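(* Let $\mathscr S$ be a rotationally symmetric, non-singular, non-stationary subdivision scheme whose action in an irregular region (a neighbourhood of an extraordinary vertex/face of valence $n$) is described by a matrix sequence $\{S_k\in\mathbb R^{N\times N},\ k\ge1\}$ and whose action in the regular patch ring $\mathbf r_{k+1}$ is described by a basic limit function vector $\boldsymbol\Phi_{k+1}(u,v)$ that satisfies the condition $\boldsymbol\Phi_{k+1}(u,v)^T\mathbf 1=\alpha_{k+1}\in\mathbb R$ (a number depending only on $k$). Moreover, let $\bar{\mathscr S}$ be a rotationally symmetric, standard, stationary subdivision scheme that in the same irregular region is associated with the matrix $S\in\mathbb R^{N\times N}$, with subdominant eigenvalue $\lambda_1$. Assume that: (i) $\bar{\mathscr S}$ is $C^1$-convergent in regular regions, with a symbol $c(\boldsymbol z)$ containing the factor $(1+z_1)(1+z_2)$, and its characteristic map is regular: for the planar ring $\overline{\boldsymbol\Psi}(u,v)^T=\overline{\boldsymbol\Phi}(u,v)^T(\boldsymbol x_1^0,\boldsymbol x_1^1)\in\mathbb R^{1\times2}$, where $\boldsymbol x_1^0,\boldsymbol x_1^1\in\mathbb R^N$ are two linearly independent eigenvectors of $S$ associated with $\lambda_1$, the sign of $\det\begin{pmatrix}\partial_u\overline{\boldsymbol\Psi}(u,v)^T\\ \partial_v\overline{\boldsymbol\Psi}(u,v)^T\end{pmatrix}$ is non-zero and constant for all $(u,v)\in\Omega_1$; (ii) in regular regions $\mathscr S$ is defined by the symbols $\{c^{(k)}(\boldsymbol z),\ k\ge1\}$, where each $c^{(k)}(\boldsymbol z)$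 contains the factor $(1+z_1)(1+z_2)$; (iii) in regular regions $\mathscr S$ is asymptotically equivalent of order $1$ to $\bar{\mathscr S}$, i.e. $\sum_{k=1}^{+\infty}2^k\|\mathcal S_{\mathbf c^{(k)}}-\mathcal S_{\mathbf c}\|_\infty<+\infty$; (iv) in the irregular region the matrices $S_k$ and $S$ satisfy, for all $k\ge1$, $\|S_k-S\|_\infty\le\frac{C}{\sigma^k}$ with $C$ some finite positive constant and $\sigma>\frac1{\lambda_1}>1$. Then the subdivision surface generated by $\mathscr S$ is normal continuous at the limit point $\mathbf r_c$ of the sequence of extraordinary vertices/faces.
   Context: **Regular regions.** A non-stationary (level-dependent) bivariate subdivision scheme acts on regular regions through real masks $\mathbf c^{(k)}=\{c^{(k)}_{\alpha}\}_{\alpha\in\mathbb Z^2}$, $k\ge1$, all with the same bounded support, via $\mathbf f^{(k+1)}=\mathcal S_{\mathbf c^{(k)}}\mathbf f^{(k)}$, $(\mathcal S_{\mathbf c^{(k)}}\mathbf f)_\alpha=\sum_{\beta\in\mathbb Z^2}c^{(k)}_{\alpha-2\beta}f_\beta$. A stationary scheme uses one mask $\mathbf c$ for all $k$. The symbol is the Laurent polynomial $c^{(k)}(\boldsymbol z)=\sum_\alpha c^{(k)}_\alpha\boldsymbol z^\alpha$, $\boldsymbol z=(z_1,z_2)$; "contains the factor" means divisibility among Laurent polynomials. For a mask $\mathbf a$, $\|\mathcal S_{\mathbf a}\|_\infty=\max\{\sum_{\beta}|a_{\alpha-2\beta}|:\alpha\in\{0,1\}^2\}$, and $\mathcal S_{\mathbf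 c^{(k)}}-\mathcal S_{\mathbf c}=\mathcal S_{\mathbf c^{(k)}-\mathbf c}$. The scheme is convergent in regular regions if for every bounded initial sequence $\mathbf f^{(1)}$ on $\mathbb Z^2$ there is $g\in C(\mathbb R^2)$ with $\lim_{\ell\to\infty}\sup_{\alpha}|g(2^{-\ell}\alpha)-f^{(\ell+1)}_\alpha|=0$, and $g$ is nonzero for at least one nonzero $\mathbf f^{(1)}$; it is $C^1$-convergent if moreover $g\in C^1(\mathbb R^2)$. For a convergent scheme, the $k$-th basic limit function $\phi_k$ is the limit function obtained by applying successively the masks $\mathbf c^{(k)},\mathbf c^{(k+1)},\dots$ to $\boldsymbol\delta=\{\delta_{0,\alpha}\}_{\alpha\in\mathbb Z^2}$; in the stationary case it is denoted $\bar\phi$. **Non-singularity (of the non-stationary scheme).** $\mathscr S$ generates a zero limit if and only if the starting sequence is the zero sequence, and its local subdivision matrices $S_k$ (below) are non-singular. **Irregular region.** One isolated extraordinary vertex or face of valence $n$ in a quadrilateral or triangular mesh is considered. Near it, step $k$ of the scheme maps the control points $\mathbf d_k\in\mathbb R^{N\times3}$ to $\mathbf d_{k+1}=S_k\mathbf d_k$. For rotationally symmetric schemes the local subdivision matrix is block-circulant, $S_k=\mathrm{circ}(B_{0,k},\dots,B_{n-1,k})$ (first block row $B_{0,k},\dots,B_{n-1,k}$, each further block row being the cyclic right shift of the previous one). For an extraordinary face with $p$ control points per sector, $N=pn$. For an extraordinary vertex one first builds the $(pn+1)\times(pn+1)$ matrix $$\tilde S_k=\begin{pmatrix}\tilde\alpha_k&\tilde{\boldsymbol\beta}_k^T&\cdots&\tilde{\boldsymbol\beta}_k^T\\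 \tilde{\boldsymbol\gamma}_k&\tilde B_{0,k}&\cdots&\tilde B_{n-1,k}\\ \vdots&&&\vdots\\ \tilde{\boldsymbol\gamma}_k&\tilde B_{1,k}&\cdots&\tilde B_{0,k}\end{pmatrix}$$ and transforms it into the block-circulant matrix $S_k$ with blocks $B_{j,k}=\begin{pmatrix}\tilde\alpha_k/n&\tilde{\boldsymbol\beta}_k^T\\ \tilde{\boldsymbol\gamma}_k/n&\tilde B_{j,k}\end{pmatrix}$, so $N=n(p+1)$. The stationary scheme is associated in the same way with a single matrix $S$. **Rings.** In the quadrilateral case $\Omega_k=\{u,v\ge0,\ 2^{1-k}\le\max\{u,v\}\le2^{2-k}\}$; in the triangular case $\Omega_k=\{u,v\ge0,\ 2^{1-k}\le u+v\le2^{2-k}\}$. Put $\mathbf D_{n,k}=\Omega_k\times\mathbb Z_n$ ($n$ copies of $\Omega_k$). $\Omega_k$ is a union of 3 cells, so $\mathbf D_{n,k}$ consists of $3n$ cells $\omega_k^{[j]}$, $j=1,\dots,3n$. The ring $\mathbf r_k:\mathbf D_{n,k}\to\mathbb R^3$ is the restriction of the subdivision surface to $\mathbf D_{n,k}$ and consists of the patches $$\mathbf r_k^{[j]}(u,v)=(\mathbf d_k^{[j]})^T\boldsymbol\Phi_k^{[j]}(u,v)=\mathbf d_k^T\boldsymbol\Phi_k(u,v),\qquad (u,v)\in\omega_k^{[j]},$$ where $\mathbf d_k^{[j]}\in\mathbb R^{P\times3}$, $P<N$, contains the control points of the patch (rows of $\mathbf d_k$), $\boldsymbol\Phi_k^{[j]}\in\mathbb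 R^P$ contains, in the corresponding order, all the basic limit functions of level $k$ (copies of $\phi_k$, one associated with each control point) whose supports intersect $\omega_k^{[j]}$, and $\boldsymbol\Phi_k\in\mathbb R^N$ is the vector assembled from these, only $P$ of whose entries are non-zero on $\omega_k^{[j]}$. $\overline{\boldsymbol\Phi}\in\mathbb R^N$ is the analogous vector for $\bar{\mathscr S}$, built from $\bar\phi$. $\mathbf 1=(1,\dots,1)^T$. A scheme convergent in regular regions is convergent in the irregular region if for all $\mathbf d_1\in\mathbb R^{N\times3}$ there is $\mathbf r_c\in\mathbb R^3$ with $\lim_{k\to\infty}\sup_{(u,v)\in\mathbf D_{n,k}}\|\mathbf r_k(u,v)-\mathbf r_c\|_\infty=0$; the limit surface is then $\mathbf r=\bigcup_{k\ge1}\mathbf r_k\cup\{\mathbf r_c\}$. **Normal continuity.** The limit surface of a convergent scheme that is $C^1$-convergent in regular regions is normal continuous at $\mathbf r_c$ if there exists a unique vector $\mathbf n_\infty$ such that $\lim_{k\to\infty}\sup_{(u,v)\in\mathbf D_{n,k}}\|\mathbf n_k(u,v)-\mathbf n_\infty\|_\infty=0$ for almost all sequences of normal vectors $\left\{\mathbf n_k(u,v)=\dfrac{\partial_u\mathbf r_k(u,v)\wedge\partial_v\mathbf r_k(u,v)}{\|\partial_u\mathbf r_k(u,v)\wedge\partial_v\mathbf r_k(u,v)\|_2},\ k\ge1\right\}$. **Standing assumptions on the stationary scheme.** $S$ has no ineffective eigenvectors (eigenvectors for nonzero eigenvalues that produce the zero ring). "Standard" means that the subdominant eigenvalue is real and double;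 precisely, the distinct eigenvalues of $S$, ordered by modulus, satisfy $1=\lambda_0>\lambda_1>|\lambda_2|\ge\dots$, where $\lambda_0=1$ is algebraically simple with eigenvector $\boldsymbol x_0=(1,\dots,1)^T$, and $\lambda_1$ is real, positive, with algebraic and geometric multiplicity both equal to $2$. *)

theory Defs
  imports
    "HOL-Analysis.Analysis"
    "HOL-Library.Poly_Mapping"
    "Jordan_Normal_Form.Jordan_Normal_Form_Uniqueness"
begin

section \<open>Subdivision in regular regions\<close>

text \<open>A mask is identified with its symbol, an element of the ring of bivariate Laurent
  polynomials; \<^term>\<open>Poly_Mapping.lookup a \<alpha>\<close> is the mask entry at \<open>\<alpha>\<close>.\<close>

type_synonym laurent2 = "(int \<times> int) \<Rightarrow>\<^sub>0 real"

definition z1 :: laurent2 where "z1 = Poly_Mapping.single (1, 0) 1"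
definition z2 :: laurent2 where "z2 = Poly_Mapping.single (0, 1) 1"

definition subdivide :: "laurent2 \<Rightarrow> (int \<times> int \<Rightarrow> real) \<Rightarrow> (int \<times> int \<Rightarrow> real)" where
  "subdivide a f \<alpha> =
     (\<Sum>\<beta> | Poly_Mapping.lookup a (\<alpha> - (\<beta> + \<beta>)) \<noteq> 0. Poly_Mapping.lookup a (\<alpha> - (\<beta> + \<beta>)) * f \<beta>)"

definition subdivision_norm :: "laurent2 \<Rightarrow> real" where
  "subdivision_norm a = Max ((\<lambda>\<alpha>.
     \<Sum>\<beta> | Poly_Mapping.lookup a (\<alpha> - (\<beta> + \<beta>)) \<noteq> 0. \<bar>Poly_Mapping.lookup a (\<alpha> - (\<beta> + \<beta>))\<bar>) ` ({0, 1} \<times> {0, 1}))"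

text \<open>\<open>iterate_masks c k l f\<close> is the result of applying the \<open>l\<close> masks
  \<open>c k, \<dots>, c (k + l - 1)\<close> to \<open>f\<close>; for \<open>k = 1\<close> it is the sequence \<open>f\<^bsup>(l+1)\<^esup>\<close>.\<close>

primrec iterate_masks ::
    "(nat \<Rightarrow> laurent2) \<Rightarrow> nat \<Rightarrow> nat \<Rightarrow> (int \<times> int \<Rightarrow> real) \<Rightarrow> (int \<times> int \<Rightarrow> real)" where
  "iterate_masks c k 0 f = f"
| "iterate_masks c k (Suc l) f = subdivide (c (k + l)) (iterate_masks c k l f)"

definition grid_point :: "nat \<Rightarrow> int \<times> int \<Rightarrow> real \<times> real" where
  "grid_point l \<alpha> = (of_int (fst \<alpha>) / 2 ^ l, of_int (snd \<alpha>) / 2 ^ l)"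

definition has_limit_function ::
    "(nat \<Rightarrow> laurent2) \<Rightarrow> nat \<Rightarrow> (int \<times> int \<Rightarrow> real) \<Rightarrow> (real \<times> real \<Rightarrow> real) \<Rightarrow> bool" where
  "has_limit_function c k f g \<longleftrightarrow>
     continuous_on UNIV g \<and>
     uniform_limit UNIV (\<lambda>l \<alpha>. g (grid_point l \<alpha>) - iterate_masks c k l f \<alpha>) (\<lambda>\<alpha>. 0) sequentially"

definition C1_function :: "(real \<times> real \<Rightarrow> real) \<Rightarrow> bool" where
  "C1_function g \<longleftrightarrow> (\<exists>g' :: real \<times> real \<Rightarrow> (real \<times> real) \<Rightarrow>\<^sub>L real.
     continuous_on UNIV g' \<and> (\<forall>x. (g has_derivative blinfun_apply (g' x)) (at x)))"

definition convergent_regular :: "(nat \<Rightarrow> laurent2) \<Rightarrow> bool" where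
  "convergent_regular c \<longleftrightarrow>
     (\<forall>f. bounded (range f) \<longrightarrow> (\<exists>g. has_limit_function c 1 f g)) \<and>
     (\<exists>f g. bounded (range f) \<and> f \<noteq> (\<lambda>\<alpha>. 0) \<and> has_limit_function c 1 f g \<and> g \<noteq> (\<lambda>x. 0))"

definition C1_convergent_regular :: "(nat \<Rightarrow> laurent2) \<Rightarrow> bool" where
  "C1_convergent_regular c \<longleftrightarrow>
     convergent_regular c \<and>
     (\<forall>f g. bounded (range f) \<longrightarrow> has_limit_function c 1 f g \<longrightarrow> C1_function g)"

definition delta :: "int \<times> int \<Rightarrow> real" where
  "delta \<alpha> = (if \<alpha> = 0 then 1 else 0)"

text \<open>A limit function is unique, since it is continuous and determined on the dyadic points.\<close>

definition basic_limit_function :: "(nat \<Rightarrow> laurent2) \<Rightarrow> nat \<Rightarrow> real \<times> real \<Rightarrow> real" where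
  "basic_limit_function c k = (THE g. has_limit_function c k delta g)"

definition same_bounded_support :: "(nat \<Rightarrow> laurent2) \<Rightarrow> bool" where
  "same_bounded_support c \<longleftrightarrow> (\<exists>A. finite A \<and> (\<forall>k\<ge>1. Poly_Mapping.keys (c k) \<subseteq> A))"

section \<open>Local subdivision matrices\<close>

datatype irregularity = Extraordinary_Face | Extraordinary_Vertex
datatype mesh = Quadrilateral | Triangular

text \<open>Block entry \<open>(i, j)\<close> is \<open>B ((j - i) mod n)\<close>; blocks have size \<open>m \<times> m\<close>.\<close>

definition circ :: "nat \<Rightarrow> nat \<Rightarrow> (nat \<Rightarrow> real Matrix.mat) \<Rightarrow> real Matrix.mat" where
  "circ n m B = Matrix.mat (n * m) (n * m)
     (\<lambda>(i, j). B ((j div m + n - i div m) mod n) $$ (i mod m, j mod m))"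

definition vertex_matrix ::
    "nat \<Rightarrow> nat \<Rightarrow> real \<Rightarrow> real Matrix.vec \<Rightarrow> real Matrix.vec \<Rightarrow> (nat \<Rightarrow> real Matrix.mat) \<Rightarrow> real Matrix.mat" where
  "vertex_matrix n p a b g B = four_block_mat
     (Matrix.mat 1 1 (\<lambda>_. a)) (Matrix.mat 1 (n * p) (\<lambda>(_, j). Matrix.vec_index b (j mod p)))
     (Matrix.mat (n * p) 1 (\<lambda>(i, _). Matrix.vec_index g (i mod p))) (circ n p B)"

definition vertex_block ::
    "nat \<Rightarrow> nat \<Rightarrow> real \<Rightarrow> real Matrix.vec \<Rightarrow> real Matrix.vec \<Rightarrow> real Matrix.mat \<Rightarrow> real Matrix.mat" where
  "vertex_block n p a b g B = four_block_mat
     (Matrix.mat 1 1 (\<lambda>_. a / real n)) (Matrix.mat 1 p (\<lambda>(_, j). Matrix.vec_index b j))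
     (Matrix.mat p 1 (\<lambda>(i, _). Matrix.vec_index g i / real n)) B"

fun local_dim :: "irregularity \<Rightarrow> nat \<Rightarrow> nat \<Rightarrow> nat" where
  "local_dim Extraordinary_Face n p = n * p"
| "local_dim Extraordinary_Vertex n p = n * (p + 1)"

text \<open>\<open>local_matrices E n p T S\<close>: the rotationally symmetric scheme acts on the actual control
  points by \<open>T\<close>, and \<open>S\<close> is the block-circulant matrix associated with it. For a face the two
  coincide. For a vertex, \<open>T\<close> has size \<open>n * p + 1\<close>, whereas in \<open>S\<close> the extraordinary vertex is
  repeated \<open>n\<close> times, so that \<open>S\<close> has \<open>n\<close> equal columns.\<close>

fun local_matrices ::
    "irregularity \<Rightarrow> nat \<Rightarrow> nat \<Rightarrow> real Matrix.mat \<Rightarrow> real Matrix.mat \<Rightarrow> bool" where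
  "local_matrices Extraordinary_Face n p T S \<longleftrightarrow>
     (\<exists>B. (\<forall>j<n. B j \<in> carrier_mat p p) \<and> S = circ n p B \<and> T = S)"
| "local_matrices Extraordinary_Vertex n p T S \<longleftrightarrow>
     (\<exists>a b g B. b \<in> carrier_vec p \<and> g \<in> carrier_vec p \<and> (\<forall>j<n. B j \<in> carrier_mat p p) \<and>
        T = vertex_matrix n p a b g B \<and>
        S = circ n (p + 1) (\<lambda>j. vertex_block n p a b g (B j)))"

definition matrix_norm_inf :: "real Matrix.mat \<Rightarrow> real" where
  "matrix_norm_inf A = Max ((\<lambda>i. \<Sum>j<dim_col A. \<bar>A $$ (i, j)\<bar>) ` {..<dim_row A})"

text \<open>In the vertex case the local matrices that are required to be non-singular are the
  ones acting on the actual control points: the block-circulant ones always have equal columns.\<close>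

definition nonsingular_scheme :: "(nat \<Rightarrow> laurent2) \<Rightarrow> (nat \<Rightarrow> real Matrix.mat) \<Rightarrow> bool" where
  "nonsingular_scheme c T \<longleftrightarrow>
     (\<forall>f. bounded (range f) \<longrightarrow> (has_limit_function c 1 f (\<lambda>x. 0) \<longleftrightarrow> f = (\<lambda>\<alpha>. 0))) \<and>
     (\<forall>k\<ge>1. invertible_mat (T k))"

text \<open>\<open>Polynomial.order \<mu> (char_poly S)\<close> is the algebraic multiplicity of \<open>\<mu>\<close>, and
  \<open>dim_gen_eigenspace S \<mu> 1\<close> is the dimension of the eigenspace.\<close>

definition standard_matrix :: "real Matrix.mat \<Rightarrow> real \<Rightarrow> bool" where
  "standard_matrix S lam1 \<longleftrightarrow>
     eigenvector S (Matrix.vec (dim_row S) (\<lambda>_. 1)) 1 \<and>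
     Polynomial.order 1 (char_poly S) = 1 \<and>
     0 < lam1 \<and> lam1 < 1 \<and>
     Polynomial.order lam1 (char_poly S) = 2 \<and> dim_gen_eigenspace S lam1 1 = 2 \<and>
     (\<forall>\<mu> :: complex. eigenvalue (map_mat complex_of_real S) \<mu> \<longrightarrow>
        \<mu> \<noteq> 1 \<longrightarrow> \<mu> \<noteq> complex_of_real lam1 \<longrightarrow> cmod \<mu> < lam1)"

section \<open>Rings\<close>

text \<open>Here \<open>2 / 2 ^ k\<close> is the mesh width \<open>2\<^bsup>1-k\<^esup>\<close> of level \<open>k\<close>.\<close>

fun Omega :: "mesh \<Rightarrow> nat \<Rightarrow> (real \<times> real) set" where
  "Omega Quadrilateral k =
     {(u, v). 0 \<le> u \<and> 0 \<le> v \<and> 2 / 2 ^ k \<le> max u v \<and> max u v \<le> 2 * (2 / 2 ^ k)}"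
| "Omega Triangular k =
     {(u, v). 0 \<le> u \<and> 0 \<le> v \<and> 2 / 2 ^ k \<le> u + v \<and> u + v \<le> 2 * (2 / 2 ^ k)}"

fun cell :: "mesh \<Rightarrow> nat \<Rightarrow> nat \<Rightarrow> (real \<times> real) set" where
  "cell Quadrilateral k j = (let h = 2 / 2 ^ k in
     if j = 0 then {h..2 * h} \<times> {0..h}
     else if j = 1 then {h..2 * h} \<times> {h..2 * h}
     else {0..h} \<times> {h..2 * h})"
| "cell Triangular k j = (let h = 2 / 2 ^ k in
     if j = 0 then {(u, v). h \<le> u \<and> 0 \<le> v \<and> u + v \<le> 2 * h}
     else if j = 1 then {(u, v). u \<le> h \<and> v \<le> h \<and> h \<le> u + v}
     else {(u, v). 0 \<le> u \<and> h \<le> v \<and> u + v \<le> 2 * h})"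

lemma Omega_eq_cells: "Omega M k = (\<Union>j<3. cell M k j)"
proof (rule Set.set_eqI)
  fix x :: "real \<times> real"
  obtain u v where x: "x = (u, v)" by (cases x)
  define h :: real where "h = 2 / 2 ^ k"
  have h: "h > 0" by (simp add: h_def)
  have "x \<in> (\<Union>j<3. cell M k j) \<longleftrightarrow> x \<in> cell M k 0 \<or> x \<in> cell M k 1 \<or> x \<in> cell M k 2"
    by (simp add: numeral_3_eq_3 lessThan_Suc numeral_2_eq_2) blast
  also have "\<dots> \<longleftrightarrow> x \<in> Omega M k"
  proof (cases M)
    case Quadrilateral
    show ?thesis
      unfolding Quadrilateral x Omega.simps cell.simps Let_def h_def[symmetric] max_def
      using h by (simp, argo)
  next
    case Triangular
    show ?thesis
      unfolding Triangular x Omega.simps cell.simps Let_def h_def[symmetric]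
      using h by (simp, argo)
  qed
  finally show "x \<in> Omega M k \<longleftrightarrow> x \<in> (\<Union>j<3. cell M k j)" ..
qed

text \<open>The domain \<open>\<Omega>\<^sub>k \<times> \<int>\<^sub>n\<close> of a ring as the family of its \<open>3 n\<close> closed cells: \<open>(s, j, x)\<close> is the
  point \<open>x\<close> of the cell \<open>j\<close> in the sector \<open>s\<close>.\<close>

definition ring_domain :: "mesh \<Rightarrow> nat \<Rightarrow> nat \<Rightarrow> (nat \<times> nat \<times> real \<times> real) set" where
  "ring_domain M n k = {(s, j, x). s < n \<and> j < 3 \<and> x \<in> cell M k j}"

text \<open>A layout says which of the \<open>N\<close> control points belong to the patch on cell \<open>j\<close> of sector
  \<open>s\<close>, and at which position \<open>\<alpha>\<close> of the regular lattice of that patch they lie: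
  \<open>L s j i = Some \<alpha>\<close> if control point \<open>i\<close> lies at \<open>\<alpha>\<close>, and \<open>L s j i = None\<close> if it is not one
  of the \<open>P\<close> control points of the patch. The associated basic limit function is the
  copy \<open>\<phi>\<^sub>k(2\<^bsup>k-1\<^esup> x - \<alpha>)\<close> of \<open>\<phi>\<^sub>k\<close>.\<close>

type_synonym layout = "nat \<Rightarrow> nat \<Rightarrow> nat \<Rightarrow> (int \<times> int) option"

definition lattice_copy :: "(real \<times> real \<Rightarrow> real) \<Rightarrow> nat \<Rightarrow> int \<times> int \<Rightarrow> real \<times> real \<Rightarrow> real" where
  "lattice_copy \<phi> k \<alpha> x = \<phi> ((2 ^ k / 2) *\<^sub>R x - grid_point 0 \<alpha>)"

definition valid_layout :: "nat \<Rightarrow> nat \<Rightarrow> nat \<Rightarrow> layout \<Rightarrow> bool" where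
  "valid_layout n N P L \<longleftrightarrow> P < N \<and>
     (\<forall>s<n. \<forall>j<3. dom (L s j) \<subseteq> {..<N} \<and> card (dom (L s j)) = P \<and> inj_on (L s j) (dom (L s j)))"

text \<open>Every copy of \<open>\<phi>\<close> that does not vanish on a cell belongs to a control point of its patch.
  Supports that only touch the cell, without contributing to the patch, need not be listed.\<close>

definition covers_supports :: "mesh \<Rightarrow> nat \<Rightarrow> layout \<Rightarrow> nat \<Rightarrow> (real \<times> real \<Rightarrow> real) \<Rightarrow> bool" where
  "covers_supports M n L k \<phi> \<longleftrightarrow>
     (\<forall>s<n. \<forall>j<3. \<forall>\<alpha>. (\<exists>x\<in>cell M k j. lattice_copy \<phi> k \<alpha> x \<noteq> 0) \<longrightarrow> \<alpha> \<in> ran (L s j))"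

text \<open>The \<open>i\<close>-th entry of the vector \<open>\<Phi>\<^sub>k\<close> on cell \<open>j\<close> of sector \<open>s\<close>, when the masks are \<open>c\<close>.
  As a formula in \<open>x\<close> it makes sense on the whole plane, so partial derivatives
  may be taken at boundary points of the cell.\<close>

definition Phi :: "layout \<Rightarrow> (nat \<Rightarrow> laurent2) \<Rightarrow> nat \<Rightarrow> nat \<Rightarrow> nat \<Rightarrow> nat \<Rightarrow> real \<times> real \<Rightarrow> real" where
  "Phi L c k s j i x =
     (case L s j i of None \<Rightarrow> 0 | Some \<alpha> \<Rightarrow> lattice_copy (basic_limit_function c k) k \<alpha> x)"

primrec control_points ::
    "nat \<Rightarrow> (nat \<Rightarrow> real Matrix.mat) \<Rightarrow> (nat \<Rightarrow> real^3) \<Rightarrow> nat \<Rightarrow> (nat \<Rightarrow> real^3)" where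
  "control_points N S d 0 = d"
| "control_points N S d (Suc k) =
     (if k = 0 then d
      else (\<lambda>i. \<Sum>l<N. (S k $$ (i, l)) *\<^sub>R control_points N S d k l))"

definition ring_patch ::
    "nat \<Rightarrow> layout \<Rightarrow> (nat \<Rightarrow> laurent2) \<Rightarrow> (nat \<Rightarrow> real Matrix.mat) \<Rightarrow> (nat \<Rightarrow> real^3) \<Rightarrow>
     nat \<Rightarrow> nat \<Rightarrow> nat \<Rightarrow> real \<times> real \<Rightarrow> real^3" where
  "ring_patch N L c S d k s j x = (\<Sum>i<N. Phi L c k s j i x *\<^sub>R control_points N S d k i)"

definition no_ineffective_eigenvectors ::
    "mesh \<Rightarrow> nat \<Rightarrow> nat \<Rightarrow> layout \<Rightarrow> (nat \<Rightarrow> laurent2) \<Rightarrow> real Matrix.mat \<Rightarrow> bool" where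
  "no_ineffective_eigenvectors M n N L c S \<longleftrightarrow>
     (\<forall>\<mu> w. \<mu> \<noteq> 0 \<longrightarrow> eigenvector (map_mat complex_of_real S) w \<mu> \<longrightarrow>
        (\<exists>(s, j, x)\<in>ring_domain M n 1. (\<Sum>i<N. Matrix.vec_index w i * of_real (Phi L c 1 s j i x)) \<noteq> 0))"

section \<open>Convergence and normal continuity in the irregular region\<close>

definition partial_u :: "(real \<times> real \<Rightarrow> 'a::real_normed_vector) \<Rightarrow> real \<times> real \<Rightarrow> 'a" where
  "partial_u F x = vector_derivative (\<lambda>t. F (t, snd x)) (at (fst x))"

definition partial_v :: "(real \<times> real \<Rightarrow> 'a::real_normed_vector) \<Rightarrow> real \<times> real \<Rightarrow> 'a" where
  "partial_v F x = vector_derivative (\<lambda>t. F (fst x, t)) (at (snd x))"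

text \<open>The Jacobian determinant of the planar ring \<open>\<Psi>\<^sup>T = \<Phi>\<^sup>T (y0, y1)\<close>.\<close>

definition planar_component ::
    "nat \<Rightarrow> layout \<Rightarrow> (nat \<Rightarrow> laurent2) \<Rightarrow> real Matrix.vec \<Rightarrow> nat \<Rightarrow> nat \<Rightarrow> real \<times> real \<Rightarrow> real" where
  "planar_component N L c y s j x = (\<Sum>i<N. Phi L c 1 s j i x * Matrix.vec_index y i)"

definition characteristic_det ::
    "nat \<Rightarrow> layout \<Rightarrow> (nat \<Rightarrow> laurent2) \<Rightarrow> real Matrix.vec \<Rightarrow> real Matrix.vec \<Rightarrow>
     nat \<Rightarrow> nat \<Rightarrow> real \<times> real \<Rightarrow> real" where
  "characteristic_det N L c y0 y1 s j x =
     partial_u (planar_component N L c y0 s j) x * partial_v (planar_component N L c y1 s j) x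
     - partial_u (planar_component N L c y1 s j) x * partial_v (planar_component N L c y0 s j) x"

definition regular_characteristic_map ::
    "mesh \<Rightarrow> nat \<Rightarrow> nat \<Rightarrow> layout \<Rightarrow> (nat \<Rightarrow> laurent2) \<Rightarrow> real Matrix.vec \<Rightarrow> real Matrix.vec \<Rightarrow> bool" where
  "regular_characteristic_map M n N L c y0 y1 \<longleftrightarrow>
     (\<exists>e\<noteq>0. \<forall>(s, j, x)\<in>ring_domain M n 1. sgn (characteristic_det N L c y0 y1 s j x) = e)"

definition convergent_irregular ::
    "mesh \<Rightarrow> nat \<Rightarrow> nat \<Rightarrow> layout \<Rightarrow> (nat \<Rightarrow> laurent2) \<Rightarrow> (nat \<Rightarrow> real Matrix.mat) \<Rightarrow> bool" where
  "convergent_irregular M n N L c S \<longleftrightarrow>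
     (\<forall>d. \<exists>rc. \<forall>\<epsilon>>0. \<forall>\<^sub>F k in sequentially. \<forall>(s, j, x)\<in>ring_domain M n k.
        infnorm (ring_patch N L c S d k s j x - rc) < \<epsilon>)"

definition normal_direction :: "(real \<times> real \<Rightarrow> real^3) \<Rightarrow> real \<times> real \<Rightarrow> real^3" where
  "normal_direction F x = cross3 (partial_u F x) (partial_v F x)"

definition unit_normal :: "(real \<times> real \<Rightarrow> real^3) \<Rightarrow> real \<times> real \<Rightarrow> real^3" where
  "unit_normal F x = normal_direction F x /\<^sub>R norm (normal_direction F x)"

text \<open>The sequences of normals are parametrised by the initial control points, an element of the
  \<open>3 N\<close>-dimensional space of maps \<open>{..<N} \<rightarrow> \<real>\<^sup>3\<close>, and ``almost all'' refers to Lebesgue measure on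
  that space. The first conjunct says that the normals are well defined from some level on.\<close>

definition normal_continuous ::
    "mesh \<Rightarrow> nat \<Rightarrow> nat \<Rightarrow> layout \<Rightarrow> (nat \<Rightarrow> laurent2) \<Rightarrow> (nat \<Rightarrow> real Matrix.mat) \<Rightarrow> bool" where
  "normal_continuous M n N L c S \<longleftrightarrow>
     (AE d in PiM {..<N} (\<lambda>_. lborel).
        (\<forall>\<^sub>F k in sequentially. \<forall>(s, j, x)\<in>ring_domain M n k.
            normal_direction (ring_patch N L c S d k s j) x \<noteq> 0) \<and>
        (\<exists>!n_inf. \<forall>\<epsilon>>0. \<forall>\<^sub>F k in sequentially. \<forall>(s, j, x)\<in>ring_domain M n k.
            infnorm (unit_normal (ring_patch N L c S d k s j) x - n_inf) < \<epsilon>))"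

end

theory Submission
  imports Defs "Jordan_Normal_Form.Spectral_Radius" "Jordan_Normal_Form.Jordan_Normal_Form_Existence"
begin

text \<open>In the regular region, write each mask as the stationary one plus a deviation. Duhamel's formula
  expresses the limit functions as those of the stationary scheme plus a series of dilated
  stationary limit functions; the weights \<open>2\<^sup>k\<close> of the asymptotic equivalence are exactly what makes
  the series of the derivatives converge, so that \<open>\<phi>\<^sub>k\<close> tends to the stationary \<open>\<phi>\<close> in \<open>C\<^sup>1\<close>.

  In the irregular region, the same perturbation argument for matrices, with
  \<open>\<sigma> > 1 / \<lambda>\<^sub>1\<close>, shows that the control points are \<open>q\<^sub>k 1 + \<lambda>\<^sub>1\<^sup>k (x\<^sub>1\<^sup>0 a + x\<^sub>1\<^sup>1 b + o(1))\<close>, where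
  \<open>a\<close> and \<open>b\<close> are linear in the initial control points. Non-singularity makes \<open>x\<^sub>1\<^sup>0\<close> and \<open>x\<^sub>1\<^sup>1\<close> reachable
  at every level, so that these two linear maps are independent and \<open>a \<times> b\<close> vanishes only on a null set.
  Since the entries of \<open>\<Phi>\<^sub>k\<close> have a constant sum, \<open>q\<^sub>k\<close> does not contribute to the derivatives of the
  rings, whose cross product is therefore asymptotic to \<open>a \<times> b\<close> times the Jacobian of the
  characteristic map.\<close>

section \<open>Regular regions\<close>

text \<open>No rate is known for the stationary scheme: its error on \<open>delta\<close> merely
  tends to zero, so the Duhamel series is passed to the limit by domination. For the matrices,
  \<open>S\<close> need not be diagonalisable and the functionals dual to the three dominant
  eigenvectors need not be left eigenvectors, so the dominant coordinates are fed by the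
  complementary part. The spectrum of that part is found by deflation, from the algebraic
  multiplicities, and an adapted norm turns it into a strict contraction by some
  \<open>\<rho>\<close> with \<open>1 / \<sigma> < \<rho> < lam\<close>; the same
  \<open>\<rho>\<close> then bounds the decay of the perturbation. Independence of the two limit
  functionals cannot be seen at level 1, where the perturbation may be large. It is proved from a
  late level \<open>k0\<close>, where the error is of order \<open>\<theta> ^ k0\<close>, and pulled
  back to level 1; hence all constants must be uniform in \<open>k0\<close>. For a vertex the
  block-circulant matrices are singular, so the pull-back is done through the smaller invertible
  matrices \<open>T\<close>.\<close>

lemma double_minus_eq: "(\<beta> :: int \<times> int) + \<beta> = \<gamma> + \<gamma> \<longleftrightarrow> \<beta> = \<gamma>"
  by (cases \<beta>; cases \<gamma>) auto

lemma finite_mask_support: "finite {\<beta>. Poly_Mapping.lookup (a :: laurent2) (\<alpha> - (\<beta> + \<beta>)) \<noteq> 0}"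
proof (rule finite_imageD)
  show "finite ((\<lambda>\<beta>. \<alpha> - (\<beta> + \<beta>)) ` {\<beta>. Poly_Mapping.lookup a (\<alpha> - (\<beta> + \<beta>)) \<noteq> 0})"
    by (rule finite_subset[OF _ finite_keys[of a]]) (auto simp: in_keys_iff)
  show "inj_on (\<lambda>\<beta>. \<alpha> - (\<beta> + \<beta>)) {\<beta>. Poly_Mapping.lookup a (\<alpha> - (\<beta> + \<beta>)) \<noteq> 0}"
    by (auto simp: inj_on_def double_minus_eq)
qed

lemma subdivide_eq:
  assumes "finite B" "{\<beta>. Poly_Mapping.lookup a (\<alpha> - (\<beta> + \<beta>)) \<noteq> 0} \<subseteq> B"
  shows "subdivide a f \<alpha> = (\<Sum>\<beta>\<in>B. Poly_Mapping.lookup a (\<alpha> - (\<beta> + \<beta>)) * f \<beta>)"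
  unfolding subdivide_def using assms by (intro sum.mono_neutral_left) auto

lemma subdivide_add: "subdivide a (\<lambda>\<beta>. f \<beta> + g \<beta>) \<alpha> = subdivide a f \<alpha> + subdivide a g \<alpha>"
  by (simp add: subdivide_def distrib_left sum.distrib)

lemma subdivide_sum:
  "subdivide a (\<lambda>\<beta>. \<Sum>i\<in>I. b i * F i \<beta>) \<alpha> = (\<Sum>i\<in>I. b i * subdivide a (F i) \<alpha>)"
  unfolding subdivide_def by (simp add: sum_distrib_left mult.left_commute) (rule sum.swap)

lemma subdivide_diff_mask: "subdivide (a - b) f \<alpha> = subdivide a f \<alpha> - subdivide b f \<alpha>"
proof -
  \<comment> \<open>Entries of \<open>a - b\<close> may cancel, so its support can be smaller than
    the union; all three sums are taken over the union.\<close>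
  define B where "B = {\<beta>. Poly_Mapping.lookup a (\<alpha> - (\<beta> + \<beta>)) \<noteq> 0} \<union> {\<beta>. Poly_Mapping.lookup b (\<alpha> - (\<beta> + \<beta>)) \<noteq> 0}"
  have B: "finite B" by (simp add: B_def finite_mask_support)
  show ?thesis
    by (subst (1 2 3) subdivide_eq[OF B])
      (auto simp: B_def lookup_minus left_diff_distrib sum_subtractf)
qed

text \<open>The mask index \<open>\<alpha> - (\<beta> + \<beta>)\<close> counts a coarse shift
  twice: shifting the data by \<open>\<gamma>\<close> shifts the refined data by
  \<open>\<gamma> + \<gamma>\<close>.\<close>

lemma subdivide_shift: "subdivide a (\<lambda>\<beta>. f (\<beta> - \<gamma>)) \<alpha> = subdivide a f (\<alpha> - (\<gamma> + \<gamma>))"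
  unfolding subdivide_def
  by (rule sum.reindex_bij_witness[of _ "\<lambda>\<beta>. \<beta> + \<gamma>" "\<lambda>\<beta>. \<beta> - \<gamma>"]) (auto simp: algebra_simps)

text \<open>A row sum depends only on the parities of \<open>\<alpha>\<close>, because an even shift
  of \<open>\<alpha>\<close> merely reindexes it. Hence the maximum over four representatives bounds
  every row.\<close>

lemma mask_row_le_subdivision_norm:
  "(\<Sum>\<beta> | Poly_Mapping.lookup a (\<alpha> - (\<beta> + \<beta>)) \<noteq> 0. \<bar>Poly_Mapping.lookup a (\<alpha> - (\<beta> + \<beta>))\<bar>) \<le> subdivision_norm a"
proof -
  define \<gamma> where "\<gamma> = (fst \<alpha> div 2, snd \<alpha> div 2)"
  define \<epsilon> where "\<epsilon> = (fst \<alpha> mod 2, snd \<alpha> mod 2)"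
  have \<alpha>: "\<alpha> = \<epsilon> + (\<gamma> + \<gamma>)" by (cases \<alpha>) (simp add: \<epsilon>_def \<gamma>_def)
  have "\<epsilon> \<in> {0, 1} \<times> {0, 1}" by (auto simp: \<epsilon>_def)
  then have "(\<Sum>\<beta> | Poly_Mapping.lookup a (\<epsilon> - (\<beta> + \<beta>)) \<noteq> 0. \<bar>Poly_Mapping.lookup a (\<epsilon> - (\<beta> + \<beta>))\<bar>) \<le> subdivision_norm a"
    unfolding subdivision_norm_def by (intro Max_ge) auto
  moreover have "(\<Sum>\<beta> | Poly_Mapping.lookup a (\<alpha> - (\<beta> + \<beta>)) \<noteq> 0. \<bar>Poly_Mapping.lookup a (\<alpha> - (\<beta> + \<beta>))\<bar>) =
      (\<Sum>\<beta> | Poly_Mapping.lookup a (\<epsilon> - (\<beta> + \<beta>)) \<noteq> 0. \<bar>Poly_Mapping.lookup a (\<epsilon> - (\<beta> + \<beta>))\<bar>)"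
    unfolding \<alpha>
    by (rule sum.reindex_bij_witness[of _ "\<lambda>\<beta>. \<beta> + \<gamma>" "\<lambda>\<beta>. \<beta> - \<gamma>"]) (auto simp: algebra_simps)
  ultimately show ?thesis by simp
qed

lemma subdivision_norm_nonneg: "0 \<le> subdivision_norm a"
  by (rule order_trans[OF _ mask_row_le_subdivision_norm[of a 0]]) (simp add: sum_nonneg)

lemma abs_subdivide_le:
  assumes "\<And>\<beta>. \<bar>f \<beta>\<bar> \<le> M"
  shows "\<bar>subdivide a f \<alpha>\<bar> \<le> subdivision_norm a * M"
proof -
  have M: "0 \<le> M" using assms[of 0] by linarith
  have "\<bar>subdivide a f \<alpha>\<bar> \<le> (\<Sum>\<beta> | Poly_Mapping.lookup a (\<alpha> - (\<beta> + \<beta>)) \<noteq> 0. \<bar>Poly_Mapping.lookup a (\<alpha> - (\<beta> + \<beta>))\<bar> * M)"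
    unfolding subdivide_def
    by (rule order_trans[OF sum_abs]) (auto simp: abs_mult intro!: sum_mono mult_left_mono assms)
  also have "\<dots> \<le> subdivision_norm a * M"
    unfolding sum_distrib_right[symmetric] using M by (intro mult_right_mono mask_row_le_subdivision_norm)
  finally show ?thesis .
qed

section \<open>Iterated subdivision on the refined lattices\<close>

lemma grid_point_diff: "grid_point m \<alpha> - grid_point m \<beta> = grid_point m (\<alpha> - \<beta>)"
  by (simp add: grid_point_def diff_divide_distrib)

text \<open>Each refinement doubles indices, so this is where the coarse lattice point sits after
  \<open>m\<close> steps.\<close>

definition dilate :: "nat \<Rightarrow> int \<times> int \<Rightarrow> int \<times> int" where
  "dilate m \<beta> = (2 ^ m * fst \<beta>, 2 ^ m * snd \<beta>)"

lemma grid_point_dilate: "grid_point m (dilate m \<beta>) = grid_point 0 \<beta>"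
  by (simp add: grid_point_def dilate_def)

lemma dilate_Suc: "dilate (Suc m) \<beta> = dilate m \<beta> + dilate m \<beta>"
  by (simp add: dilate_def algebra_simps)

definition lattice_box :: "real \<Rightarrow> real \<times> real \<Rightarrow> (int \<times> int) set" where
  "lattice_box r x = {\<beta>. \<bar>fst x - of_int (fst \<beta>)\<bar> \<le> r \<and> \<bar>snd x - of_int (snd \<beta>)\<bar> \<le> r}"

text \<open>The bound depends on \<open>r\<close> alone; this is what makes later estimates uniform
  over the plane.\<close>

lemma lattice_box_finite_card:
  assumes "0 \<le> r"
  shows "finite (lattice_box r x)" "real (card (lattice_box r x)) \<le> (2 * r + 1)\<^sup>2"
proof -
  define I where "I t = {\<lceil>t - r\<rceil>..\<lfloor>t + r\<rfloor>}" for t :: real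
  have eq: "lattice_box r x = I (fst x) \<times> I (snd x)"
    by (auto simp: lattice_box_def I_def abs_le_iff ceiling_le_iff le_floor_iff)
  then show "finite (lattice_box r x)" by (simp add: I_def)
  have "real (card (I t)) \<le> 2 * r + 1" for t
  proof -
    have "real (card (I t)) = real_of_int (max 0 (\<lfloor>t + r\<rfloor> + 1 - \<lceil>t - r\<rceil>))" by (simp add: I_def)
    also have "\<dots> \<le> 2 * r + 1"
    proof (cases "0 \<le> \<lfloor>t + r\<rfloor> + 1 - \<lceil>t - r\<rceil>")
      case True
      then have "real_of_int (max 0 (\<lfloor>t + r\<rfloor> + 1 - \<lceil>t - r\<rceil>)) = real_of_int \<lfloor>t + r\<rfloor> + 1 - real_of_int \<lceil>t - r\<rceil>" by simp
      then show ?thesis by linarith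
    qed (use assms in auto)
    finally show ?thesis .
  qed
  then have "real (card (I (fst x))) * real (card (I (snd x))) \<le> (2 * r + 1) * (2 * r + 1)"
    using assms by (intro mult_mono) auto
  then show "real (card (lattice_box r x)) \<le> (2 * r + 1)\<^sup>2"
    by (simp add: eq card_cartesian_product power2_eq_square)
qed

text \<open>One step turns a support radius \<open>r\<close> into \<open>2 * r + R\<close>; starting
  from 0 this gives \<open>R * (2 ^ m - 1)\<close>. After rescaling by \<open>2 ^ m\<close> the
  radius stays at most \<open>R\<close> on all levels.\<close>

lemma funpow_subdivide_delta_support:
  fixes R :: int
  assumes R: "\<forall>\<alpha>\<in>Poly_Mapping.keys a. \<bar>fst \<alpha>\<bar> \<le> R \<and> \<bar>snd \<alpha>\<bar> \<le> R"
    and nz: "(subdivide a ^^ m) delta \<alpha> \<noteq> 0"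
  shows "\<bar>fst \<alpha>\<bar> \<le> R * (2 ^ m - 1) \<and> \<bar>snd \<alpha>\<bar> \<le> R * (2 ^ m - 1)"
  using nz
proof (induction m arbitrary: \<alpha>)
  case 0
  then show ?case by (auto simp: delta_def split: if_splits)
next
  case (Suc m)
  from Suc.prems have "\<exists>\<beta>. Poly_Mapping.lookup a (\<alpha> - (\<beta> + \<beta>)) \<noteq> 0 \<and> (subdivide a ^^ m) delta \<beta> \<noteq> 0"
    unfolding funpow.simps comp_apply subdivide_def[of a "(subdivide a ^^ m) delta"]
    by (metis (mono_tags, lifting) mult_zero_right sum.neutral mem_Collect_eq)
  then obtain \<beta> where \<beta>: "\<alpha> - (\<beta> + \<beta>) \<in> Poly_Mapping.keys a" "(subdivide a ^^ m) delta \<beta> \<noteq> 0"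
    by (auto simp: in_keys_iff)
  from bspec[OF R \<beta>(1)] Suc.IH[OF \<beta>(2)] show ?case
    by (auto simp: algebra_simps abs_le_iff)
qed

text \<open>Linearity and the shift rule express the iterate by translates of the response to
  \<open>delta\<close>. Since \<open>f\<close> may have infinite support, only the translates
  reaching \<open>\<alpha>\<close> are summed; admitting any finite superset \<open>B\<close> lets
  the induction change the index set.\<close>

lemma funpow_subdivide_expansion:
  fixes R :: int
  assumes R: "\<forall>\<alpha>\<in>Poly_Mapping.keys a. \<bar>fst \<alpha>\<bar> \<le> R \<and> \<bar>snd \<alpha>\<bar> \<le> R"
    and B: "finite B" "{\<beta>. (subdivide a ^^ m) delta (\<alpha> - dilate m \<beta>) \<noteq> 0} \<subseteq> B"
  shows "(subdivide a ^^ m) f \<alpha> = (\<Sum>\<beta>\<in>B. f \<beta> * (subdivide a ^^ m) delta (\<alpha> - dilate m \<beta>))"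
  using B
proof (induction m arbitrary: \<alpha> B)
  case 0
  then have "\<alpha> \<in> B" by (auto simp: dilate_def delta_def)
  moreover have "(\<Sum>\<beta>\<in>B. f \<beta> * delta (\<alpha> - \<beta>)) = (\<Sum>\<beta>\<in>B. if \<alpha> = \<beta> then f \<beta> else 0)"
    by (intro sum.cong) (auto simp: delta_def)
  ultimately show ?case using 0 by (simp add: dilate_def)
next
  case (Suc m)
  define \<Gamma> where "\<Gamma> = {\<gamma>. Poly_Mapping.lookup a (\<alpha> - (\<gamma> + \<gamma>)) \<noteq> 0}"
  have \<Gamma>: "finite \<Gamma>" by (simp add: \<Gamma>_def finite_mask_support)
  define Z where "Z \<gamma> = {\<beta>. (subdivide a ^^ m) delta (\<gamma> - dilate m \<beta>) \<noteq> 0}" for \<gamma>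
  have "finite (Z \<gamma>)" for \<gamma>
  proof (rule finite_imageD)
    have "(\<lambda>\<beta>. \<gamma> - dilate m \<beta>) ` Z \<gamma> \<subseteq> {- (R * (2 ^ m - 1))..R * (2 ^ m - 1)} \<times> {- (R * (2 ^ m - 1))..R * (2 ^ m - 1)}"
    proof
      fix \<delta> assume "\<delta> \<in> (\<lambda>\<beta>. \<gamma> - dilate m \<beta>) ` Z \<gamma>"
      then have "(subdivide a ^^ m) delta \<delta> \<noteq> 0" by (auto simp: Z_def)
      from funpow_subdivide_delta_support[OF R this]
      show "\<delta> \<in> {- (R * (2 ^ m - 1))..R * (2 ^ m - 1)} \<times> {- (R * (2 ^ m - 1))..R * (2 ^ m - 1)}"
        unfolding abs_le_iff mem_Times_iff atLeastAtMost_iff by linarith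
    qed
    then show "finite ((\<lambda>\<beta>. \<gamma> - dilate m \<beta>) ` Z \<gamma>)" by (rule finite_subset) auto
    show "inj_on (\<lambda>\<beta>. \<gamma> - dilate m \<beta>) (Z \<gamma>)"
      by (auto simp: inj_on_def dilate_def prod_eq_iff)
  qed
  then have Z: "finite (B \<union> (\<Union>\<gamma>\<in>\<Gamma>. Z \<gamma>))" using \<Gamma> Suc.prems by auto
  \<comment> \<open>One index set for all \<open>\<gamma>\<close> in \<open>\<Gamma>\<close>, so
    that the two sums can be interchanged; its surplus terms vanish and are dropped at the
    end.\<close>
  let ?B = "B \<union> (\<Union>\<gamma>\<in>\<Gamma>. Z \<gamma>)"
  have "(subdivide a ^^ Suc m) f \<alpha> = (\<Sum>\<gamma>\<in>\<Gamma>. Poly_Mapping.lookup a (\<alpha> - (\<gamma> + \<gamma>)) * (subdivide a ^^ m) f \<gamma>)"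
    by (simp add: subdivide_def[of a "(subdivide a ^^ m) f"] \<Gamma>_def)
  also have "\<dots> = (\<Sum>\<gamma>\<in>\<Gamma>. Poly_Mapping.lookup a (\<alpha> - (\<gamma> + \<gamma>)) *
      (\<Sum>\<beta>\<in>?B. f \<beta> * (subdivide a ^^ m) delta (\<gamma> - dilate m \<beta>)))"
  proof (intro sum.cong refl arg_cong2[of _ _ _ _ "(*)"])
    show "(subdivide a ^^ m) f \<gamma> = (\<Sum>\<beta>\<in>?B. f \<beta> * (subdivide a ^^ m) delta (\<gamma> - dilate m \<beta>))" if "\<gamma> \<in> \<Gamma>" for \<gamma>
      by (rule Suc.IH[OF Z]) (use that in \<open>auto simp: Z_def\<close>)
  qed
  also have "\<dots> = subdivide a (\<lambda>\<gamma>. \<Sum>\<beta>\<in>?B. f \<beta> * (subdivide a ^^ m) delta (\<gamma> - dilate m \<beta>)) \<alpha>"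
    by (simp add: subdivide_def \<Gamma>_def)
  also have "\<dots> = (\<Sum>\<beta>\<in>?B. f \<beta> * subdivide a (\<lambda>\<gamma>. (subdivide a ^^ m) delta (\<gamma> - dilate m \<beta>)) \<alpha>)"
    by (rule subdivide_sum)
  also have "\<dots> = (\<Sum>\<beta>\<in>?B. f \<beta> * (subdivide a ^^ Suc m) delta (\<alpha> - dilate (Suc m) \<beta>))"
    by (simp add: subdivide_shift dilate_Suc)
  also have "\<dots> = (\<Sum>\<beta>\<in>B. f \<beta> * (subdivide a ^^ Suc m) delta (\<alpha> - dilate (Suc m) \<beta>))"
    using Z Suc.prems by (intro sum.mono_neutral_right) auto
  finally show ?case .
qed

lemma iterate_masks_const: "iterate_masks (\<lambda>_. a) k m f = (subdivide a ^^ m) f"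
  by (induction m) auto

section \<open>Limit functions and their uniqueness\<close>

lemma dyadic_approximation:
  fixes x :: "real \<times> real"
  obtains \<alpha> where "(\<lambda>m. grid_point m (\<alpha> m)) \<longlonglongrightarrow> x"
proof
  define \<alpha> where "\<alpha> m = (\<lfloor>2 ^ m * fst x\<rfloor>, \<lfloor>2 ^ m * snd x\<rfloor>)" for m :: nat
  have *: "(\<lambda>m. of_int \<lfloor>2 ^ m * t\<rfloor> / 2 ^ m) \<longlonglongrightarrow> t" for t :: real
  proof (rule real_tendsto_sandwich)
    show "\<forall>\<^sub>F m in sequentially. t - (1 / 2) ^ m \<le> of_int \<lfloor>2 ^ m * t\<rfloor> / 2 ^ m"
    proof (intro always_eventually allI)
      fix m :: nat
      have "2 ^ m * t - 1 \<le> of_int \<lfloor>2 ^ m * t\<rfloor>" by linarith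
      then have "(2 ^ m * t - 1) / 2 ^ m \<le> of_int \<lfloor>2 ^ m * t\<rfloor> / 2 ^ m" by (rule divide_right_mono) simp
      then show "t - (1 / 2) ^ m \<le> of_int \<lfloor>2 ^ m * t\<rfloor> / 2 ^ m" by (simp add: diff_divide_distrib power_divide)
    qed
    show "\<forall>\<^sub>F m in sequentially. of_int \<lfloor>2 ^ m * t\<rfloor> / 2 ^ m \<le> t"
    proof (intro always_eventually allI)
      fix m :: nat
      have "of_int \<lfloor>2 ^ m * t\<rfloor> \<le> 2 ^ m * t" by (rule of_int_floor_le)
      then show "of_int \<lfloor>2 ^ m * t\<rfloor> / 2 ^ m \<le> t" by (simp add: field_simps)
    qed
    have "(\<lambda>m. t - (1 / 2) ^ m) \<longlonglongrightarrow> t - 0" by (intro tendsto_intros LIMSEQ_realpow_zero) auto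
    then show "(\<lambda>m. t - (1 / 2) ^ m) \<longlonglongrightarrow> t" by simp
  qed auto
  have "(\<lambda>m. grid_point m (\<alpha> m)) \<longlonglongrightarrow> (fst x, snd x)"
    unfolding grid_point_def \<alpha>_def fst_conv snd_conv by (intro tendsto_Pair *)
  then show "(\<lambda>m. grid_point m (\<alpha> m)) \<longlonglongrightarrow> x" by simp
qed

text \<open>Uniformity over the grid lets the grid point move with the level. This determines
  \<open>g\<close> off the dyadic points as well, and also yields the support of limit
  functions.\<close>

lemma has_limit_function_along:
  assumes g: "has_limit_function c k f g" and x: "(\<lambda>m. grid_point m (\<alpha> m)) \<longlonglongrightarrow> x"
  shows "(\<lambda>m. iterate_masks c k m f (\<alpha> m)) \<longlonglongrightarrow> g x"
proof -
  have "(\<lambda>m. g (grid_point m (\<alpha> m))) \<longlonglongrightarrow> g x"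
    using g x by (intro continuous_on_tendsto_compose[of UNIV g]) (auto simp: has_limit_function_def)
  moreover have "(\<lambda>m. g (grid_point m (\<alpha> m)) - iterate_masks c k m f (\<alpha> m)) \<longlonglongrightarrow> 0"
  proof (rule tendstoI)
    fix e :: real assume "e > 0"
    with g have "\<forall>\<^sub>F m in sequentially. \<forall>\<beta>\<in>UNIV. dist (g (grid_point m \<beta>) - iterate_masks c k m f \<beta>) 0 < e"
      unfolding has_limit_function_def uniform_limit_iff by blast
    then show "\<forall>\<^sub>F m in sequentially. dist (g (grid_point m (\<alpha> m)) - iterate_masks c k m f (\<alpha> m)) 0 < e"
      by (rule eventually_mono) blast
  qed
  ultimately have "(\<lambda>m. g (grid_point m (\<alpha> m)) - (g (grid_point m (\<alpha> m)) - iterate_masks c k m f (\<alpha> m))) \<longlonglongrightarrow> g x - 0"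
    by (rule tendsto_diff)
  then show ?thesis by simp
qed

lemma has_limit_function_unique:
  assumes "has_limit_function c k f g" "has_limit_function c k f g'"
  shows "g = g'"
proof
  fix x
  obtain \<alpha> where "(\<lambda>m. grid_point m (\<alpha> m)) \<longlonglongrightarrow> x" by (rule dyadic_approximation)
  then show "g x = g' x" using has_limit_function_along[OF assms(1)] has_limit_function_along[OF assms(2)] LIMSEQ_unique by blast
qed

lemma basic_limit_function_eqI: "has_limit_function c k delta g \<Longrightarrow> basic_limit_function c k = g"
  unfolding basic_limit_function_def using has_limit_function_unique by blast

lemma bounded_if_zero_outside_box:
  fixes \<psi> :: "real \<times> real \<Rightarrow> 'a::real_normed_vector"
  assumes "continuous_on UNIV \<psi>" and zero: "\<And>x. r < \<bar>fst x\<bar> \<or> r < \<bar>snd x\<bar> \<Longrightarrow> \<psi> x = 0"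
  obtains K where "0 \<le> K" "\<And>x. norm (\<psi> x) \<le> K"
proof -
  have "compact ({- r..r} \<times> {- r..r})" by (intro compact_Times compact_Icc)
  then have "bounded (\<psi> ` ({- r..r} \<times> {- r..r}))"
    using assms(1) by (intro compact_imp_bounded compact_continuous_image) (auto intro: continuous_on_subset)
  then obtain K where K: "0 < K" "\<And>x. x \<in> {- r..r} \<times> {- r..r} \<Longrightarrow> norm (\<psi> x) \<le> K"
    unfolding bounded_pos by auto
  have "norm (\<psi> x) \<le> K" for x
  proof (cases "x \<in> {- r..r} \<times> {- r..r}")
    case False
    then have "\<psi> x = 0" by (intro zero) (auto simp: mem_Times_iff abs_le_iff)
    then show ?thesis using K by simp
  qed (use K in auto)
  then show ?thesis using that[of K] K by simp
qed

section \<open>The stationary scheme: stability and limit functions for bounded data\<close>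

locale stationary_C1 =
  fixes a :: laurent2 and R :: int and \<phi> :: "real \<times> real \<Rightarrow> real" and \<phi>' :: "real \<times> real \<Rightarrow> (real \<times> real) \<Rightarrow>\<^sub>L real"
  assumes radius: "\<forall>\<alpha>\<in>Poly_Mapping.keys a. \<bar>fst \<alpha>\<bar> \<le> R \<and> \<bar>snd \<alpha>\<bar> \<le> R"
    and R: "0 \<le> R"
    and lim: "has_limit_function (\<lambda>_. a) 1 delta \<phi>"
    and deriv: "\<And>x. (\<phi> has_derivative blinfun_apply (\<phi>' x)) (at x)"
    and deriv_cont: "continuous_on UNIV \<phi>'"
begin

abbreviation F :: "nat \<Rightarrow> int \<times> int \<Rightarrow> real" where
  "F m \<equiv> (subdivide a ^^ m) delta"

lemma phi_cont: "continuous_on UNIV \<phi>"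
  using lim by (simp add: has_limit_function_def)

lemma F_zero:
  assumes "real_of_int R < \<bar>fst (grid_point m \<alpha>)\<bar> \<or> real_of_int R < \<bar>snd (grid_point m \<alpha>)\<bar>"
  shows "F m \<alpha> = 0"
proof (rule ccontr)
  assume "F m \<alpha> \<noteq> 0"
  then have "\<bar>fst \<alpha>\<bar> \<le> R * (2 ^ m - 1) \<and> \<bar>snd \<alpha>\<bar> \<le> R * (2 ^ m - 1)"
    by (rule funpow_subdivide_delta_support[OF radius])
  moreover have "R * (2 ^ m - 1) \<le> R * 2 ^ m" using R by (simp add: algebra_simps)
  ultimately have "\<bar>fst \<alpha>\<bar> \<le> R * 2 ^ m \<and> \<bar>snd \<alpha>\<bar> \<le> R * 2 ^ m" by linarith
  then have "real_of_int \<bar>fst \<alpha>\<bar> \<le> real_of_int (R * 2 ^ m)" "real_of_int \<bar>snd \<alpha>\<bar> \<le> real_of_int (R * 2 ^ m)"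
    unfolding of_int_le_iff by auto
  then show False using assms by (auto simp: grid_point_def abs_divide field_simps)
qed

text \<open>Lying outside the closed box is an open condition, so it eventually holds along grid
  points tending to \<open>x\<close>, where the iterates vanish.\<close>

lemma phi_zero:
  assumes "real_of_int R < \<bar>fst x\<bar> \<or> real_of_int R < \<bar>snd x\<bar>"
  shows "\<phi> x = 0"
proof -
  obtain \<alpha> where \<alpha>: "(\<lambda>m. grid_point m (\<alpha> m)) \<longlonglongrightarrow> x" by (rule dyadic_approximation)
  have "(\<lambda>m. \<bar>fst (grid_point m (\<alpha> m))\<bar>) \<longlonglongrightarrow> \<bar>fst x\<bar>" "(\<lambda>m. \<bar>snd (grid_point m (\<alpha> m))\<bar>) \<longlonglongrightarrow> \<bar>snd x\<bar>"
    by (intro tendsto_intros \<alpha>)+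
  then have "\<forall>\<^sub>F m in sequentially. real_of_int R < \<bar>fst (grid_point m (\<alpha> m))\<bar> \<or> real_of_int R < \<bar>snd (grid_point m (\<alpha> m))\<bar>"
    using assms by (auto dest: order_tendstoD elim: eventually_mono)
  then have "\<forall>\<^sub>F m in sequentially. F m (\<alpha> m) = 0" by (rule eventually_mono) (rule F_zero)
  then have "(\<lambda>m. F m (\<alpha> m)) \<longlonglongrightarrow> 0" by (rule tendsto_eventually)
  moreover have "(\<lambda>m. F m (\<alpha> m)) \<longlonglongrightarrow> \<phi> x"
    using has_limit_function_along[OF lim \<alpha>] by (simp add: iterate_masks_const)
  ultimately show ?thesis using LIMSEQ_unique by blast
qed

lemma phi'_zero:
  assumes "real_of_int R < \<bar>fst x\<bar> \<or> real_of_int R < \<bar>snd x\<bar>"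
  shows "\<phi>' x = 0"
proof -
  define U where "U = {y :: real \<times> real. real_of_int R < \<bar>fst y\<bar> \<or> real_of_int R < \<bar>snd y\<bar>}"
  have "open U" unfolding U_def by (intro open_Collect_disj open_Collect_less continuous_intros)
  have "(\<phi> has_derivative (\<lambda>_. 0)) (at x)"
    by (rule has_derivative_transform_within_open[OF has_derivative_const[of 0] \<open>open U\<close>])
      (use assms phi_zero in \<open>auto simp: U_def\<close>)
  then have "blinfun_apply (\<phi>' x) = (\<lambda>_. 0)" using has_derivative_unique[OF deriv] by blast
  then show ?thesis by (intro blinfun_eqI) simp
qed

definition K0 where "K0 = (SOME K. 0 \<le> K \<and> (\<forall>x. \<bar>\<phi> x\<bar> \<le> K))"
definition K1 where "K1 = (SOME K. 0 \<le> K \<and> (\<forall>x. norm (\<phi>' x) \<le> K))"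

lemma K0: "0 \<le> K0" "\<bar>\<phi> x\<bar> \<le> K0"
proof -
  have "\<exists>K. 0 \<le> K \<and> (\<forall>x. \<bar>\<phi> x\<bar> \<le> K)"
    using bounded_if_zero_outside_box[OF phi_cont phi_zero] unfolding real_norm_def by blast
  from someI_ex[OF this] show "0 \<le> K0" "\<bar>\<phi> x\<bar> \<le> K0" unfolding K0_def by blast+
qed

lemma K1: "0 \<le> K1" "norm (\<phi>' x) \<le> K1"
proof -
  have "\<exists>K. 0 \<le> K \<and> (\<forall>x. norm (\<phi>' x) \<le> K)"
    using bounded_if_zero_outside_box[OF deriv_cont phi'_zero] by blast
  from someI_ex[OF this] show "0 \<le> K1" "norm (\<phi>' x) \<le> K1" unfolding K1_def by blast+
qed

text \<open>Bounds the number of lattice points in a \<open>Box\<close>, hence the number of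
  translates of \<open>\<phi>\<close> that are felt at any one point.\<close>

definition \<nu> :: real where "\<nu> = (2 * (real_of_int R + 1) + 1)\<^sup>2"

abbreviation Box :: "real \<times> real \<Rightarrow> (int \<times> int) set" where
  "Box \<equiv> lattice_box (real_of_int R + 1)"

text \<open>\<open>G f\<close> is the limit function of the stationary scheme started at \<open>f\<close>. The box is one unit larger
  than the support of \<open>\<phi>\<close>, so that near \<open>x\<close> the sum can be taken over the fixed box of \<open>x\<close>.\<close>

definition G :: "(int \<times> int \<Rightarrow> real) \<Rightarrow> real \<times> real \<Rightarrow> real" where
  "G f x = (\<Sum>\<beta>\<in>Box x. f \<beta> * \<phi> (x - grid_point 0 \<beta>))"

definition G' :: "(int \<times> int \<Rightarrow> real) \<Rightarrow> real \<times> real \<Rightarrow> (real \<times> real) \<Rightarrow>\<^sub>L real" where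
  "G' f x = (\<Sum>\<beta>\<in>Box x. f \<beta> *\<^sub>R \<phi>' (x - grid_point 0 \<beta>))"

lemma finite_Box: "finite (Box x)"
  using R by (intro lattice_box_finite_card) simp

lemma nu_ge: "1 \<le> \<nu>"
  using R by (simp add: \<nu>_def one_le_power)

lemma sum_Box_le:
  assumes "\<And>\<beta>. u \<beta> \<le> b" "0 \<le> b"
  shows "(\<Sum>\<beta>\<in>Box x. u \<beta>) \<le> \<nu> * b"
proof -
  have "(\<Sum>\<beta>\<in>Box x. u \<beta>) \<le> real (card (Box x)) * b" using assms(1) by (intro sum_bounded_above)
  also have "\<dots> \<le> \<nu> * b" unfolding \<nu>_def using R assms(2) by (intro mult_right_mono lattice_box_finite_card) auto
  finally show ?thesis .
qed

lemma sum_Box_local: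
  fixes \<psi> :: "real \<times> real \<Rightarrow> 'b::real_vector"
  assumes zero: "\<And>x. real_of_int R < \<bar>fst x\<bar> \<or> real_of_int R < \<bar>snd x\<bar> \<Longrightarrow> \<psi> x = 0" and y: "dist y x < 1"
  shows "(\<Sum>\<beta>\<in>Box y. f \<beta> *\<^sub>R \<psi> (y - grid_point 0 \<beta>)) = (\<Sum>\<beta>\<in>Box x. f \<beta> *\<^sub>R \<psi> (y - grid_point 0 \<beta>))"
proof -
  have xy: "\<bar>fst y - fst x\<bar> < 1" "\<bar>snd y - snd x\<bar> < 1"
    using y dist_fst_le[of y x] dist_snd_le[of y x] by (auto simp: dist_real_def)
  have "f \<beta> *\<^sub>R \<psi> (y - grid_point 0 \<beta>) = 0" if "\<beta> \<notin> Box x \<or> \<beta> \<notin> Box y" for \<beta>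
  proof -
    have "real_of_int R < \<bar>fst y - of_int (fst \<beta>)\<bar> \<or> real_of_int R < \<bar>snd y - of_int (snd \<beta>)\<bar>"
    proof (rule ccontr)
      assume "\<not> ?thesis"
      then have le: "\<bar>fst y - of_int (fst \<beta>)\<bar> \<le> real_of_int R" "\<bar>snd y - of_int (snd \<beta>)\<bar> \<le> real_of_int R"
        by (simp_all add: not_less)
      then have "\<bar>fst x - of_int (fst \<beta>)\<bar> \<le> real_of_int R + 1" "\<bar>snd x - of_int (snd \<beta>)\<bar> \<le> real_of_int R + 1"
        using xy by linarith+
      moreover have "\<bar>fst y - of_int (fst \<beta>)\<bar> \<le> real_of_int R + 1" "\<bar>snd y - of_int (snd \<beta>)\<bar> \<le> real_of_int R + 1"
        using le by linarith+
      ultimately show False using that by (simp add: lattice_box_def)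
    qed
    then show ?thesis using zero[of "y - grid_point 0 \<beta>"] by (simp add: grid_point_def)
  qed
  then show ?thesis using finite_Box
    by (intro sum.mono_neutral_cong) auto
qed

lemma G_deriv: "(G f has_derivative blinfun_apply (G' f x)) (at x)"
proof (rule has_derivative_transform_within_open[OF _ open_ball[of x 1]])
  have "((\<lambda>y. \<Sum>\<beta>\<in>Box x. f \<beta> * \<phi> (y - grid_point 0 \<beta>)) has_derivative
      (\<lambda>h. \<Sum>\<beta>\<in>Box x. f \<beta> * blinfun_apply (\<phi>' (x - grid_point 0 \<beta>)) h)) (at x)"
  proof (intro has_derivative_sum has_derivative_mult_right)
    fix \<beta>
    have "((\<lambda>y. y - grid_point 0 \<beta>) has_derivative (\<lambda>h. h)) (at x)" by (auto intro!: derivative_eq_intros)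
    from has_derivative_compose[OF this deriv]
    show "((\<lambda>y. \<phi> (y - grid_point 0 \<beta>)) has_derivative blinfun_apply (\<phi>' (x - grid_point 0 \<beta>))) (at x)" .
  qed
  moreover have "(\<lambda>h. \<Sum>\<beta>\<in>Box x. f \<beta> * blinfun_apply (\<phi>' (x - grid_point 0 \<beta>)) h) = blinfun_apply (G' f x)"
    by (simp add: G'_def fun_eq_iff blinfun.sum_left blinfun.scaleR_left)
  ultimately show "((\<lambda>y. \<Sum>\<beta>\<in>Box x. f \<beta> * \<phi> (y - grid_point 0 \<beta>)) has_derivative blinfun_apply (G' f x)) (at x)" by simp
  show "(\<Sum>\<beta>\<in>Box x. f \<beta> * \<phi> (y - grid_point 0 \<beta>)) = G f y" if "y \<in> ball x 1" for y
    using sum_Box_local[where \<psi> = \<phi> and y = y and x = x and f = f, OF phi_zero] that by (simp add: G_def dist_commute)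
qed simp

lemma G'_cont: "continuous_on UNIV (G' f)"
proof (rule continuous_at_imp_continuous_on, rule ballI)
  fix x
  have "continuous_on UNIV (\<lambda>y. \<phi>' (y - grid_point 0 \<beta>))" for \<beta>
    by (rule continuous_on_compose2[OF deriv_cont]) (auto intro!: continuous_intros)
  then have "continuous_on UNIV (\<lambda>y. \<Sum>\<beta>\<in>Box x. f \<beta> *\<^sub>R \<phi>' (y - grid_point 0 \<beta>))"
    by (intro continuous_intros)
  then have cont: "isCont (\<lambda>y. \<Sum>\<beta>\<in>Box x. f \<beta> *\<^sub>R \<phi>' (y - grid_point 0 \<beta>)) x"
    unfolding continuous_on_eq_continuous_at[OF open_UNIV] by blast
  have ev: "\<forall>\<^sub>F y in nhds x. (\<Sum>\<beta>\<in>Box x. f \<beta> *\<^sub>R \<phi>' (y - grid_point 0 \<beta>)) = G' f y"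
  proof -
    have "\<forall>\<^sub>F y in nhds x. y \<in> ball x 1" by (rule eventually_nhds_in_open) auto
    then show ?thesis
    proof (rule eventually_mono)
      fix y assume "y \<in> ball x 1"
      then show "(\<Sum>\<beta>\<in>Box x. f \<beta> *\<^sub>R \<phi>' (y - grid_point 0 \<beta>)) = G' f y"
        unfolding G'_def by (intro sum_Box_local[symmetric] phi'_zero) (auto simp: dist_commute)
    qed
  qed
  show "isCont (G' f) x" by (rule iffD1[OF isCont_cong[OF ev] cont])
qed

lemma G_bound:
  assumes "\<And>\<beta>. \<bar>f \<beta>\<bar> \<le> H"
  shows "\<bar>G f x\<bar> \<le> \<nu> * (H * K0)" "norm (G' f x) \<le> \<nu> * (H * K1)"
proof -
  have H: "0 \<le> H" using assms[of 0] by linarith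
  have "\<bar>G f x\<bar> \<le> (\<Sum>\<beta>\<in>Box x. \<bar>f \<beta>\<bar> * \<bar>\<phi> (x - grid_point 0 \<beta>)\<bar>)"
    unfolding G_def by (rule order_trans[OF sum_abs]) (simp add: abs_mult)
  also have "\<dots> \<le> \<nu> * (H * K0)" using H K0 assms by (intro sum_Box_le mult_mono) auto
  finally show "\<bar>G f x\<bar> \<le> \<nu> * (H * K0)" .
  have "norm (G' f x) \<le> (\<Sum>\<beta>\<in>Box x. \<bar>f \<beta>\<bar> * norm (\<phi>' (x - grid_point 0 \<beta>)))"
    unfolding G'_def by (rule order_trans[OF norm_sum]) simp
  also have "\<dots> \<le> \<nu> * (H * K1)" using H K1 assms by (intro sum_Box_le mult_mono) auto
  finally show "norm (G' f x) \<le> \<nu> * (H * K1)" .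
qed

text \<open>In rescaled coordinates the translate belonging to \<open>\<beta>\<close> is evaluated
  at \<open>grid_point m \<alpha> - grid_point 0 \<beta>\<close> and vanishes beyond distance
  \<open>R\<close>. So one box of fixed size serves every \<open>m\<close>, exactly as in the
  definition of \<open>G\<close>.\<close>

lemma funpow_eq_sum_Box:
  "(subdivide a ^^ m) f \<alpha> = (\<Sum>\<beta>\<in>Box (grid_point m \<alpha>). f \<beta> * F m (\<alpha> - dilate m \<beta>))"
proof (rule funpow_subdivide_expansion[OF radius finite_Box])
  show "{\<beta>. F m (\<alpha> - dilate m \<beta>) \<noteq> 0} \<subseteq> Box (grid_point m \<alpha>)"
  proof
    fix \<beta> assume "\<beta> \<in> {\<beta>. F m (\<alpha> - dilate m \<beta>) \<noteq> 0}"
    then have "F m (\<alpha> - dilate m \<beta>) \<noteq> 0" by simp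
    then have "\<bar>fst (grid_point m (\<alpha> - dilate m \<beta>))\<bar> \<le> R" "\<bar>snd (grid_point m (\<alpha> - dilate m \<beta>))\<bar> \<le> R"
      using F_zero[of m "\<alpha> - dilate m \<beta>"] by linarith+
    then have "\<bar>fst (grid_point m \<alpha> - grid_point 0 \<beta>)\<bar> \<le> R" "\<bar>snd (grid_point m \<alpha> - grid_point 0 \<beta>)\<bar> \<le> R"
      by (simp_all only: grid_point_diff[symmetric] grid_point_dilate)
    then show "\<beta> \<in> Box (grid_point m \<alpha>)" by (simp add: lattice_box_def grid_point_def[of 0])
  qed
qed

text \<open>From some level \<open>M\<close> on, the iterates are within 1 of the bounded function
  \<open>\<phi>\<close>; the finitely many earlier levels are covered by powers of \<open>s\<close>,
  which is made at least 1 so that its powers increase.\<close>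

lemma F_bounded: "\<exists>B. \<forall>m \<alpha>. \<bar>F m \<alpha>\<bar> \<le> B"
proof -
  define s where "s = 1 + subdivision_norm a"
  have s: "1 \<le> s" by (simp add: s_def subdivision_norm_nonneg)
  have pow: "\<bar>F m \<alpha>\<bar> \<le> s ^ m" for m \<alpha>
  proof (induction m arbitrary: \<alpha>)
    case (Suc m)
    have "\<bar>F (Suc m) \<alpha>\<bar> \<le> subdivision_norm a * s ^ m"
      using abs_subdivide_le[of "F m" "s ^ m" a] Suc by simp
    also have "\<dots> \<le> s ^ Suc m" using s by (simp add: s_def mult_right_mono)
    finally show ?case .
  qed (simp add: delta_def)
  have "uniform_limit UNIV (\<lambda>m \<alpha>. \<phi> (grid_point m \<alpha>) - iterate_masks (\<lambda>_. a) 1 m delta \<alpha>) (\<lambda>\<alpha>. 0) sequentially"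
    using lim by (simp add: has_limit_function_def)
  from uniform_limitD[OF this, of 1]
  have "\<forall>\<^sub>F m in sequentially. \<forall>\<alpha>\<in>UNIV. dist (\<phi> (grid_point m \<alpha>) - iterate_masks (\<lambda>_. a) 1 m delta \<alpha>) 0 < 1" by simp
  then obtain M where M: "\<And>m \<alpha>. m \<ge> M \<Longrightarrow> \<bar>\<phi> (grid_point m \<alpha>) - F m \<alpha>\<bar> < 1"
    unfolding eventually_sequentially by (auto simp: iterate_masks_const)
  have "\<bar>F m \<alpha>\<bar> \<le> K0 + 1 + s ^ M" for m \<alpha>
  proof (cases "m \<ge> M")
    case True
    have "0 \<le> s ^ M" using s by simp
    then show ?thesis using M[OF True, of \<alpha>] K0(2)[of "grid_point m \<alpha>"] by linarith
  next
    case False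
    then have "s ^ m \<le> s ^ M" using s by (intro power_increasing) auto
    then show ?thesis using pow[of m \<alpha>] K0(1) by linarith
  qed
  then show ?thesis by blast
qed

definition B0 where "B0 = (SOME B. 1 \<le> B \<and> (\<forall>m \<alpha>. \<bar>F m \<alpha>\<bar> \<le> B))"

lemma B0: "1 \<le> B0" "\<bar>F m \<alpha>\<bar> \<le> B0"
proof -
  obtain B where B: "\<And>m \<alpha>. \<bar>F m \<alpha>\<bar> \<le> B" using F_bounded by blast
  have "\<bar>F 0 0\<bar> = 1" by (simp add: delta_def)
  then have "1 \<le> B" using B[of 0 0] by simp
  then have "\<exists>B. 1 \<le> B \<and> (\<forall>m \<alpha>. \<bar>F m \<alpha>\<bar> \<le> B)" using B by blast
  from someI_ex[OF this] show "1 \<le> B0" "\<bar>F m \<alpha>\<bar> \<le> B0" unfolding B0_def by blast+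
qed

text \<open>Stability: the powers of the stationary operator are bounded in the sup norm uniformly
  in \<open>m\<close>, although its own norm may exceed 1.\<close>

lemma funpow_bound:
  assumes "\<And>\<beta>. \<bar>f \<beta>\<bar> \<le> H"
  shows "\<bar>(subdivide a ^^ m) f \<alpha>\<bar> \<le> (\<nu> * B0) * H"
proof -
  have H: "0 \<le> H" using assms[of 0] by linarith
  have "\<bar>(subdivide a ^^ m) f \<alpha>\<bar> \<le> (\<Sum>\<beta>\<in>Box (grid_point m \<alpha>). \<bar>f \<beta>\<bar> * \<bar>F m (\<alpha> - dilate m \<beta>)\<bar>)"
    unfolding funpow_eq_sum_Box[of m f \<alpha>] by (rule order_trans[OF sum_abs]) (simp add: abs_mult)
  also have "\<dots> \<le> \<nu> * (H * B0)" using H B0 assms by (intro sum_Box_le mult_mono) auto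
  finally show ?thesis by (simp add: mult_ac)
qed

text \<open>The worst error at level \<open>m\<close> for the data \<open>delta\<close>. By
  linearity and locality it controls the error for all bounded data
  (\<open>G_approx\<close>).\<close>

definition eps :: "nat \<Rightarrow> real" where
  "eps m = (SUP \<alpha>. \<bar>\<phi> (grid_point m \<alpha>) - F m \<alpha>\<bar>)"

lemma eps: "\<bar>\<phi> (grid_point m \<alpha>) - F m \<alpha>\<bar> \<le> eps m" "0 \<le> eps m" "eps m \<le> K0 + B0"
proof -
  have le: "\<bar>\<phi> (grid_point m \<alpha>) - F m \<alpha>\<bar> \<le> K0 + B0" for \<alpha>
    using K0(2)[of "grid_point m \<alpha>"] B0(2)[of m \<alpha>] by linarith
  then have bdd: "bdd_above (range (\<lambda>\<alpha>. \<bar>\<phi> (grid_point m \<alpha>) - F m \<alpha>\<bar>))"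
    by (intro bdd_aboveI[of _ "K0 + B0"]) auto
  show upper: "\<bar>\<phi> (grid_point m \<alpha>) - F m \<alpha>\<bar> \<le> eps m" for \<alpha>
    unfolding eps_def by (rule cSUP_upper[OF _ bdd]) simp
  show "0 \<le> eps m" using upper[of 0] by linarith
  show "eps m \<le> K0 + B0" unfolding eps_def using le by (intro cSUP_least) auto
qed

lemma eps_tendsto: "eps \<longlonglongrightarrow> 0"
proof (rule LIMSEQ_I)
  fix e :: real assume e: "0 < e"
  have "uniform_limit UNIV (\<lambda>m \<alpha>. \<phi> (grid_point m \<alpha>) - iterate_masks (\<lambda>_. a) 1 m delta \<alpha>) (\<lambda>\<alpha>. 0) sequentially"
    using lim by (simp add: has_limit_function_def)
  from uniform_limitD[OF this half_gt_zero[OF e]]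
  have "\<forall>\<^sub>F m in sequentially. \<forall>\<alpha>\<in>UNIV. dist (\<phi> (grid_point m \<alpha>) - iterate_masks (\<lambda>_. a) 1 m delta \<alpha>) 0 < e / 2" .
  then obtain M where M: "\<And>m \<alpha>. m \<ge> M \<Longrightarrow> \<bar>\<phi> (grid_point m \<alpha>) - F m \<alpha>\<bar> < e / 2"
    unfolding eventually_sequentially by (auto simp: iterate_masks_const)
  have "norm (eps m - 0) < e" if "m \<ge> M" for m
  proof -
    have "eps m \<le> e / 2"
      unfolding eps_def using M[OF that] by (intro cSUP_least) (auto intro: less_imp_le)
    then show ?thesis using e eps(2)[of m] by simp
  qed
  then show "\<exists>no. \<forall>m\<ge>no. norm (eps m - 0) < e" by blast
qed

text \<open>Both sides are sums over the same box with the same coefficients, so the errors of the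
  translates of \<open>delta\<close> add up to at most \<open>\<nu>\<close> copies of
  \<open>eps m\<close>.\<close>

lemma G_approx:
  assumes "\<And>\<beta>. \<bar>f \<beta>\<bar> \<le> H"
  shows "\<bar>G f (grid_point m \<alpha>) - (subdivide a ^^ m) f \<alpha>\<bar> \<le> \<nu> * (H * eps m)"
proof -
  have H: "0 \<le> H" using assms[of 0] by linarith
  have "G f (grid_point m \<alpha>) - (subdivide a ^^ m) f \<alpha> =
    (\<Sum>\<beta>\<in>Box (grid_point m \<alpha>). f \<beta> * (\<phi> (grid_point m (\<alpha> - dilate m \<beta>)) - F m (\<alpha> - dilate m \<beta>)))"
    unfolding G_def funpow_eq_sum_Box[of m f \<alpha>] sum_subtractf[symmetric] right_diff_distrib
    by (simp only: grid_point_diff[symmetric] grid_point_dilate)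
  also have "\<bar>\<dots>\<bar> \<le> (\<Sum>\<beta>\<in>Box (grid_point m \<alpha>). \<bar>f \<beta>\<bar> * \<bar>\<phi> (grid_point m (\<alpha> - dilate m \<beta>)) - F m (\<alpha> - dilate m \<beta>)\<bar>)"
    by (rule order_trans[OF sum_abs]) (simp add: abs_mult)
  also have "\<dots> \<le> \<nu> * (H * eps m)" using H eps assms by (intro sum_Box_le mult_mono) auto
  finally show ?thesis .
qed

lemma G_delta: "G delta = \<phi>"
proof
  fix x
  show "G delta x = \<phi> x"
  proof (cases "0 \<in> Box x")
    case True
    have "G delta x = (\<Sum>\<beta>\<in>Box x. if 0 = \<beta> then \<phi> x else 0)"
      unfolding G_def by (intro sum.cong) (auto simp: delta_def grid_point_def zero_prod_def[symmetric])
    then show ?thesis using True finite_Box by simp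
  next
    case False
    then have "\<phi> x = 0" by (intro phi_zero) (auto simp: lattice_box_def)
    moreover have "G delta x = 0" unfolding G_def using False by (intro sum.neutral) (auto simp: delta_def)
    ultimately show ?thesis by simp
  qed
qed

lemma G'_delta: "G' delta = \<phi>'"
proof
  fix x
  have "blinfun_apply (G' delta x) = blinfun_apply (\<phi>' x)"
    using G_deriv[of delta x] deriv[of x] unfolding G_delta by (rule has_derivative_unique)
  then show "G' delta x = \<phi>' x" by (intro blinfun_eqI) simp
qed

end

section \<open>Perturbation of the stationary scheme\<close>

locale asymptotically_equivalent = stationary_C1 +
  fixes c :: "nat \<Rightarrow> laurent2"
  assumes summ: "summable (\<lambda>k. 2 ^ Suc k * subdivision_norm (c (Suc k) - a))"
begin

definition dev :: "nat \<Rightarrow> real" where "dev k = subdivision_norm (c k - a)"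

definition total :: real where "total = suminf (\<lambda>k. 2 ^ Suc k * dev (Suc k))"

lemma dev_nonneg: "0 \<le> dev k"
  by (simp add: dev_def subdivision_norm_nonneg)

lemma weighted_tail:
  assumes "1 \<le> k"
  shows "summable (\<lambda>j. 2 ^ (k + j) * dev (k + j))" "suminf (\<lambda>j. 2 ^ (k + j) * dev (k + j)) \<le> total"
proof -
  define g where "g i = 2 ^ Suc i * dev (Suc i)" for i
  have g: "summable g" "\<And>i. 0 \<le> g i" using summ by (simp_all add: g_def[abs_def] dev_def subdivision_norm_nonneg)
  \<comment> \<open>The assumed series starts with level 1 at index 0, so level \<open>k + j\<close>
    is its term \<open>j + (k - 1)\<close>.\<close>
  have eq: "2 ^ (k + j) * dev (k + j) = g (j + (k - 1))" for j
    using assms by (cases k) (simp_all add: g_def add.commute)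
  show "summable (\<lambda>j. 2 ^ (k + j) * dev (k + j))"
    unfolding eq using g(1) by (subst summable_iff_shift)
  have "suminf (\<lambda>j. g (j + (k - 1))) = suminf g - sum g {..<k - 1}"
    by (rule suminf_minus_initial_segment[OF g(1)])
  also have "\<dots> \<le> suminf g" using g by (simp add: sum_nonneg)
  finally show "suminf (\<lambda>j. 2 ^ (k + j) * dev (k + j)) \<le> total"
    unfolding eq total_def g_def[symmetric] .
qed

lemma total_nonneg: "0 \<le> total"
  unfolding total_def using summ by (intro suminf_nonneg) (auto simp: dev_def subdivision_norm_nonneg)

lemma dev_le: "dev (k + j) \<le> 2 ^ (k + j) * dev (k + j) / 2 ^ k"
proof -
  have "dev (k + j) \<le> 2 ^ j * dev (k + j)"
    using dev_nonneg[of "k + j"] mult_right_mono[of 1 "2 ^ j" "dev (k + j)"] by simp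
  also have "\<dots> = 2 ^ (k + j) * dev (k + j) / 2 ^ k" by (simp add: power_add)
  finally show ?thesis .
qed

text \<open>The weights are at least \<open>2 ^ k\<close> on this tail; giving them up yields the
  factor \<open>1 / 2 ^ k\<close>.\<close>

lemma dev_tail:
  assumes "1 \<le> k"
  shows "summable (\<lambda>j. dev (k + j))" "suminf (\<lambda>j. dev (k + j)) \<le> total / 2 ^ k"
proof -
  have s: "summable (\<lambda>j. 2 ^ (k + j) * dev (k + j) / 2 ^ k)"
    by (rule summable_divide[OF weighted_tail(1)[OF assms]])
  show s': "summable (\<lambda>j. dev (k + j))"
    by (rule summable_comparison_test'[OF s, of 0]) (use dev_le dev_nonneg in auto)
  have "suminf (\<lambda>j. dev (k + j)) \<le> suminf (\<lambda>j. 2 ^ (k + j) * dev (k + j) / 2 ^ k)"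
    by (rule suminf_le[OF dev_le s' s])
  also have "\<dots> = suminf (\<lambda>j. 2 ^ (k + j) * dev (k + j)) / 2 ^ k"
    by (rule suminf_divide[OF weighted_tail(1)[OF assms]])
  also have "\<dots> \<le> total / 2 ^ k" by (intro divide_right_mono weighted_tail(2)[OF assms]) auto
  finally show "suminf (\<lambda>j. dev (k + j)) \<le> total / 2 ^ k" .
qed

text \<open>The defect made at step \<open>j\<close>. It lives on the lattice after
  \<open>j + 1\<close> refinements, which is the origin of the dilations \<open>2 ^ Suc j\<close>
  below.\<close>

definition h :: "nat \<Rightarrow> (int \<times> int \<Rightarrow> real) \<Rightarrow> nat \<Rightarrow> int \<times> int \<Rightarrow> real" where
  "h k f j = subdivide (c (k + j) - a) (iterate_masks c k j f)"

text \<open>Duhamel's formula: the deviation of each mask from the stationary one is propagated by the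
  stationary scheme.\<close>

lemma iterate_masks_duhamel:
  "iterate_masks c k l f \<alpha> = (subdivide a ^^ l) f \<alpha> + (\<Sum>j<l. (subdivide a ^^ (l - Suc j)) (h k f j) \<alpha>)"
proof (induction l arbitrary: \<alpha>)
  case (Suc l)
  have "iterate_masks c k (Suc l) f \<alpha> = subdivide a (iterate_masks c k l f) \<alpha> + h k f l \<alpha>"
    by (simp add: h_def subdivide_diff_mask)
  also have "subdivide a (iterate_masks c k l f) \<alpha> =
      subdivide a (\<lambda>\<beta>. (subdivide a ^^ l) f \<beta> + (\<Sum>j<l. 1 * (subdivide a ^^ (l - Suc j)) (h k f j) \<beta>)) \<alpha>"
    by (rule arg_cong[of _ _ "\<lambda>g. subdivide a g \<alpha>"]) (simp add: fun_eq_iff Suc.IH)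
  also have "\<dots> = (subdivide a ^^ Suc l) f \<alpha> + (\<Sum>j<l. subdivide a ((subdivide a ^^ (l - Suc j)) (h k f j)) \<alpha>)"
    unfolding subdivide_add subdivide_sum by simp
  also have "(\<Sum>j<l. subdivide a ((subdivide a ^^ (l - Suc j)) (h k f j)) \<alpha>) = (\<Sum>j<l. (subdivide a ^^ (Suc l - Suc j)) (h k f j) \<alpha>)"
  proof (rule sum.cong)
    fix j assume "j \<in> {..<l}"
    then have "Suc l - Suc j = Suc (l - Suc j)" by auto
    then show "subdivide a ((subdivide a ^^ (l - Suc j)) (h k f j)) \<alpha> = (subdivide a ^^ (Suc l - Suc j)) (h k f j) \<alpha>"
      by simp
  qed simp
  finally show ?case by simp
qed simp

text \<open>The constant of a discrete Gronwall inequality in which \<open>\<nu> * B0\<close> is the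
  stability constant of the stationary scheme.\<close>

definition Mc :: real where "Mc = \<nu> * B0 * exp (\<nu> * B0 * total)"

lemma nuB0: "1 \<le> \<nu> * B0"
  using mult_mono[OF nu_ge B0(1)] nu_ge by simp

lemma Mc_nonneg: "0 \<le> Mc"
  using nuB0 by (simp add: Mc_def)

text \<open>Discrete Gronwall argument: Duhamel's formula and stability bound level \<open>l\<close>
  by all earlier levels, hence the strong induction. The bound is uniform in the starting level
  \<open>k\<close> and the number of steps \<open>l\<close>.\<close>

lemma iterate_masks_bound:
  assumes k: "1 \<le> k" and f: "\<And>\<beta>. \<bar>f \<beta>\<bar> \<le> H"
  shows "\<bar>iterate_masks c k l f \<alpha>\<bar> \<le> Mc * H"
proof -
  define b where "b = \<nu> * B0"
  define P where "P l = (\<Prod>j<l. 1 + b * dev (k + j))" for l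
  have b: "1 \<le> b" using nuB0 by (simp add: b_def)
  have H: "0 \<le> H" using f[of 0] by linarith
  \<comment> \<open>The products solve the Gronwall recursion with equality.\<close>
  have P: "1 + (\<Sum>j<l. b * dev (k + j) * P j) = P l" for l
    by (induction l) (simp_all add: P_def algebra_simps)
  have "\<bar>iterate_masks c k l f \<alpha>\<bar> \<le> b * H * P l" for l \<alpha>
  proof (induction l arbitrary: \<alpha> rule: less_induct)
    case (less l)
    have "\<bar>(subdivide a ^^ (l - Suc j)) (h k f j) \<alpha>\<bar> \<le> b * (dev (k + j) * (b * H * P j))" if "j < l" for j
    proof -
      have "\<bar>h k f j \<beta>\<bar> \<le> dev (k + j) * (b * H * P j)" for \<beta>
        unfolding h_def dev_def by (rule abs_subdivide_le) (rule less.IH[OF that])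
      from funpow_bound[OF this] show ?thesis by (simp add: b_def)
    qed
    then have "(\<Sum>j<l. \<bar>(subdivide a ^^ (l - Suc j)) (h k f j) \<alpha>\<bar>) \<le> (\<Sum>j<l. b * H * (b * dev (k + j) * P j))"
      by (intro sum_mono) (simp add: mult_ac)
    then have "\<bar>\<Sum>j<l. (subdivide a ^^ (l - Suc j)) (h k f j) \<alpha>\<bar> \<le> b * H * (\<Sum>j<l. b * dev (k + j) * P j)"
      unfolding sum_distrib_left by (rule order_trans[OF sum_abs])
    moreover have "\<bar>(subdivide a ^^ l) f \<alpha>\<bar> \<le> b * H" unfolding b_def by (rule funpow_bound[OF f])
    ultimately have "\<bar>iterate_masks c k l f \<alpha>\<bar> \<le> b * H * (1 + (\<Sum>j<l. b * dev (k + j) * P j))"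
      unfolding iterate_masks_duhamel distrib_left by linarith
    then show ?case unfolding P .
  qed
  also have "b * H * P l \<le> b * H * exp (b * total)"
  proof -
    have "P l \<le> (\<Prod>j<l. exp (b * dev (k + j)))"
      unfolding P_def using b dev_nonneg by (intro prod_mono conjI exp_ge_add_one_self) auto
    also have "\<dots> = exp (b * (\<Sum>j<l. dev (k + j)))" by (simp add: exp_sum sum_distrib_left)
    also have "(\<Sum>j<l. dev (k + j)) \<le> suminf (\<lambda>j. dev (k + j))"
      using dev_nonneg by (intro sum_le_suminf dev_tail(1)[OF k]) auto
    also have "\<dots> \<le> total / 2 ^ k" by (rule dev_tail(2)[OF k])
    also have "\<dots> \<le> total"
    proof -
      have "total * 1 \<le> total * 2 ^ k" using total_nonneg by (intro mult_left_mono) auto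
      then show ?thesis by (simp add: divide_le_eq)
    qed
    finally have "P l \<le> exp (b * total)" using b by simp
    then show ?thesis using b H by (intro mult_left_mono) auto
  qed
  finally show ?thesis by (simp add: Mc_def b_def mult_ac)
qed

lemma h_bound:
  assumes "1 \<le> k" "\<And>\<beta>. \<bar>f \<beta>\<bar> \<le> H"
  shows "\<bar>h k f j \<beta>\<bar> \<le> dev (k + j) * (Mc * H)"
  unfolding h_def dev_def by (intro abs_subdivide_le iterate_masks_bound assms)

text \<open>Duhamel's formula in the limit of infinitely many steps: each defect contributes its
  stationary limit function, dilated to the mesh on which the defect was made.\<close>

definition perturbed_limit :: "nat \<Rightarrow> (int \<times> int \<Rightarrow> real) \<Rightarrow> real \<times> real \<Rightarrow> real" where
  "perturbed_limit k f x = G f x + suminf (\<lambda>j. G (h k f j) (2 ^ Suc j *\<^sub>R x))"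

definition perturbed_limit' :: "nat \<Rightarrow> (int \<times> int \<Rightarrow> real) \<Rightarrow> real \<times> real \<Rightarrow> (real \<times> real) \<Rightarrow>\<^sub>L real" where
  "perturbed_limit' k f x = G' f x + suminf (\<lambda>j. 2 ^ Suc j *\<^sub>R G' (h k f j) (2 ^ Suc j *\<^sub>R x))"

context
  fixes k :: nat and f :: "int \<times> int \<Rightarrow> real" and H :: real
  assumes k: "1 \<le> k" and f: "\<And>\<beta>. \<bar>f \<beta>\<bar> \<le> H"
begin

lemma H_nonneg: "0 \<le> H"
  using f[of 0] by linarith

lemma hb: "\<bar>h k f j \<beta>\<bar> \<le> dev (k + j) * (Mc * H)"
  by (rule h_bound[OF k]) (rule f)

lemma term_bound: "\<bar>G (h k f j) x\<bar> \<le> \<nu> * (Mc * H * K0) * dev (k + j)"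
  using G_bound(1)[where f = "h k f j" and x = x, OF hb] by (simp add: mult_ac)

lemma term_summable: "summable (\<lambda>j. G (h k f j) (y j))"
proof (rule summable_comparison_test')
  show "summable (\<lambda>j. \<nu> * (Mc * H * K0) * dev (k + j))" by (rule summable_mult[OF dev_tail(1)[OF k]])
  show "norm (G (h k f j) (y j)) \<le> \<nu> * (Mc * H * K0) * dev (k + j)" if "0 \<le> j" for j
    using term_bound by simp
qed

text \<open>The chain rule costs \<open>2 ^ Suc j\<close>, which is written as
  \<open>2 / 2 ^ k\<close> times the weight \<open>2 ^ (k + j)\<close> of the asymptotic
  equivalence. Thus the weighted series pays for differentiation and still leaves a factor
  \<open>1 / 2 ^ k\<close>.\<close>

lemma term_deriv_bound:
  "norm (2 ^ Suc j *\<^sub>R G' (h k f j) x) \<le> \<nu> * (Mc * H * K1) * 2 / 2 ^ k * (2 ^ (k + j) * dev (k + j))"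
proof -
  have "norm (2 ^ Suc j *\<^sub>R G' (h k f j) x) \<le> 2 ^ Suc j * (\<nu> * (dev (k + j) * (Mc * H) * K1))"
    using G_bound(2)[where f = "h k f j" and x = x, OF hb] by simp
  also have "\<dots> = \<nu> * (Mc * H * K1) * 2 / 2 ^ k * (2 ^ (k + j) * dev (k + j))"
    by (simp add: power_add)
  finally show ?thesis .
qed

lemma perturbed_limit_close: "\<bar>perturbed_limit k f x - G f x\<bar> \<le> \<nu> * (Mc * H * K0) * (total / 2 ^ k)"
proof -
  have nn: "0 \<le> \<nu> * (Mc * H * K0)" using nu_ge Mc_nonneg H_nonneg K0 by simp
  have "norm (suminf (\<lambda>j. G (h k f j) (2 ^ Suc j *\<^sub>R x))) \<le> suminf (\<lambda>j. \<nu> * (Mc * H * K0) * dev (k + j))"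
    using term_bound by (intro norm_suminf_le summable_mult dev_tail(1)[OF k]) auto
  also have "\<dots> = \<nu> * (Mc * H * K0) * suminf (\<lambda>j. dev (k + j))" by (rule suminf_mult[OF dev_tail(1)[OF k]])
  also have "\<dots> \<le> \<nu> * (Mc * H * K0) * (total / 2 ^ k)" by (intro mult_left_mono dev_tail(2)[OF k] nn)
  finally show ?thesis by (simp add: perturbed_limit_def)
qed

lemma perturbed_limit'_close: "norm (perturbed_limit' k f x - G' f x) \<le> \<nu> * (Mc * H * K1) * 2 * total / 2 ^ k"
proof -
  define q where "q = \<nu> * (Mc * H * K1) * 2 / 2 ^ k"
  have nn: "0 \<le> q" using nu_ge Mc_nonneg H_nonneg K1 by (simp add: q_def)
  have "norm (suminf (\<lambda>j. 2 ^ Suc j *\<^sub>R G' (h k f j) (2 ^ Suc j *\<^sub>R x))) \<le> suminf (\<lambda>j. q * (2 ^ (k + j) * dev (k + j)))"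
    using term_deriv_bound unfolding q_def by (intro norm_suminf_le summable_mult weighted_tail(1)[OF k])
  also have "\<dots> = q * suminf (\<lambda>j. 2 ^ (k + j) * dev (k + j))" by (rule suminf_mult[OF weighted_tail(1)[OF k]])
  also have "\<dots> \<le> q * total" by (intro mult_left_mono weighted_tail(2)[OF k] nn)
  finally show ?thesis by (simp add: perturbed_limit'_def q_def)
qed

text \<open>Termwise differentiation: the derivative series converges uniformly by the M-test, and
  the series itself converges at the point 0, which is enough to differentiate it.\<close>

lemma perturbed_limit_deriv: "(perturbed_limit k f has_derivative blinfun_apply (perturbed_limit' k f x)) (at x)"
  and perturbed_limit'_cont: "continuous_on UNIV (perturbed_limit' k f)"
proof -
  define D where "D j x = 2 ^ Suc j *\<^sub>R G' (h k f j) (2 ^ Suc j *\<^sub>R x)" for j x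
  have unif: "uniform_limit UNIV (\<lambda>n x. \<Sum>i<n. D i x) (\<lambda>x. suminf (\<lambda>i. D i x)) sequentially"
    unfolding D_def
    by (rule Weierstrass_m_test[OF term_deriv_bound summable_mult[OF weighted_tail(1)[OF k]]])
  have "continuous_on UNIV (\<lambda>x. D j x)" for j
    unfolding D_def by (intro continuous_intros continuous_on_compose2[OF G'_cont]) auto
  then have "continuous_on UNIV (\<lambda>x. suminf (\<lambda>i. D i x))"
    by (intro uniform_limit_theorem[OF _ unif] always_eventually allI continuous_intros) auto
  then show "continuous_on UNIV (perturbed_limit' k f)"
    unfolding perturbed_limit'_def D_def[symmetric] by (intro continuous_intros G'_cont)
  have Dder: "((\<lambda>x. G (h k f j) (2 ^ Suc j *\<^sub>R x)) has_derivative blinfun_apply (D j x)) (at x)" for j x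
  proof -
    have "((\<lambda>x :: real \<times> real. (2 ^ Suc j :: real) *\<^sub>R x) has_derivative (\<lambda>v. 2 ^ Suc j *\<^sub>R v)) (at x)"
      by (intro derivative_intros)
    moreover have "(\<lambda>v. blinfun_apply (G' (h k f j) (2 ^ Suc j *\<^sub>R x)) (2 ^ Suc j *\<^sub>R v)) = blinfun_apply (D j x)"
      by (simp add: D_def fun_eq_iff blinfun.scaleR_left blinfun.scaleR_right del: power_Suc)
    ultimately show ?thesis using has_derivative_compose[OF _ G_deriv[of "h k f j"]] by fastforce
  qed
  have "\<exists>g. \<forall>x\<in>UNIV. (\<lambda>n. G (h k f n) (2 ^ Suc n *\<^sub>R x)) sums g x \<and>
      (g has_derivative blinfun_apply (suminf (\<lambda>i. D i x))) (at x within UNIV)"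
  proof (rule has_derivative_series[where l = "suminf (\<lambda>n. G (h k f n) (2 ^ Suc n *\<^sub>R 0))" and x = 0])
    show "((\<lambda>x. G (h k f n) (2 ^ Suc n *\<^sub>R x)) has_derivative blinfun_apply (D n x)) (at x within UNIV)" for n x
      using Dder by simp
    show "(\<lambda>n. G (h k f n) (2 ^ Suc n *\<^sub>R 0)) sums suminf (\<lambda>n. G (h k f n) (2 ^ Suc n *\<^sub>R 0))"
      by (rule summable_sums[OF term_summable])
    fix \<epsilon> :: real assume "0 < \<epsilon>"
    from uniform_limitD[OF unif this]
    show "\<forall>\<^sub>F n in sequentially. \<forall>x\<in>UNIV. \<forall>v. norm ((\<Sum>i<n. blinfun_apply (D i x) v) - blinfun_apply (suminf (\<lambda>i. D i x)) v) \<le> \<epsilon> * norm v"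
    proof (rule eventually_mono, intro ballI allI)
      fix n and x v :: "real \<times> real" assume "\<forall>x\<in>UNIV. dist (\<Sum>i<n. D i x) (suminf (\<lambda>i. D i x)) < \<epsilon>"
      then have "dist (\<Sum>i<n. D i x) (suminf (\<lambda>i. D i x)) < \<epsilon>" by blast
      then have "norm ((\<Sum>i<n. D i x) - suminf (\<lambda>i. D i x)) \<le> \<epsilon>" by (simp add: dist_norm)
      then have "norm ((\<Sum>i<n. D i x) - suminf (\<lambda>i. D i x)) * norm v \<le> \<epsilon> * norm v" by (intro mult_right_mono) auto
      moreover have "norm (blinfun_apply ((\<Sum>i<n. D i x) - suminf (\<lambda>i. D i x)) v) \<le> norm ((\<Sum>i<n. D i x) - suminf (\<lambda>i. D i x)) * norm v"
        by (rule norm_blinfun)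
      ultimately show "norm ((\<Sum>i<n. blinfun_apply (D i x) v) - blinfun_apply (suminf (\<lambda>i. D i x)) v) \<le> \<epsilon> * norm v"
        by (simp add: blinfun.diff_left blinfun.sum_left)
    qed
  qed auto
  then obtain g where "\<forall>x\<in>UNIV. (\<lambda>n. G (h k f n) (2 ^ Suc n *\<^sub>R x)) sums g x \<and>
      (g has_derivative blinfun_apply (suminf (\<lambda>i. D i x))) (at x)" by blast
  then have g: "\<And>x. (\<lambda>n. G (h k f n) (2 ^ Suc n *\<^sub>R x)) sums g x"
    "\<And>x. (g has_derivative blinfun_apply (suminf (\<lambda>i. D i x))) (at x)" by blast+
  have perturbed_limit: "perturbed_limit k f = (\<lambda>x. G f x + g x)" using sums_unique[OF g(1)] by (simp add: perturbed_limit_def fun_eq_iff)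
  have "blinfun_apply (perturbed_limit' k f x) = (\<lambda>v. blinfun_apply (G' f x) v + blinfun_apply (suminf (\<lambda>i. D i x)) v)"
    by (simp add: perturbed_limit'_def D_def blinfun.add_left fun_eq_iff)
  then show "(perturbed_limit k f has_derivative blinfun_apply (perturbed_limit' k f x)) (at x)"
    unfolding perturbed_limit by (simp add: has_derivative_add[OF G_deriv g(2)])
qed

lemma perturbed_limit_limit: "has_limit_function c k f (perturbed_limit k f)"
  unfolding has_limit_function_def
proof
  show "continuous_on UNIV (perturbed_limit k f)"
    using perturbed_limit_deriv by (intro continuous_at_imp_continuous_on ballI has_derivative_continuous) blast
  \<comment> \<open>Bound for the mismatch of term \<open>j\<close> after \<open>l\<close> steps. If
    \<open>j < l\<close>, the defect has been refined \<open>l - Suc j\<close> more times; otherwise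
    it has not yet entered the iterate and its whole contribution counts. \<open>M\<close> dominates
    both cases independently of \<open>l\<close>.\<close>
  define T where "T l j = \<nu> * (Mc * H) * dev (k + j) * (if j < l then eps (l - Suc j) else K0 + B0)" for l j
  define M where "M j = \<nu> * (Mc * H) * (K0 + B0) * dev (k + j)" for j
  have nn: "0 \<le> \<nu> * (Mc * H)" "0 \<le> K0 + B0" using nu_ge Mc_nonneg H_nonneg K0 B0(1) by auto
  have M: "summable M" unfolding M_def by (intro summable_mult dev_tail(1)[OF k])
  have T0: "0 \<le> T l j" for l j using nn dev_nonneg eps(2) by (simp add: T_def)
  have TM: "T l j \<le> M j" for l j
  proof -
    have "\<nu> * (Mc * H) * dev (k + j) * (if j < l then eps (l - Suc j) else K0 + B0) \<le> \<nu> * (Mc * H) * dev (k + j) * (K0 + B0)"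
      using nn dev_nonneg eps(3) by (intro mult_left_mono) auto
    then show ?thesis by (simp add: T_def M_def mult_ac)
  qed
  have Tlim: "(\<lambda>l. T l j) \<longlonglongrightarrow> 0" for j
  proof -
    have "(\<lambda>l. \<nu> * (Mc * H) * dev (k + j) * eps l) \<longlonglongrightarrow> \<nu> * (Mc * H) * dev (k + j) * 0"
      by (intro tendsto_intros eps_tendsto)
    moreover have "T (l + Suc j) j = \<nu> * (Mc * H) * dev (k + j) * eps l" for l by (simp add: T_def)
    ultimately have "(\<lambda>l. T (l + Suc j) j) \<longlonglongrightarrow> 0" by simp
    then show ?thesis by (rule LIMSEQ_offset)
  qed
  have sumT: "summable (T l)" for l
    by (rule summable_comparison_test'[OF M, of 0]) (use T0 TM in simp)
  \<comment> \<open>Each \<open>T l j\<close> tends to 0 without a rate, so limit and series are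
    exchanged by dominated convergence.\<close>
  have "(\<lambda>l. suminf (\<lambda>j. T l j)) \<longlonglongrightarrow> suminf (\<lambda>j. 0)"
    using tannerys_theorem[of "\<lambda>j l. T l j" "\<lambda>_. 0" sequentially M, OF Tlim _ M] T0 TM by (simp add: always_eventually)
  then have lim0: "(\<lambda>l. \<nu> * (H * eps l) + suminf (T l)) \<longlonglongrightarrow> \<nu> * (H * 0) + 0"
    by (intro tendsto_intros eps_tendsto) simp
  have main: "\<bar>perturbed_limit k f (grid_point l \<alpha>) - iterate_masks c k l f \<alpha>\<bar> \<le> \<nu> * (H * eps l) + suminf (T l)" for l \<alpha>
  proof -
    define u where "u j = G (h k f j) (2 ^ Suc j *\<^sub>R grid_point l \<alpha>)" for j
    \<comment> \<open>The finite Duhamel sum padded with zeros, to be subtracted from the series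
      term by term.\<close>
    define w where "w j = (if j \<in> {..<l} then (subdivide a ^^ (l - Suc j)) (h k f j) \<alpha> else 0)" for j
    have u: "summable u" unfolding u_def by (rule term_summable)
    have w: "w sums (\<Sum>j<l. (subdivide a ^^ (l - Suc j)) (h k f j) \<alpha>)"
      unfolding w_def by (rule sums_If_finite_set) simp
    have uw: "\<bar>u j - w j\<bar> \<le> T l j" for j
    proof (cases "j < l")
      case True
      \<comment> \<open>The dilation matches the index: a point of grid \<open>l\<close> becomes a
        point of grid \<open>l - Suc j\<close>, the number of refinements the defect has
        undergone.\<close>
      have "2 ^ Suc j *\<^sub>R grid_point l \<alpha> = grid_point (l - Suc j) \<alpha>"
      proof -
        have "(2::real) ^ l = 2 ^ (l - Suc j) * 2 ^ Suc j" using True by (simp only: power_add[symmetric]) simp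
        then show ?thesis by (simp add: grid_point_def del: power_Suc)
      qed
      then have "u j - w j = G (h k f j) (grid_point (l - Suc j) \<alpha>) - (subdivide a ^^ (l - Suc j)) (h k f j) \<alpha>"
        using True by (simp add: u_def w_def)
      then show ?thesis
        using G_approx[where f = "h k f j" and m = "l - Suc j" and \<alpha> = \<alpha>, OF hb] True by (simp add: T_def mult_ac)
    next
      case False
      have "\<nu> * (Mc * H * K0) * dev (k + j) \<le> \<nu> * (Mc * H) * dev (k + j) * (K0 + B0)"
      proof -
        have "\<nu> * (Mc * H) * dev (k + j) * K0 \<le> \<nu> * (Mc * H) * dev (k + j) * (K0 + B0)"
          using nn(1) dev_nonneg B0(1) by (intro mult_left_mono) auto
        then show ?thesis by (simp add: mult_ac)
      qed
      then show ?thesis using False term_bound[of j "2 ^ Suc j *\<^sub>R grid_point l \<alpha>"] unfolding u_def w_def T_def by simp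
    qed
    have "perturbed_limit k f (grid_point l \<alpha>) - iterate_masks c k l f \<alpha> =
        (G f (grid_point l \<alpha>) - (subdivide a ^^ l) f \<alpha>) + suminf (\<lambda>j. u j - w j)"
      unfolding suminf_diff[OF u sums_summable[OF w], symmetric] sums_unique[OF w, symmetric]
      by (simp add: perturbed_limit_def u_def[abs_def] iterate_masks_duhamel)
    moreover have "norm (suminf (\<lambda>j. u j - w j)) \<le> suminf (T l)"
      using uw by (intro norm_suminf_le sumT) auto
    ultimately show ?thesis using G_approx[where f = f and m = l and \<alpha> = \<alpha>, OF f] by simp
  qed
  show "uniform_limit UNIV (\<lambda>l \<alpha>. perturbed_limit k f (grid_point l \<alpha>) - iterate_masks c k l f \<alpha>) (\<lambda>\<alpha>. 0) sequentially"
  proof (rule uniform_limitI)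
    fix \<epsilon> :: real assume "0 < \<epsilon>"
    then have "\<forall>\<^sub>F l in sequentially. \<nu> * (H * eps l) + suminf (T l) < \<epsilon>"
      using order_tendstoD(2)[OF lim0] by simp
    then show "\<forall>\<^sub>F l in sequentially. \<forall>\<alpha>\<in>UNIV. dist (perturbed_limit k f (grid_point l \<alpha>) - iterate_masks c k l f \<alpha>) 0 < \<epsilon>"
      by (rule eventually_mono) (use main in \<open>auto intro: le_less_trans\<close>)
  qed
qed

end

end

section \<open>Conclusions for the regular regions\<close>

lemma mask_radius_exists:
  obtains R :: int where "0 \<le> R" "\<forall>\<alpha>\<in>Poly_Mapping.keys (a :: laurent2). \<bar>fst \<alpha>\<bar> \<le> R \<and> \<bar>snd \<alpha>\<bar> \<le> R"
proof
  define R where "R = (\<Sum>\<alpha>\<in>Poly_Mapping.keys a. \<bar>fst \<alpha>\<bar> + \<bar>snd \<alpha>\<bar>)"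
  show "0 \<le> R" by (simp add: R_def sum_nonneg)
  show "\<forall>\<alpha>\<in>Poly_Mapping.keys a. \<bar>fst \<alpha>\<bar> \<le> R \<and> \<bar>snd \<alpha>\<bar> \<le> R"
  proof
    fix \<alpha> assume "\<alpha> \<in> Poly_Mapping.keys a"
    then have "\<bar>fst \<alpha>\<bar> + \<bar>snd \<alpha>\<bar> \<le> R" unfolding R_def by (intro member_le_sum) auto
    then show "\<bar>fst \<alpha>\<bar> \<le> R \<and> \<bar>snd \<alpha>\<bar> \<le> R" by linarith
  qed
qed

lemma bounded_delta: "bounded (range delta)"
  by (rule boundedI[of _ 1]) (auto simp: delta_def)

text \<open>The perturbation series gives existence and smoothness of the limits; that some limit is
  non-zero comes from \<open>nonsing\<close>, applied to \<open>delta\<close>. The basic limit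
  functions are the perturbed limits of \<open>delta\<close>, whose distance to
  \<open>\<phi>\<close> in value and derivative is of order \<open>(1 / 2) ^ k\<close>.\<close>

lemma regular_convergence:
  fixes c :: "nat \<Rightarrow> laurent2"
  assumes C1: "C1_convergent_regular (\<lambda>_. cbar)"
    and summ: "summable (\<lambda>k. 2 ^ Suc k * subdivision_norm (c (Suc k) - cbar))"
    and nonsing: "\<And>f. bounded (range f) \<Longrightarrow> has_limit_function c 1 f (\<lambda>x. 0) \<longleftrightarrow> f = (\<lambda>\<alpha>. 0)"
  shows "C1_convergent_regular c"
    and "\<exists>\<phi>' \<phi>k' \<epsilon> K. continuous_on UNIV \<phi>' \<and>
      (\<forall>x. (basic_limit_function (\<lambda>_. cbar) 1 has_derivative blinfun_apply (\<phi>' x)) (at x)) \<and>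
      (\<forall>x. \<bar>basic_limit_function (\<lambda>_. cbar) 1 x\<bar> \<le> K \<and> norm (\<phi>' x) \<le> K) \<and>
      (\<forall>k\<ge>1. \<forall>x. (basic_limit_function c k has_derivative blinfun_apply (\<phi>k' k x)) (at x) \<and>
         \<bar>basic_limit_function c k x - basic_limit_function (\<lambda>_. cbar) 1 x\<bar> \<le> \<epsilon> k \<and>
         norm (\<phi>k' k x - \<phi>' x) \<le> \<epsilon> k) \<and>
      \<epsilon> \<longlonglongrightarrow> (0::real)"
proof -
  obtain R :: int where R: "0 \<le> R" "\<forall>\<alpha>\<in>Poly_Mapping.keys cbar. \<bar>fst \<alpha>\<bar> \<le> R \<and> \<bar>snd \<alpha>\<bar> \<le> R"
    by (rule mask_radius_exists)
  obtain \<phi> where lim: "has_limit_function (\<lambda>_. cbar) 1 delta \<phi>"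
    using C1 bounded_delta unfolding C1_convergent_regular_def convergent_regular_def by blast
  then have "C1_function \<phi>" using C1 bounded_delta unfolding C1_convergent_regular_def by blast
  then obtain \<phi>' where \<phi>': "continuous_on UNIV \<phi>'" "\<And>x. (\<phi> has_derivative blinfun_apply (\<phi>' x)) (at x)"
    unfolding C1_function_def by blast
  interpret asymptotically_equivalent cbar R \<phi> \<phi>' c
    by unfold_locales (use R lim \<phi>' summ in auto)
  have bnd: "\<exists>H. \<forall>\<beta>. \<bar>f \<beta>\<bar> \<le> H" if "bounded (range f)" for f :: "int \<times> int \<Rightarrow> real"
    using that unfolding bounded_iff by (auto simp: real_norm_def)
  show "C1_convergent_regular c"
    unfolding C1_convergent_regular_def convergent_regular_def
  proof (intro conjI allI impI)
    show ex: "\<exists>g. has_limit_function c 1 f g" if "bounded (range f)" for f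
      using bnd[OF that] perturbed_limit_limit[of 1 f] by blast
    obtain g where g: "has_limit_function c 1 delta g" using ex[OF bounded_delta] by blast
    have "delta 0 \<noteq> 0" by (simp add: delta_def)
    then have "delta \<noteq> (\<lambda>\<alpha>. 0)" by metis
    moreover from this have "g \<noteq> (\<lambda>x. 0)" using nonsing[OF bounded_delta] g by blast
    ultimately show "\<exists>f g. bounded (range f) \<and> f \<noteq> (\<lambda>\<alpha>. 0) \<and> has_limit_function c 1 f g \<and> g \<noteq> (\<lambda>x. 0)"
      using g bounded_delta by blast
    fix f g assume "bounded (range f)" and g: "has_limit_function c 1 f g"
    then obtain H where H: "\<And>\<beta>. \<bar>f \<beta>\<bar> \<le> H" using bnd by blast
    have "g = perturbed_limit 1 f" using has_limit_function_unique[OF g perturbed_limit_limit[where f = f and k = 1, OF _ H]] by simp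
    moreover have "C1_function (perturbed_limit 1 f)"
      unfolding C1_function_def using perturbed_limit'_cont[where f = f and k = 1, OF _ H] perturbed_limit_deriv[where f = f and k = 1, OF _ H] by blast
    ultimately show "C1_function g" by simp
  qed
  have delta_le: "\<bar>delta \<beta>\<bar> \<le> 1" for \<beta> by (simp add: delta_def)
  have blf: "basic_limit_function (\<lambda>_. cbar) 1 = \<phi>" using lim by (rule basic_limit_function_eqI)
  have blfk: "basic_limit_function c k = perturbed_limit k delta" if "1 \<le> k" for k
    using perturbed_limit_limit[where f = delta, OF that delta_le] by (rule basic_limit_function_eqI)
  define \<epsilon> where "\<epsilon> k = (\<nu> * (Mc * 1 * K0) * total + \<nu> * (Mc * 1 * K1) * 2 * total) * (1 / 2) ^ k" for k
  have nn: "0 \<le> \<nu> * (Mc * 1 * K0) * total * (1 / 2) ^ k" "0 \<le> \<nu> * (Mc * 1 * K1) * 2 * total * (1 / 2) ^ k" for k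
    using nu_ge Mc_nonneg K0(1) K1(1) total_nonneg by auto
  have close: "\<bar>perturbed_limit k delta x - \<phi> x\<bar> \<le> \<epsilon> k" "norm (perturbed_limit' k delta x - \<phi>' x) \<le> \<epsilon> k" if "1 \<le> k" for k x
  proof -
    show "\<bar>perturbed_limit k delta x - \<phi> x\<bar> \<le> \<epsilon> k"
      using perturbed_limit_close[where f = delta and x = x, OF that delta_le] nn(2)[of k] unfolding G_delta \<epsilon>_def
      by (simp add: power_divide add_divide_distrib)
    show "norm (perturbed_limit' k delta x - \<phi>' x) \<le> \<epsilon> k"
      using perturbed_limit'_close[where f = delta and x = x, OF that delta_le] nn(1)[of k] unfolding G'_delta \<epsilon>_def
      by (simp add: power_divide add_divide_distrib)
  qed
  have \<epsilon>0: "\<epsilon> \<longlonglongrightarrow> 0"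
    unfolding \<epsilon>_def by (intro tendsto_mult_right_zero LIMSEQ_realpow_zero) auto
  show "\<exists>\<phi>' \<phi>k' \<epsilon> K. continuous_on UNIV \<phi>' \<and>
      (\<forall>x. (basic_limit_function (\<lambda>_. cbar) 1 has_derivative blinfun_apply (\<phi>' x)) (at x)) \<and>
      (\<forall>x. \<bar>basic_limit_function (\<lambda>_. cbar) 1 x\<bar> \<le> K \<and> norm (\<phi>' x) \<le> K) \<and>
      (\<forall>k\<ge>1. \<forall>x. (basic_limit_function c k has_derivative blinfun_apply (\<phi>k' k x)) (at x) \<and>
         \<bar>basic_limit_function c k x - basic_limit_function (\<lambda>_. cbar) 1 x\<bar> \<le> \<epsilon> k \<and>
         norm (\<phi>k' k x - \<phi>' x) \<le> \<epsilon> k) \<and>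
      \<epsilon> \<longlonglongrightarrow> (0::real)"
  proof (rule exI[of _ \<phi>'], rule exI[of _ "\<lambda>k. perturbed_limit' k delta"], rule exI[of _ \<epsilon>], rule exI[of _ "K0 + K1"],
      intro conjI allI impI)
    fix x show "\<bar>basic_limit_function (\<lambda>_. cbar) 1 x\<bar> \<le> K0 + K1" unfolding blf using K0(2)[of x] K1(1) by linarith
    show "norm (\<phi>' x) \<le> K0 + K1" using K1(2)[of x] K0(1) by linarith
    fix k :: nat assume k: "1 \<le> k"
    show "(basic_limit_function c k has_derivative blinfun_apply (perturbed_limit' k delta x)) (at x)"
      unfolding blfk[OF k] by (rule perturbed_limit_deriv[OF k delta_le])
  qed (use blf blfk close \<phi>' \<epsilon>0 in \<open>simp_all only:\<close>)
qed

section \<open>Iteration of asymptotically equivalent matrices\<close>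

text \<open>Induction in the manner of Gram-Schmidt. The part \<open>r\<close> of the new vector
  that the old functionals do not explain is non-zero by independence, so one of its coordinates can
  serve to build the new functional.\<close>

lemma dual_family:
  fixes x :: "nat \<Rightarrow> nat \<Rightarrow> real"
  assumes "\<And>c. (\<And>t. t < N \<Longrightarrow> (\<Sum>i<m. c i * x i t) = 0) \<Longrightarrow> \<forall>i<m. c i = 0"
  shows "\<exists>w. \<forall>i<m. \<forall>j<m. (\<Sum>t<N. w i t * x j t) = (if i = j then 1 else 0)"
  using assms
proof (induction m)
  case 0
  then show ?case by simp
next
  case (Suc m)
  have "\<forall>i<m. c i = 0" if c: "\<And>t. t < N \<Longrightarrow> (\<Sum>i<m. c i * x i t) = 0" for c
  proof -
    have "\<forall>i<Suc m. (c(m := 0)) i = 0"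
    proof (rule Suc.prems)
      fix t assume "t < N"
      then have "(\<Sum>i<m. (c(m := 0)) i * x i t) = 0"
        using c[of t] by simp
      then show "(\<Sum>i<Suc m. (c(m := 0)) i * x i t) = 0" by simp
    qed
    then show ?thesis by (auto simp: less_Suc_eq)
  qed
  from Suc.IH[OF this] obtain w where
    w: "\<And>i j. i < m \<Longrightarrow> j < m \<Longrightarrow> (\<Sum>t<N. w i t * x j t) = (if i = j then 1 else 0)"
    by auto
  define b where "b i = (\<Sum>t<N. w i t * x m t)" for i
  define r where "r t = x m t - (\<Sum>i<m. b i * x i t)" for t
  have "\<exists>s<N. r s \<noteq> 0"
  proof (rule ccontr)
    assume "\<not> (\<exists>s<N. r s \<noteq> 0)"
    then have r0: "r t = 0" if "t < N" for t using that by blast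
    have "\<forall>i<Suc m. (\<lambda>i. if i = m then 1 else - b i) i = 0"
    proof (rule Suc.prems)
      fix t assume t: "t < N"
      have "(\<Sum>i<m. (if i = m then 1 else - b i) * x i t) = (\<Sum>i<m. - (b i * x i t))"
        by (rule sum.cong) auto
      then show "(\<Sum>i<Suc m. (if i = m then 1 else - b i) * x i t) = 0"
        using r0[OF t] by (simp add: r_def sum_negf)
    qed
    then show False by auto
  qed
  then obtain s where s: "s < N" "r s \<noteq> 0" by blast
  \<comment> \<open>Coordinate \<open>s\<close> of the projection along the old vectors, normalised
    at \<open>r s\<close>: it kills the old vectors and is 1 on the new one.\<close>
  define e where "e t = ((if t = s then 1 else 0) - (\<Sum>i<m. x i s * w i t)) / r s" for t
  have e: "(\<Sum>t<N. e t * g t) = (g s - (\<Sum>i<m. x i s * (\<Sum>t<N. w i t * g t))) / r s" for g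
  proof -
    have "(\<Sum>t<N. e t * g t) =
      ((\<Sum>t<N. (if t = s then 1 else 0) * g t) - (\<Sum>t<N. (\<Sum>i<m. x i s * w i t) * g t)) / r s"
      unfolding e_def by (simp add: sum_subtractf[symmetric] sum_divide_distrib algebra_simps)
    also have "(\<Sum>t<N. (if t = s then 1 else 0) * g t) = g s"
      using s(1) by (simp add: if_distrib[of "\<lambda>y. y * _"] cong: if_cong)
    also have "(\<Sum>t<N. (\<Sum>i<m. x i s * w i t) * g t) = (\<Sum>i<m. x i s * (\<Sum>t<N. w i t * g t))"
      by (simp add: sum_distrib_left sum_distrib_right mult.assoc) (rule sum.swap)
    finally show ?thesis .
  qed
  have e_old: "(\<Sum>t<N. e t * x j t) = 0" if "j < m" for j
  proof -
    have "(\<Sum>i<m. x i s * (\<Sum>t<N. w i t * x j t)) = (\<Sum>i<m. x i s * (if i = j then 1 else 0))"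
      using w that by (intro sum.cong) auto
    also have "\<dots> = x j s" using that by (simp add: if_distrib[of "\<lambda>y. _ * y"] cong: if_cong)
    finally show ?thesis unfolding e by simp
  qed
  have e_new: "(\<Sum>t<N. e t * x m t) = 1"
    using s(2) unfolding e b_def[symmetric] by (simp add: r_def mult.commute)
  \<comment> \<open>The old functionals take the value \<open>b i\<close> on the new vector, which
    the multiple of \<open>e\<close> removes.\<close>
  define w' where "w' i t = (if i = m then e t else w i t - b i * e t)" for i t
  have w'_m: "(\<Sum>t<N. w' m t * g t) = (\<Sum>t<N. e t * g t)" for g
    by (simp add: w'_def)
  have w'_i: "(\<Sum>t<N. w' i t * g t) = (\<Sum>t<N. w i t * g t) - b i * (\<Sum>t<N. e t * g t)" if "i < m" for g i
    using that by (simp add: w'_def algebra_simps sum_subtractf sum_distrib_left)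
  have "(\<Sum>t<N. w' i t * x j t) = (if i = j then 1 else 0)" if "i < Suc m" "j < Suc m" for i j
  proof (cases "i = m")
    case True
    then show ?thesis using that e_old e_new by (auto simp: w'_m less_Suc_eq)
  next
    case False
    then have "i < m" using that by simp
    then show ?thesis using that e_old e_new w[of i j] b_def[of i]
      by (auto simp: w'_i less_Suc_eq)
  qed
  then show ?case by blast
qed

text \<open>The matrix determinant lemma with \<open>X / z\<close> in place of the inverse of
  \<open>A\<close> applied to \<open>X\<close>. Evaluating one bordered determinant in two ways,
  multiplied by \<open>z\<close>, avoids any invertibility of \<open>A\<close> and any
  division.\<close>

lemma det_rank_one_update:
  fixes A :: "'a::idom Matrix.mat"
  assumes A: "A \<in> carrier_mat n n" and X: "X \<in> carrier_mat n 1" and U: "U \<in> carrier_mat 1 n"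
    and AX: "A * X = z \<cdot>\<^sub>m X"
  shows "Determinant.det (A + X * U) * z = Determinant.det A * (z + (U * X) $$ (0, 0))"
proof -
  define M where "M = four_block_mat A X (- U) (1\<^sub>m 1)"
  have M: "M \<in> carrier_mat (n + 1) (n + 1)"
    using A X U by (auto simp: M_def)
  \<comment> \<open>First evaluation: the column operation with blocks \<open>- X\<close> and
    \<open>Z\<close> clears the upper right block, as \<open>X\<close> is an eigenvector of
    \<open>A\<close> for \<open>z\<close>.\<close>
  define Z :: "'a Matrix.mat" where "Z = z \<cdot>\<^sub>m 1\<^sub>m 1"
  have Z: "Z \<in> carrier_mat 1 1" by (simp add: Z_def)
  have "M * four_block_mat (1\<^sub>m n) (- X) (0\<^sub>m 1 n) Z =
    four_block_mat (A * 1\<^sub>m n + X * 0\<^sub>m 1 n) (A * (- X) + X * Z)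
      ((- U) * 1\<^sub>m n + 1\<^sub>m 1 * 0\<^sub>m 1 n) ((- U) * (- X) + 1\<^sub>m 1 * Z)"
    unfolding M_def by (rule mult_four_block_mat) (use A X U Z in auto)
  also have "A * 1\<^sub>m n + X * 0\<^sub>m 1 n = A"
    using A X by simp
  also have "A * (- X) + X * Z = 0\<^sub>m n 1"
    using A X AX by (auto simp: Z_def intro!: eq_matI)
  also have "(- U) * 1\<^sub>m n + 1\<^sub>m 1 * 0\<^sub>m 1 n = - U"
    using U by auto
  also have "(- U) * (- X) + 1\<^sub>m 1 * Z = U * X + Z"
    using U X Z by auto
  finally have 1: "M * four_block_mat (1\<^sub>m n) (- X) (0\<^sub>m 1 n) Z = four_block_mat A (0\<^sub>m n 1) (- U) (U * X + Z)" .
  have "Determinant.det M * Determinant.det (four_block_mat (1\<^sub>m n) (- X) (0\<^sub>m 1 n) Z) =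
     Determinant.det (four_block_mat A (0\<^sub>m n 1) (- U) (U * X + Z))"
    unfolding 1[symmetric] by (rule det_mult[symmetric]) (use M X Z in auto)
  also have "Determinant.det (four_block_mat A (0\<^sub>m n 1) (- U) (U * X + Z)) =
     Determinant.det A * Determinant.det (U * X + Z)"
    by (rule det_four_block_mat_upper_right_zero) (use A U X Z in auto)
  also have "Determinant.det (four_block_mat (1\<^sub>m n) (- X) (0\<^sub>m 1 n) Z) = Determinant.det (1\<^sub>m n :: 'a Matrix.mat) * Determinant.det Z"
    by (rule det_four_block_mat_lower_left_zero) (use X Z in auto)
  finally have 2: "Determinant.det M * z = Determinant.det A * (z + (U * X) $$ (0, 0))"
    using U X by (simp add: Z_def det_single add.commute)
  \<comment> \<open>Second evaluation: eliminating with the lower right identity block leaves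
    \<open>A + X * U\<close> as Schur complement.\<close>
  have "four_block_mat (1\<^sub>m n) X (0\<^sub>m 1 n) (1\<^sub>m 1) * four_block_mat (A + X * U) (0\<^sub>m n 1) (- U) (1\<^sub>m 1) =
    four_block_mat (1\<^sub>m n * (A + X * U) + X * (- U)) (1\<^sub>m n * 0\<^sub>m n 1 + X * 1\<^sub>m 1)
      (0\<^sub>m 1 n * (A + X * U) + 1\<^sub>m 1 * (- U)) (0\<^sub>m 1 n * 0\<^sub>m n 1 + 1\<^sub>m 1 * 1\<^sub>m 1)"
    by (rule mult_four_block_mat) (use A X U in auto)
  also have "1\<^sub>m n * (A + X * U) + X * (- U) = A"
    using A X U by (auto intro!: eq_matI)
  also have "1\<^sub>m n * 0\<^sub>m n 1 + X * 1\<^sub>m 1 = X"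
    using X by auto
  also have "0\<^sub>m 1 n * (A + X * U) + 1\<^sub>m 1 * (- U) = - U"
    using A X U by auto
  also have "0\<^sub>m 1 n * 0\<^sub>m n 1 + 1\<^sub>m 1 * 1\<^sub>m 1 = (1\<^sub>m 1 :: 'a Matrix.mat)"
    by auto
  finally have 3: "M = four_block_mat (1\<^sub>m n) X (0\<^sub>m 1 n) (1\<^sub>m 1) * four_block_mat (A + X * U) (0\<^sub>m n 1) (- U) (1\<^sub>m 1)"
    by (simp add: M_def)
  have "Determinant.det M = Determinant.det (four_block_mat (1\<^sub>m n) X (0\<^sub>m 1 n) (1\<^sub>m 1)) *
      Determinant.det (four_block_mat (A + X * U) (0\<^sub>m n 1) (- U) (1\<^sub>m 1))"
    unfolding 3 by (rule det_mult) (use A X U in auto)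
  also have "Determinant.det (four_block_mat (1\<^sub>m n) X (0\<^sub>m 1 n) (1\<^sub>m 1)) =
     Determinant.det (1\<^sub>m n :: 'a Matrix.mat) * Determinant.det (1\<^sub>m 1 :: 'a Matrix.mat)"
    by (rule det_four_block_mat_lower_left_zero) (use X in auto)
  also have "Determinant.det (four_block_mat (A + X * U) (0\<^sub>m n 1) (- U) (1\<^sub>m 1)) =
     Determinant.det (A + X * U) * Determinant.det (1\<^sub>m 1 :: 'a Matrix.mat)"
    by (rule det_four_block_mat_upper_right_zero) (use A X U in auto)
  finally have "Determinant.det M = Determinant.det (A + X * U)" by simp
  with 2 show ?thesis by simp
qed

text \<open>Wielandt deflation: a rank-one term along an eigenvector moves its eigenvalue
  \<open>\<mu>\<close> to 0 and keeps the rest of the spectrum. The polynomials are compared at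
  every \<open>z\<close> through the determinant identity for \<open>z\<close> times the identity
  minus \<open>S\<close>.\<close>

lemma char_poly_deflation:
  fixes S :: "real Matrix.mat"
  assumes S: "S \<in> carrier_mat n n" and X: "X \<in> carrier_mat n 1" and U: "U \<in> carrier_mat 1 n"
    and SX: "S * X = \<mu> \<cdot>\<^sub>m X" and UX: "(U * X) $$ (0, 0) = \<mu>"
  shows "char_poly (S - X * U) * [:- \<mu>, 1:] = char_poly S * [:0, 1:]"
proof -
  have "poly (char_poly (S - X * U) * [:- \<mu>, 1:]) z = poly (char_poly S * [:0, 1:]) z" for z
  proof -
    define A where "A = - char_matrix S z"
    have A: "A \<in> carrier_mat n n" using S by (auto simp: A_def char_matrix_def)
    have "S * X + (- z) \<cdot>\<^sub>m 1\<^sub>m n * X = (\<mu> - z) \<cdot>\<^sub>m X"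
      using S X SX by (auto intro!: eq_matI simp: algebra_simps)
    then have "A * X = (z - \<mu>) \<cdot>\<^sub>m X"
      using S X by (auto simp: A_def char_matrix_def add_mult_distrib_mat[of _ n n] algebra_simps intro!: eq_matI)
    from det_rank_one_update[OF A X U this]
    have "Determinant.det (A + X * U) * (z - \<mu>) = Determinant.det A * z" using UX by simp
    moreover have "A + X * U = - char_matrix (S - X * U) z"
      using S X U by (auto simp: A_def char_matrix_def intro!: eq_matI)
    moreover have "S - X * U \<in> carrier_mat n n" using S X U by auto
    ultimately show ?thesis
      using S by (simp add: char_poly_matrix A_def algebra_simps)
  qed
  then show ?thesis by (simp add: poly_eq_poly_eq_iff[symmetric] fun_eq_iff)
qed

text \<open>A \<open>\<rho>\<close> strictly above the spectral radius absorbs the polynomial growth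
  caused by Jordan blocks: after division by \<open>\<rho>\<close> the spectral radius is below 1
  and the powers are bounded. The extra room above \<open>\<tau>\<close> later serves to put
  \<open>\<rho>\<close> above \<open>1 / \<sigma>\<close>.\<close>

lemma matrix_power_bound:
  fixes D :: "real Matrix.mat"
  assumes D: "D \<in> carrier_mat n n" and lam: "0 < lam" "\<tau> < lam"
    and ev: "\<And>z. eigenvalue (map_mat complex_of_real D) z \<Longrightarrow> cmod z < lam"
  shows "\<exists>\<rho> K. 0 < \<rho> \<and> \<tau> < \<rho> \<and> \<rho> < lam \<and> (\<forall>m. \<forall>i<n. \<forall>j<n. \<bar>(D ^\<^sub>m m) $$ (i, j)\<bar> \<le> K * \<rho> ^ m)"
proof (cases "n = 0")
  case True
  obtain \<rho> where "max 0 \<tau> < \<rho>" "\<rho> < lam" using lam dense[of "max 0 \<tau>" lam] by auto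
  then show ?thesis using True by auto
next
  case False
  define A where "A = map_mat complex_of_real D"
  have A: "A \<in> carrier_mat n n" using D by (simp add: A_def)
  have "spectral_radius A < lam"
    using spectral_radius_mem_max(1)[OF A] False ev by (auto simp: A_def spectrum_def)
  then obtain \<rho> where \<rho>: "max (max 0 \<tau>) (spectral_radius A) < \<rho>" "\<rho> < lam"
    using lam dense[of "max (max 0 \<tau>) (spectral_radius A)" lam] by auto
  define B where "B = complex_of_real (1 / \<rho>) \<cdot>\<^sub>m A"
  have B: "B \<in> carrier_mat n n" using A by (simp add: B_def)
  have "cmod z < 1" if "eigenvalue B z" for z
  proof -
    from that obtain v where v: "v \<in> carrier_vec n" "v \<noteq> 0\<^sub>v n" "B *\<^sub>v v = z \<cdot>\<^sub>v v"
      using B by (auto simp: eigenvalue_def eigenvector_def)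
    have "B *\<^sub>v v = complex_of_real (1 / \<rho>) \<cdot>\<^sub>v (A *\<^sub>v v)"
      using v(1) A unfolding B_def by (auto intro!: eq_vecI simp: scalar_prod_def sum_divide_distrib)
    then have "complex_of_real (1 / \<rho>) \<cdot>\<^sub>v (A *\<^sub>v v) = z \<cdot>\<^sub>v v"
      using v(3) by simp
    then have "complex_of_real \<rho> \<cdot>\<^sub>v (complex_of_real (1 / \<rho>) \<cdot>\<^sub>v (A *\<^sub>v v)) = (of_real \<rho> * z) \<cdot>\<^sub>v v"
      using v by (simp add: smult_smult_assoc)
    then have "A *\<^sub>v v = (of_real \<rho> * z) \<cdot>\<^sub>v v"
      using \<rho> by (simp add: smult_smult_assoc of_real_mult[symmetric] del: of_real_mult)
    then have "eigenvalue A (of_real \<rho> * z)"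
      using v A by (auto simp: eigenvalue_def eigenvector_def)
    then have "cmod (of_real \<rho> * z) \<in> norm ` spectrum A" by (simp add: spectrum_def)
    from spectral_radius_mem_max(2)[OF A _ this] False \<rho> have "\<rho> * cmod z \<le> spectral_radius A"
      by (simp add: norm_mult)
    then have "\<rho> * cmod z < \<rho> * 1" using \<rho> by linarith
    then show ?thesis using \<rho> mult_less_cancel_left_pos[of \<rho> "cmod z" 1] by linarith
  qed
  then have "spectral_radius B < 1"
    using spectral_radius_mem_max(1)[OF B] False by (auto simp: spectrum_def)
  moreover obtain as where "char_poly B = (\<Prod> a \<leftarrow> as. [:- a, 1:])"
    using char_poly_factorized[OF B] by blast
  then have "\<exists>n_as. jordan_nf B n_as" by (rule jordan_nf_exists[OF B])
  ultimately obtain K where K: "\<And>m. norm_bound (B ^\<^sub>m m) K"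
    using spectral_radius_jnf_norm_bound_less_1[OF B] by auto
  have pow: "B ^\<^sub>m m = complex_of_real (1 / \<rho> ^ m) \<cdot>\<^sub>m map_mat complex_of_real (D ^\<^sub>m m)" for m
  proof (induction m)
    case 0
    then show ?case using A B D by (auto intro!: eq_matI)
  next
    case (Suc m)
    have Dm: "D ^\<^sub>m m \<in> carrier_mat n n" using D by simp
    have "B ^\<^sub>m Suc m = (complex_of_real (1 / \<rho> ^ m) \<cdot>\<^sub>m map_mat complex_of_real (D ^\<^sub>m m)) * (complex_of_real (1 / \<rho>) \<cdot>\<^sub>m A)"
      unfolding pow_mat.simps Suc by (simp add: B_def)
    also have "\<dots> = complex_of_real (1 / \<rho> ^ m) \<cdot>\<^sub>m (complex_of_real (1 / \<rho>) \<cdot>\<^sub>m (map_mat complex_of_real (D ^\<^sub>m m) * A))"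
      using Dm A by (auto simp: mult_smult_assoc_mat[of _ n n _ n] mult_smult_distrib[of _ n n _ n] intro!: eq_matI)
    also have "map_mat complex_of_real (D ^\<^sub>m m) * A = map_mat complex_of_real (D ^\<^sub>m Suc m)"
      using of_real_hom.mat_hom_mult[OF Dm D, symmetric] by (simp add: A_def)
    finally show ?case by (auto intro!: eq_matI)
  qed
  have "\<bar>(D ^\<^sub>m m) $$ (i, j)\<bar> \<le> K * \<rho> ^ m" if "i < n" "j < n" for m i j
  proof -
    have Dm: "D ^\<^sub>m m \<in> carrier_mat n n" using D by simp
    have "cmod ((B ^\<^sub>m m) $$ (i, j)) \<le> K"
      using K[of m] B that by (auto simp: norm_bound_def)
    also have "cmod ((B ^\<^sub>m m) $$ (i, j)) = \<bar>(D ^\<^sub>m m) $$ (i, j)\<bar> / \<rho> ^ m"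
      using Dm that \<rho> D unfolding pow by (auto simp: norm_mult norm_divide norm_power)
    finally show ?thesis using \<rho> by (simp add: divide_simps)
  qed
  then show ?thesis using \<rho> by (intro exI[of _ \<rho>] exI[of _ K]) auto
qed

lemma order_linear_power:
  fixes a b :: "'a::idom" shows "Polynomial.order a ([:- b, 1:] ^ m) = (if a = b then m else 0)"
proof (cases "a = b")
  case True then show ?thesis by (simp add: order_power_n_n)
next
  case False
  then have "poly ([:- b, 1:] ^ m) a \<noteq> 0" by simp
  then show ?thesis using False by (simp add: order_0I)
qed

text \<open>Subtracting the three rank-one terms one after the other turns the roots \<open>1, lam, lam\<close> of the
  characteristic polynomial into roots \<open>0\<close> and keeps the others.\<close>

lemma deflated_eigenvalues:
  fixes S :: "real Matrix.mat" and x w :: "nat \<Rightarrow> nat \<Rightarrow> real"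
  assumes S: "S \<in> carrier_mat N N" and std: "standard_matrix S lam"
    and ev: "\<And>j t. j < 3 \<Longrightarrow> t < N \<Longrightarrow> (\<Sum>l<N. S $$ (t, l) * x j l) = (if j = 0 then 1 else lam) * x j t"
    and dual: "\<And>i j. i < 3 \<Longrightarrow> j < 3 \<Longrightarrow> (\<Sum>t<N. w i t * x j t) = (if i = j then 1 else 0)"
    and D: "D = Matrix.mat N N (\<lambda>(t, l). S $$ (t, l) - (\<Sum>j<3. x j t * (\<Sum>s<N. w j s * S $$ (s, l))))"
    and z: "eigenvalue (map_mat complex_of_real D) z"
  shows "cmod z < lam"
proof -
  define \<mu> where "\<mu> j = (if j = 0 then 1 else lam)" for j :: nat
  define X where "X j = Matrix.mat N 1 (\<lambda>(t, _). x j t)" for j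
  define U where "U j = Matrix.mat 1 N (\<lambda>(_, l). \<Sum>s<N. w j s * S $$ (s, l))" for j
  define A where "A m = Matrix.mat N N (\<lambda>(t, l). S $$ (t, l) - (\<Sum>j<m. x j t * (\<Sum>s<N. w j s * S $$ (s, l))))" for m
  have A: "A m \<in> carrier_mat N N" for m by (simp add: A_def)
  have wS: "(\<Sum>l<N. (\<Sum>s<N. w i s * S $$ (s, l)) * x j l) = (if i = j then \<mu> j else 0)" if "i < 3" "j < 3" for i j
  proof -
    have "(\<Sum>l<N. (\<Sum>s<N. w i s * S $$ (s, l)) * x j l) = (\<Sum>s<N. w i s * (\<Sum>l<N. S $$ (s, l) * x j l))"
      by (simp add: sum_distrib_left sum_distrib_right mult.assoc) (rule sum.swap)
    also have "\<dots> = (\<Sum>s<N. \<mu> j * (w i s * x j s))"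
      using ev that by (intro sum.cong) (auto simp: \<mu>_def)
    also have "\<dots> = \<mu> j * (\<Sum>s<N. w i s * x j s)" by (simp add: sum_distrib_left)
    finally show ?thesis using dual that by simp
  qed
  have cubic: "p3 * (a ^ 2 * b ^ 1) = p0 * q ^ 3"
    if "p3 * a = p2 * q" "p2 * a = p1 * q" "p1 * b = p0 * q" for p0 p1 p2 p3 a b q :: "real poly"
  proof -
    have "p3 * (a ^ 2 * b ^ 1) = (p3 * a) * a * b" by (simp add: power2_eq_square mult.assoc)
    also have "\<dots> = (p2 * a) * b * q" unfolding that(1) by (simp only: mult_ac)
    also have "\<dots> = (p1 * b) * q * q" unfolding that(2) by (simp only: mult_ac)
    also have "\<dots> = p0 * q ^ 3" unfolding that(3) by (simp add: power3_eq_cube mult.assoc)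
    finally show ?thesis .
  qed
  have step: "char_poly (A (Suc m)) * [:- \<mu> m, 1:] = char_poly (A m) * [:0, 1:]" if m: "m < 3" for m
  proof -
    have "A (Suc m) = A m - X m * U m"
      by (rule eq_matI) (auto simp: A_def X_def U_def scalar_prod_def)
    moreover have "char_poly (A m - X m * U m) * [:- \<mu> m, 1:] = char_poly (A m) * [:0, 1:]"
    proof (rule char_poly_deflation[OF A])
      \<comment> \<open>The terms subtracted so far involve the functionals of index below
        \<open>m\<close>, which vanish on \<open>x m\<close>; so \<open>x m\<close> is still an
        eigenvector for the original eigenvalue.\<close>
      show "A m * X m = \<mu> m \<cdot>\<^sub>m X m"
      proof (rule eq_matI)
        fix t c assume "t < dim_row (\<mu> m \<cdot>\<^sub>m X m)" "c < dim_col (\<mu> m \<cdot>\<^sub>m X m)"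
        then have t: "t < N" "c = 0" by (auto simp: X_def)
        have "(A m * X m) $$ (t, c) = (\<Sum>l<N. (S $$ (t, l) - (\<Sum>j<m. x j t * (\<Sum>s<N. w j s * S $$ (s, l)))) * x m l)"
          using t by (simp add: A_def X_def scalar_prod_def lessThan_atLeast0)
        also have "\<dots> = (\<Sum>l<N. S $$ (t, l) * x m l) - (\<Sum>l<N. \<Sum>j<m. x j t * ((\<Sum>s<N. w j s * S $$ (s, l)) * x m l))"
          by (simp add: left_diff_distrib sum_subtractf sum_distrib_right mult.assoc)
        also have "(\<Sum>l<N. \<Sum>j<m. x j t * ((\<Sum>s<N. w j s * S $$ (s, l)) * x m l)) =
           (\<Sum>j<m. x j t * (\<Sum>l<N. (\<Sum>s<N. w j s * S $$ (s, l)) * x m l))"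
          by (subst sum.swap) (simp add: sum_distrib_left)
        also have "\<dots> = 0" using wS m by (intro sum.neutral) auto
        finally show "(A m * X m) $$ (t, c) = (\<mu> m \<cdot>\<^sub>m X m) $$ (t, c)"
          using t ev[OF m, of t] by (simp add: X_def \<mu>_def)
      qed (auto simp: X_def A_def)
      show "(U m * X m) $$ (0, 0) = \<mu> m"
        using wS[OF m m] by (simp add: U_def X_def scalar_prod_def lessThan_atLeast0)
    qed (auto simp: X_def U_def)
    ultimately show ?thesis by simp
  qed
  have "char_poly (A 3) * [:- lam, 1:] = char_poly (A 2) * [:0, 1:]"
    "char_poly (A 2) * [:- lam, 1:] = char_poly (A 1) * [:0, 1:]"
    "char_poly (A 1) * [:- 1, 1:] = char_poly (A 0) * [:0, 1:]"
    using step[of 2] step[of 1] step[of 0] by (simp_all add: \<mu>_def eval_nat_numeral)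
  moreover have "A 0 = S" using S by (auto simp: A_def intro!: eq_matI)
  moreover have "A 3 = D" by (simp add: A_def D)
  ultimately have cp: "char_poly D * ([:- lam, 1:] ^ 2 * [:- 1, 1:] ^ 1) = char_poly S * [:- 0, 1:] ^ 3"
    using cubic[of "char_poly D" "[:- lam, 1:]" "char_poly (A 2)" "[:0, 1:]" "char_poly (A 1)" "[:- 1, 1:]" "char_poly S"]
    by simp
  have nz: "char_poly D \<noteq> 0" "char_poly S \<noteq> 0"
    using degree_monic_char_poly[OF S] degree_monic_char_poly[of D N] D by auto
  \<comment> \<open>Comparing multiplicities in the product identity: as 1 is a simple root and
    \<open>lam\<close> a double root for \<open>S\<close>, neither remains a root for
    \<open>D\<close>.\<close>
  have ord: "Polynomial.order a (char_poly D) + (if a = lam then 2 else 0) + (if a = 1 then 1 else 0) =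
     Polynomial.order a (char_poly S) + (if a = 0 then 3 else 0)" for a
  proof -
    have nz': "char_poly D * ([:- lam, 1:] ^ 2 * [:- 1, 1:] ^ 1) \<noteq> 0" "char_poly S * [:- 0, 1:] ^ 3 \<noteq> 0"
      "[:- lam, 1:] ^ 2 * [:- 1, 1:] ^ 1 \<noteq> 0"
      using nz by (simp_all only: mult_eq_0_iff power_eq_0_iff) auto
    show ?thesis
      using arg_cong[OF cp, of "Polynomial.order a"]
      unfolding order_mult[OF nz'(1)] order_mult[OF nz'(2)] order_mult[OF nz'(3)] order_linear_power
      by (simp only: add.assoc)
  qed
  have lam: "0 < lam" "lam < 1" "Polynomial.order 1 (char_poly S) = 1" "Polynomial.order lam (char_poly S) = 2"
    using std by (auto simp: standard_matrix_def)
  have "Polynomial.order 1 (char_poly D) = 0" "Polynomial.order lam (char_poly D) = 0"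
    using ord[of 1] ord[of lam] lam by auto
  then have nroot: "poly (char_poly D) 1 \<noteq> 0" "poly (char_poly D) lam \<noteq> 0"
    using nz by (simp_all add: order_root)
  have Dc: "D \<in> carrier_mat N N" by (simp add: D)
  have c: "map_mat complex_of_real S \<in> carrier_mat N N" "map_mat complex_of_real D \<in> carrier_mat N N" using S Dc by auto
  have root: "poly (map_poly complex_of_real (char_poly D)) z = 0"
    using z unfolding eigenvalue_root_char_poly[OF c(2)] of_real_hom.char_poly_hom[OF Dc] .
  have "z \<noteq> of_real a" if "poly (char_poly D) a \<noteq> 0" for a
    using root that by (auto simp: of_real_hom.poly_map_poly)
  then have z1: "z \<noteq> 1" "z \<noteq> of_real lam" using nroot by force+
  interpret map_poly_comm_ring_hom complex_of_real ..
  show ?thesis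
  proof (cases "z = 0")
    case False
    \<comment> \<open>A non-zero eigenvalue of \<open>D\<close> is one of \<open>S\<close>, since
      the factor introduced by the deflation vanishes only at 0. Being neither 1 nor
      \<open>lam\<close>, it has modulus below \<open>lam\<close>.\<close>
    have "poly (map_poly complex_of_real (char_poly D * ([:- lam, 1:] ^ 2 * [:- 1, 1:] ^ 1))) z = 0"
      using root by (simp only: hom_mult poly_mult mult_zero_left)
    then have "poly (map_poly complex_of_real (char_poly S)) z * z ^ 3 = 0"
      unfolding cp by (simp add: hom_mult hom_power)
    then have "eigenvalue (map_mat complex_of_real S) z"
      using False unfolding eigenvalue_root_char_poly[OF c(1)] of_real_hom.char_poly_hom[OF S] by simp
    then show ?thesis using z1 std by (auto simp: standard_matrix_def)
  qed (use lam in auto)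
qed

section \<open>Dominant coordinates and the complementary part\<close>

definition l1_norm :: "nat \<Rightarrow> (nat \<Rightarrow> real) \<Rightarrow> real" where
  "l1_norm N v = (\<Sum>t<N. \<bar>v t\<bar>)"

text \<open>Vectors are total functions of which only the entries below \<open>N\<close> count, so
  that they can be added, scaled and restarted without dimension side conditions.\<close>

definition mat_app :: "nat \<Rightarrow> real Matrix.mat \<Rightarrow> (nat \<Rightarrow> real) \<Rightarrow> nat \<Rightarrow> real" where
  "mat_app N S v t = (\<Sum>l<N. S $$ (t, l) * v l)"

definition dual_coef :: "nat \<Rightarrow> (nat \<Rightarrow> nat \<Rightarrow> real) \<Rightarrow> nat \<Rightarrow> (nat \<Rightarrow> real) \<Rightarrow> real" where
  "dual_coef N w i v = (\<Sum>t<N. w i t * v t)"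

text \<open>For a dual family this is the projection onto the common kernel of the functionals along
  the span of the three \<open>x j\<close>.\<close>

definition residual ::
    "nat \<Rightarrow> (nat \<Rightarrow> nat \<Rightarrow> real) \<Rightarrow> (nat \<Rightarrow> nat \<Rightarrow> real) \<Rightarrow> (nat \<Rightarrow> real) \<Rightarrow> nat \<Rightarrow> real" where
  "residual N x w v t = v t - (\<Sum>j<3. x j t * dual_coef N w j v)"

text \<open>The dominant part of \<open>S\<close> is spanned by \<open>x 0, x 1, x 2\<close>, with dual functionals \<open>w\<close>; the
  complementary part contracts by \<open>\<rho> < lam\<close> in the adapted norm \<open>nu\<close>.\<close>

locale spectral_splitting =
  fixes N :: nat and S :: "real Matrix.mat" and lam \<rho> :: real
    and x w :: "nat \<Rightarrow> nat \<Rightarrow> real" and nu :: "(nat \<Rightarrow> real) \<Rightarrow> real" and K :: real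
  assumes dual: "\<And>i j. i < 3 \<Longrightarrow> j < 3 \<Longrightarrow> dual_coef N w i (x j) = (if i = j then 1 else 0)"
    and eigen: "\<And>j t. j < 3 \<Longrightarrow> t < N \<Longrightarrow> mat_app N S (x j) t = (if j = 0 then 1 else lam) * x j t"
    and rho: "0 < \<rho>" "\<rho> < lam" "lam < 1"
    and x0: "x 0 = (\<lambda>_. 1)"
    and nu_add: "\<And>u v. nu (\<lambda>t. u t + v t) \<le> nu u + nu v"
    and nu_ge: "\<And>v. l1_norm N v \<le> nu v"
    and nu_le: "\<And>v. nu v \<le> K * l1_norm N v" and K: "0 \<le> K"
    and nu_contract: "\<And>v. nu (residual N x w (mat_app N S v)) \<le> \<rho> * nu v"

text \<open>Any family dual to the three eigenvectors will do. What matters is that their span is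
  invariant, so that \<open>S\<close> followed by the projection \<open>residual\<close> carries
  exactly the remaining spectrum, padded with zeros.\<close>

lemma spectral_splitting_exists:
  assumes S: "S \<in> carrier_mat N N" and std: "standard_matrix S lam" and tau: "\<tau> < lam"
    and y: "eigenvector S y0 lam" "eigenvector S y1 lam"
    and indep: "\<And>a b :: real. a \<cdot>\<^sub>v y0 + b \<cdot>\<^sub>v y1 = 0\<^sub>v N \<Longrightarrow> a = 0 \<and> b = 0"
  shows "\<exists>\<rho> x w nu K. \<tau> < \<rho> \<and> x 1 = vec_index y0 \<and> x 2 = vec_index y1 \<and> spectral_splitting N S lam \<rho> x w nu K"
proof -
  define \<mu> where "\<mu> j = (if j = 0 then 1 else lam)" for j :: nat
  define x where "x = (\<lambda>j :: nat. if j = 0 then (\<lambda>_. 1) else if j = 1 then vec_index y0 else vec_index y1)"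
  have lam: "0 < lam" "lam < 1" using std by (auto simp: standard_matrix_def)
  have app: "mat_app N S (vec_index v) t = c * vec_index v t" if "eigenvector S v c" "t < N" for v c t
  proof -
    have "v \<in> carrier_vec N" "S *\<^sub>v v = c \<cdot>\<^sub>v v" using that S by (auto simp: eigenvector_def)
    then have "vec_index (S *\<^sub>v v) t = c * vec_index v t" using that by simp
    then show ?thesis using that S \<open>v \<in> carrier_vec N\<close>
      by (simp add: mat_app_def scalar_prod_def lessThan_atLeast0)
  qed
  have one: "mat_app N S (\<lambda>_. 1) t = 1" if "t < N" for t
  proof -
    have "eigenvector S (Matrix.vec N (\<lambda>_. 1)) 1" using std S by (auto simp: standard_matrix_def)
    from app[OF this that] show ?thesis using that by (simp add: mat_app_def)
  qed
  have ev: "mat_app N S (x j) t = \<mu> j * x j t" if "j < 3" "t < N" for j t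
    using that app[OF y(1)] app[OF y(2)] one by (auto simp: x_def \<mu>_def)
  have "\<exists>w. \<forall>i<3. \<forall>j<3. (\<Sum>t<N. w i t * x j t) = (if i = j then 1 else 0)"
  proof (rule dual_family)
    fix c :: "nat \<Rightarrow> real" assume c: "\<And>t. t < N \<Longrightarrow> (\<Sum>i<3. c i * x i t) = 0"
    have c3: "c 0 + c 1 * vec_index y0 t + c 2 * vec_index y1 t = 0" if "t < N" for t
      using c[OF that] by (simp add: x_def numeral_3_eq_3 numeral_2_eq_2)
    have dims: "y0 \<in> carrier_vec N" "y1 \<in> carrier_vec N" using y S by (auto simp: eigenvector_def)
    have "N > 0" using y(1) S by (auto simp: eigenvector_def)
    \<comment> \<open>Row 0 of \<open>S\<close> applied to the relation gives
      \<open>c 0 + lam * (- c 0) = 0\<close>: the eigenvalue 1 separates from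
      \<open>lam\<close>.\<close>
    have "(1 - lam) * c 0 = 0"
    proof -
      have "0 = (\<Sum>l<N. S $$ (0, l) * (c 0 + c 1 * vec_index y0 l + c 2 * vec_index y1 l))"
        using c3 by simp
      also have "\<dots> = c 0 * mat_app N S (\<lambda>_. 1) 0 + c 1 * mat_app N S (vec_index y0) 0 + c 2 * mat_app N S (vec_index y1) 0"
        by (simp add: mat_app_def sum_distrib_left distrib_left sum.distrib mult_ac)
      also have "\<dots> = c 0 + lam * (c 1 * vec_index y0 0 + c 2 * vec_index y1 0)"
        using app[OF y(1)] app[OF y(2)] one \<open>N > 0\<close> by (simp add: algebra_simps)
      also have "c 1 * vec_index y0 0 + c 2 * vec_index y1 0 = - c 0"
        using c3[OF \<open>N > 0\<close>] by simp
      finally show ?thesis by (simp add: algebra_simps)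
    qed
    then have c0: "c 0 = 0" using lam by simp
    have "c 1 \<cdot>\<^sub>v y0 + c 2 \<cdot>\<^sub>v y1 = 0\<^sub>v N"
      using dims c3 c0 by (intro eq_vecI) auto
    then have "c 1 = 0" "c 2 = 0" using indep by blast+
    then show "\<forall>i<3. c i = 0" using c0 by (auto simp: eval_nat_numeral less_Suc_eq)
  qed
  then obtain w where w: "\<And>i j. i < 3 \<Longrightarrow> j < 3 \<Longrightarrow> (\<Sum>t<N. w i t * x j t) = (if i = j then 1 else 0)" by blast
  define D where "D = Matrix.mat N N (\<lambda>(t, l). S $$ (t, l) - (\<Sum>j<3. x j t * (\<Sum>s<N. w j s * S $$ (s, l))))"
  have D: "D \<in> carrier_mat N N" by (simp add: D_def)
  have "cmod z < lam" if "eigenvalue (map_mat complex_of_real D) z" for z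
    by (rule deflated_eigenvalues[OF S std _ w D_def that]) (use ev in \<open>auto simp: mat_app_def \<mu>_def\<close>)
  then obtain \<rho> K0 where rho: "0 < \<rho>" "\<tau> < \<rho>" "\<rho> < lam"
    and K0: "\<And>m i j. i < N \<Longrightarrow> j < N \<Longrightarrow> \<bar>(D ^\<^sub>m m) $$ (i, j)\<bar> \<le> K0 * \<rho> ^ m"
    using matrix_power_bound[OF D lam(1) tau] by blast
  define p where "p m v = (\<Sum>i<N. \<bar>\<Sum>j<N. (D ^\<^sub>m m) $$ (i, j) * v j\<bar>) / \<rho> ^ m" for m and v :: "nat \<Rightarrow> real"
  \<comment> \<open>The adapted norm: replacing \<open>v\<close> by \<open>D\<close> applied to
    \<open>v\<close> shifts the supremum by one power and gains the factor \<open>\<rho>\<close>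
    with no constant, while the term \<open>m = 0\<close> dominates the l1 norm.\<close>
  define nu where "nu v = (SUP m. p m v)" for v
  define K where "K = real N * \<bar>K0\<bar>"
  have p_le: "p m v \<le> K * l1_norm N v" for m v
  proof -
    have "\<bar>\<Sum>j<N. (D ^\<^sub>m m) $$ (i, j) * v j\<bar> \<le> \<bar>K0\<bar> * \<rho> ^ m * l1_norm N v" if "i < N" for i
    proof -
      have "\<bar>\<Sum>j<N. (D ^\<^sub>m m) $$ (i, j) * v j\<bar> \<le> (\<Sum>j<N. \<bar>(D ^\<^sub>m m) $$ (i, j)\<bar> * \<bar>v j\<bar>)"
        by (rule order_trans[OF sum_abs]) (simp add: abs_mult)
      also have "\<dots> \<le> (\<Sum>j<N. (\<bar>K0\<bar> * \<rho> ^ m) * \<bar>v j\<bar>)"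
      proof (intro sum_mono mult_right_mono)
        fix j assume "j \<in> {..<N}"
        then have "\<bar>(D ^\<^sub>m m) $$ (i, j)\<bar> \<le> K0 * \<rho> ^ m" using K0 that by simp
        also have "\<dots> \<le> \<bar>K0\<bar> * \<rho> ^ m" using rho by (intro mult_right_mono) auto
        finally show "\<bar>(D ^\<^sub>m m) $$ (i, j)\<bar> \<le> \<bar>K0\<bar> * \<rho> ^ m" .
      qed auto
      finally show ?thesis by (simp add: l1_norm_def sum_distrib_left)
    qed
    then have "(\<Sum>i<N. \<bar>\<Sum>j<N. (D ^\<^sub>m m) $$ (i, j) * v j\<bar>) \<le> (\<Sum>i<N. \<bar>K0\<bar> * \<rho> ^ m * l1_norm N v)"
      by (intro sum_mono) auto
    then show ?thesis using rho by (simp add: p_def K_def field_simps)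
  qed
  have bdd: "bdd_above (range (\<lambda>m. p m v))" for v
    using p_le by (intro bdd_aboveI[of _ "K * l1_norm N v"]) auto
  have p_nu: "p m v \<le> nu v" for m v
    unfolding nu_def by (rule cSUP_upper[OF _ bdd]) simp
  have "spectral_splitting N S lam \<rho> x w nu K"
  proof
    show "dual_coef N w i (x j) = (if i = j then 1 else 0)" if "i < 3" "j < 3" for i j
      using w that by (simp add: dual_coef_def)
    show "mat_app N S (x j) t = (if j = 0 then 1 else lam) * x j t" if "j < 3" "t < N" for j t
      using ev that by (simp add: \<mu>_def)
    show "0 < \<rho>" "\<rho> < lam" "lam < 1" "x 0 = (\<lambda>_. 1)" "0 \<le> K" using rho lam by (auto simp: x_def K_def)
    show "nu (\<lambda>t. u t + v t) \<le> nu u + nu v" for u v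
    proof -
      have "p m (\<lambda>t. u t + v t) \<le> p m u + p m v" for m
      proof -
        have "(\<Sum>i<N. \<bar>\<Sum>j<N. (D ^\<^sub>m m) $$ (i, j) * (u j + v j)\<bar>) \<le>
          (\<Sum>i<N. \<bar>\<Sum>j<N. (D ^\<^sub>m m) $$ (i, j) * u j\<bar>) + (\<Sum>i<N. \<bar>\<Sum>j<N. (D ^\<^sub>m m) $$ (i, j) * v j\<bar>)"
          unfolding sum.distrib[symmetric] by (rule sum_mono) (simp add: ring_distribs sum.distrib)
        then show ?thesis using rho unfolding p_def add_divide_distrib[symmetric]
          by (intro divide_right_mono) auto
      qed
      then have "p m (\<lambda>t. u t + v t) \<le> nu u + nu v" for m
        using p_nu[of m u] p_nu[of m v] by (meson add_mono order_trans)
      then show ?thesis unfolding nu_def[of "\<lambda>t. u t + v t"] by (intro cSUP_least) auto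
    qed
    show "l1_norm N v \<le> nu v" for v
    proof -
      have "p 0 v = l1_norm N v"
      proof -
        have "(\<Sum>j<N. (D ^\<^sub>m 0) $$ (i, j) * v j) = v i" if "i < N" for i
        proof -
          have "(\<Sum>j<N. (D ^\<^sub>m 0) $$ (i, j) * v j) = (\<Sum>j<N. if i = j then v j else 0)"
            using that D by (intro sum.cong) auto
          then show ?thesis using that by simp
        qed
        then show ?thesis by (simp add: p_def l1_norm_def)
      qed
      then show ?thesis using p_nu[of 0 v] by simp
    qed
    show "nu v \<le> K * l1_norm N v" for v
      unfolding nu_def using p_le by (intro cSUP_least) auto
    show "nu (residual N x w (mat_app N S v)) \<le> \<rho> * nu v" for v
    proof -
      have "p m (residual N x w (mat_app N S v)) \<le> \<rho> * nu v" for m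
      proof -
        have Dv: "residual N x w (mat_app N S v) l = (\<Sum>j<N. D $$ (l, j) * v j)" if "l < N" for l
        proof -
          have "(\<Sum>j<3. x j l * (\<Sum>s<N. w j s * (\<Sum>i<N. S $$ (s, i) * v i))) =
             (\<Sum>i<N. (\<Sum>j<3. x j l * (\<Sum>s<N. w j s * S $$ (s, i))) * v i)"
          proof -
            have "(\<Sum>s<N. w j s * (\<Sum>i<N. S $$ (s, i) * v i)) = (\<Sum>i<N. (\<Sum>s<N. w j s * S $$ (s, i)) * v i)" for j
              by (simp add: sum_distrib_left sum_distrib_right mult.assoc) (rule sum.swap)
            then show ?thesis
              by (simp add: sum_distrib_left sum_distrib_right mult.assoc) (rule sum.swap)
          qed
          then show ?thesis using that
            by (simp add: residual_def dual_coef_def mat_app_def D_def left_diff_distrib sum_subtractf)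
        qed
        have "(\<Sum>l<N. (D ^\<^sub>m m) $$ (i, l) * residual N x w (mat_app N S v) l) = (\<Sum>j<N. (D ^\<^sub>m Suc m) $$ (i, j) * v j)"
          if "i < N" for i
        proof -
          have "D ^\<^sub>m m \<in> carrier_mat N N" using D by simp
          then have "(D ^\<^sub>m Suc m) $$ (i, j) = (\<Sum>l<N. (D ^\<^sub>m m) $$ (i, l) * D $$ (l, j))" if "j < N" for j
            using D \<open>i < N\<close> that by (simp add: scalar_prod_def lessThan_atLeast0)
          then have "(\<Sum>j<N. (D ^\<^sub>m Suc m) $$ (i, j) * v j) = (\<Sum>j<N. (\<Sum>l<N. (D ^\<^sub>m m) $$ (i, l) * D $$ (l, j)) * v j)"
            by (intro sum.cong) auto
          also have "\<dots> = (\<Sum>l<N. (D ^\<^sub>m m) $$ (i, l) * (\<Sum>j<N. D $$ (l, j) * v j))"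
            by (simp add: sum_distrib_left sum_distrib_right mult.assoc) (rule sum.swap)
          also have "\<dots> = (\<Sum>l<N. (D ^\<^sub>m m) $$ (i, l) * residual N x w (mat_app N S v) l)"
            using Dv by (intro sum.cong) auto
          finally show ?thesis by simp
        qed
        then have "p m (residual N x w (mat_app N S v)) = \<rho> * p (Suc m) v"
          using rho by (simp add: p_def field_simps del: pow_mat.simps)
        then show ?thesis using p_nu[of "Suc m" v] rho by simp
      qed
      then show ?thesis unfolding nu_def[of "residual N x w (mat_app N S v)"] by (intro cSUP_least) auto
    qed
  qed
  then show ?thesis using rho by (intro exI[of _ \<rho>] exI[of _ x] exI[of _ w] exI[of _ nu] exI[of _ K]) (auto simp: x_def)
qed

text \<open>A scalar model of the perturbed recursion: \<open>c i\<close> are the dominant coordinates, \<open>r\<close> is the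
  adapted norm of the complementary part and \<open>v\<close> the norm of the full vector.\<close>

lemma perturbed_recursion_bounds:
  fixes \<rho> lam H B :: real
  assumes rho: "0 < \<rho>" "\<rho> < lam" "lam < 1" and HB: "0 \<le> H" "0 \<le> B"
  obtains \<theta> G where "0 < \<theta>" "\<theta> < lam" "0 \<le> G"
    "\<And>k0 (c :: nat \<Rightarrow> nat \<Rightarrow> real) (h :: nat \<Rightarrow> nat \<Rightarrow> real) r v V.
      (\<And>m. 0 \<le> r m) \<Longrightarrow> (\<And>m. 0 \<le> v m) \<Longrightarrow>
      (\<And>m. v m \<le> B * (\<bar>c 0 m\<bar> + \<bar>c 1 m\<bar> + \<bar>c 2 m\<bar> + r m)) \<Longrightarrow>
      (\<And>i m. i < 3 \<Longrightarrow> c i (Suc m) = (if i = 0 then 1 else lam) * c i m + h i m) \<Longrightarrow>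
      (\<And>i m. i < 3 \<Longrightarrow> \<bar>h i m\<bar> \<le> H * (r m + \<rho> ^ (k0 + m) * v m)) \<Longrightarrow>
      (\<And>m. r (Suc m) \<le> \<rho> * r m + H * \<rho> ^ (k0 + m) * v m) \<Longrightarrow>
      V = \<bar>c 0 0\<bar> + \<bar>c 1 0\<bar> + \<bar>c 2 0\<bar> + r 0 \<Longrightarrow>
      (\<forall>m. r m \<le> G * \<theta> ^ m * (r 0 + \<theta> ^ k0 * V)) \<and>
      (\<forall>i<3. \<forall>m. \<bar>h i m\<bar> \<le> G * \<theta> ^ m * (r 0 + \<theta> ^ k0 * V))"
proof -
  \<comment> \<open>A rate strictly between the two: slightly worse than \<open>\<rho>\<close>, so
    that a forcing term of order \<open>\<rho> ^ m\<close> causes no resonance, and still better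
    than \<open>lam\<close>.\<close>
  define \<theta> where "\<theta> = (\<rho> + lam) / 2"
  have th: "0 < \<theta>" "\<rho> < \<theta>" "\<theta> < lam" using rho by (auto simp: \<theta>_def)
  \<comment> \<open>Each step feeds at most \<open>3 * H * r m\<close> into the three coordinates.
    With weight \<open>\<kappa>\<close> on \<open>r\<close>, the contraction by
    \<open>\<rho>\<close> pays for this, and the weighted sum \<open>W\<close> below grows only by
    the summable amounts \<open>g * \<rho> ^ m\<close>.\<close>
  define \<kappa> where "\<kappa> = 1 + 3 * H / (1 - \<rho>)"
  have kap: "1 \<le> \<kappa>" "3 * H + \<kappa> * \<rho> \<le> \<kappa>"
  proof -
    have "0 < 1 - \<rho>" using rho by simp
    then show "1 \<le> \<kappa>" using HB by (simp add: \<kappa>_def)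
    have "\<kappa> * (1 - \<rho>) = (1 - \<rho>) + 3 * H" using \<open>0 < 1 - \<rho>\<close> by (simp add: \<kappa>_def distrib_right)
    then show "3 * H + \<kappa> * \<rho> \<le> \<kappa>" using \<open>0 < 1 - \<rho>\<close> by (simp add: algebra_simps)
  qed
  define g where "g = (3 + \<kappa>) * H * B"
  have g: "0 \<le> g" using kap HB by (simp add: g_def)
  \<comment> \<open>Bounds \<open>v\<close> in terms of the initial size \<open>V\<close>: the
    exponent is \<open>g\<close> times the full geometric series of \<open>\<rho>\<close>.\<close>
  define B2 where "B2 = B * \<kappa> * exp (g / (1 - \<rho>))"
  have B2: "0 \<le> B2" using HB kap by (simp add: B2_def)
  \<comment> \<open>Chosen so that \<open>\<rho> * A + H * B2 = \<theta> * A\<close>, which makes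
    the bound \<open>rm\<close> reproduce itself in the induction.\<close>
  define A where "A = H * B2 / (\<theta> - \<rho>)"
  have A: "0 \<le> A" using HB B2 th by (simp add: A_def)
  define G where "G = 1 + A + H * (1 + A + B2)"
  have G: "1 + A \<le> G" "H * (1 + A + B2) \<le> G" "0 \<le> G" using A HB B2 by (auto simp: G_def)
  \<comment> \<open>All constants are fixed by now, before \<open>k0\<close> and the sequences
    enter; a later start then profits from the small factor \<open>\<theta> ^ k0\<close>.\<close>
  have "(\<forall>m. r m \<le> G * \<theta> ^ m * (r 0 + \<theta> ^ k0 * V)) \<and>
      (\<forall>i<3. \<forall>m. \<bar>h i m\<bar> \<le> G * \<theta> ^ m * (r 0 + \<theta> ^ k0 * V))"
    if nn: "\<And>m. 0 \<le> r m" "\<And>m. 0 \<le> v m"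
      and v: "\<And>m. v m \<le> B * (\<bar>c 0 m\<bar> + \<bar>c 1 m\<bar> + \<bar>c 2 m\<bar> + r m)"
      and c: "\<And>i m. i < 3 \<Longrightarrow> c i (Suc m) = (if i = 0 then 1 else lam) * c i m + h i m"
      and h: "\<And>i m. i < 3 \<Longrightarrow> \<bar>h i m\<bar> \<le> H * (r m + \<rho> ^ (k0 + m) * v m)"
      and r: "\<And>m. r (Suc m) \<le> \<rho> * r m + H * \<rho> ^ (k0 + m) * v m"
      and V: "V = \<bar>c 0 0\<bar> + \<bar>c 1 0\<bar> + \<bar>c 2 0\<bar> + r 0"
    for k0 and c h :: "nat \<Rightarrow> nat \<Rightarrow> real" and r v V
  proof -
    define W where "W m = \<bar>c 0 m\<bar> + \<bar>c 1 m\<bar> + \<bar>c 2 m\<bar> + \<kappa> * r m" for m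
    have W0: "0 \<le> W m" for m using nn kap by (simp add: W_def)
    have vW: "v m \<le> B * W m" for m
    proof -
      have "r m \<le> \<kappa> * r m" using kap(1) nn(1)[of m] mult_right_mono by fastforce
      then have "B * (\<bar>c 0 m\<bar> + \<bar>c 1 m\<bar> + \<bar>c 2 m\<bar> + r m) \<le> B * W m"
        using HB by (intro mult_left_mono) (auto simp: W_def)
      then show ?thesis using v[of m] by simp
    qed
    have cc: "\<bar>c i (Suc m)\<bar> \<le> \<bar>c i m\<bar> + H * r m + H * (\<rho> ^ (k0 + m) * v m)" if "i < 3" for i m
    proof -
      have "\<bar>(if i = 0 then 1 else lam) * c i m\<bar> \<le> 1 * \<bar>c i m\<bar>"
        unfolding abs_mult using rho by (intro mult_right_mono) auto
      then show ?thesis using c[OF that, of m] h[OF that, of m] by (simp add: distrib_left)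
    qed
    have Wstep: "W (Suc m) \<le> W m * (1 + g * \<rho> ^ m)" for m
    proof -
      define q where "q = \<rho> ^ (k0 + m) * v m"
      have "W (Suc m) \<le> \<bar>c 0 m\<bar> + \<bar>c 1 m\<bar> + \<bar>c 2 m\<bar> + 3 * (H * r m + H * q) + \<kappa> * (\<rho> * r m + H * q)"
      proof -
        have "\<kappa> * r (Suc m) \<le> \<kappa> * (\<rho> * r m + H * q)"
          using r[of m] kap by (intro mult_left_mono) (auto simp: q_def mult.assoc)
        then show ?thesis using cc[of 0 m] cc[of 1 m] cc[of 2 m] by (simp add: W_def q_def[symmetric])
      qed
      also have "\<dots> = \<bar>c 0 m\<bar> + \<bar>c 1 m\<bar> + \<bar>c 2 m\<bar> + (3 * H + \<kappa> * \<rho>) * r m + (3 + \<kappa>) * H * q"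
        by (simp add: algebra_simps)
      also have "(3 * H + \<kappa> * \<rho>) * r m \<le> \<kappa> * r m" using kap nn by (intro mult_right_mono) auto
      also have "q \<le> \<rho> ^ m * (B * W m)"
      proof -
        have "\<rho> ^ (k0 + m) \<le> \<rho> ^ m" using rho by (intro power_decreasing) auto
        then show ?thesis unfolding q_def using vW nn(2) rho by (intro mult_mono) auto
      qed
      then have "(3 + \<kappa>) * H * q \<le> (3 + \<kappa>) * H * (\<rho> ^ m * (B * W m))"
        using kap HB by (intro mult_left_mono) auto
      finally show ?thesis by (simp add: W_def g_def algebra_simps)
    qed
    have "W m \<le> W 0 * exp (g * (\<Sum>i<m. \<rho> ^ i))" for m
    proof (induction m)
      case (Suc m)
      have "W (Suc m) \<le> W m * (1 + g * \<rho> ^ m)" by (rule Wstep)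
      also have "\<dots> \<le> (W 0 * exp (g * (\<Sum>i<m. \<rho> ^ i))) * exp (g * \<rho> ^ m)"
        using Suc W0 g rho by (intro mult_mono) (auto intro!: exp_ge_add_one_self)
      also have "\<dots> = W 0 * exp (g * (\<Sum>i<Suc m. \<rho> ^ i))"
        by (simp add: exp_add[symmetric] distrib_left)
      finally show ?case .
    qed simp
    also have "W 0 * exp (g * (\<Sum>i<m. \<rho> ^ i)) \<le> \<kappa> * V * exp (g / (1 - \<rho>))" for m
    proof (intro mult_mono)
      show "W 0 \<le> \<kappa> * V"
      proof -
        have "1 * (\<bar>c 0 0\<bar> + \<bar>c 1 0\<bar> + \<bar>c 2 0\<bar>) \<le> \<kappa> * (\<bar>c 0 0\<bar> + \<bar>c 1 0\<bar> + \<bar>c 2 0\<bar>)"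
          using kap by (intro mult_right_mono) auto
        then show ?thesis by (simp add: W_def V distrib_left)
      qed
      have "(\<Sum>i<m. \<rho> ^ i) = (1 - \<rho> ^ m) / (1 - \<rho>)" using rho by (simp add: sum_gp_strict)
      also have "\<dots> \<le> 1 / (1 - \<rho>)" using rho by (intro divide_right_mono) auto
      finally have "g * (\<Sum>i<m. \<rho> ^ i) \<le> g * (1 / (1 - \<rho>))" using g by (rule mult_left_mono)
      then show "exp (g * (\<Sum>i<m. \<rho> ^ i)) \<le> exp (g / (1 - \<rho>))" by simp
      show "0 \<le> \<kappa> * V" using kap nn by (simp add: V)
    qed auto
    finally have WV: "W m \<le> \<kappa> * V * exp (g / (1 - \<rho>))" for m .
    have vV: "v m \<le> B2 * V" for m
    proof -
      have "v m \<le> B * (\<kappa> * V * exp (g / (1 - \<rho>)))"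
        using vW[of m] mult_left_mono[OF WV[of m] HB(2)] by linarith
      then show ?thesis by (simp add: B2_def mult_ac)
    qed
    have V0: "0 \<le> V" using nn by (simp add: V)
    have pv: "\<rho> ^ (k0 + m) * v m \<le> \<theta> ^ (k0 + m) * (B2 * V)" for m
      using vV nn rho th by (intro mult_mono power_mono) auto
    have rm: "r m \<le> \<theta> ^ m * r 0 + A * \<theta> ^ (k0 + m) * V" for m
    proof (induction m)
      case 0
      then show ?case using A V0 th by simp
    next
      case (Suc m)
      have "r (Suc m) \<le> \<rho> * (\<theta> ^ m * r 0 + A * \<theta> ^ (k0 + m) * V) + H * (\<theta> ^ (k0 + m) * (B2 * V))"
      proof -
        have "\<rho> * r m \<le> \<rho> * (\<theta> ^ m * r 0 + A * \<theta> ^ (k0 + m) * V)"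
          using Suc rho by (intro mult_left_mono) auto
        moreover have "H * (\<rho> ^ (k0 + m) * v m) \<le> H * (\<theta> ^ (k0 + m) * (B2 * V))"
          using pv HB by (intro mult_left_mono)
        ultimately show ?thesis using r[of m] by (simp add: mult.assoc)
      qed
      also have "\<rho> * (\<theta> ^ m * r 0 + A * \<theta> ^ (k0 + m) * V) + H * (\<theta> ^ (k0 + m) * (B2 * V)) =
          \<rho> * (\<theta> ^ m * r 0) + (\<rho> * A + H * B2) * (\<theta> ^ (k0 + m) * V)"
        by (simp add: algebra_simps)
      also have "\<rho> * A + H * B2 = \<theta> * A" using th by (simp add: A_def field_simps)
      also have "\<rho> * (\<theta> ^ m * r 0) \<le> \<theta> * (\<theta> ^ m * r 0)"
        using th nn by (intro mult_right_mono) auto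
      finally show ?case by (simp add: mult_ac)
    qed
    have G': "a * \<theta> ^ m * (r 0 + \<theta> ^ k0 * V) \<le> G * \<theta> ^ m * (r 0 + \<theta> ^ k0 * V)" if "a \<le> G" for a m
      using that th nn V0 by (intro mult_right_mono) auto
    have rm': "r m \<le> (1 + A) * \<theta> ^ m * (r 0 + \<theta> ^ k0 * V)" for m
    proof -
      have "0 \<le> A * (\<theta> ^ m * r 0)" "0 \<le> \<theta> ^ (k0 + m) * V" using A th nn V0 by auto
      then show ?thesis using rm[of m] by (simp add: algebra_simps power_add)
    qed
    have "\<bar>h i m\<bar> \<le> G * \<theta> ^ m * (r 0 + \<theta> ^ k0 * V)" if "i < 3" for i m
    proof -
      have "\<theta> ^ (k0 + m) * (B2 * V) \<le> B2 * \<theta> ^ m * (r 0 + \<theta> ^ k0 * V)"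
      proof -
        have "0 \<le> B2 * (\<theta> ^ m * r 0)" using B2 th nn by auto
        then show ?thesis by (simp add: algebra_simps power_add)
      qed
      then have "r m + \<rho> ^ (k0 + m) * v m \<le> (1 + A + B2) * \<theta> ^ m * (r 0 + \<theta> ^ k0 * V)"
        using rm'[of m] pv[of m] by (simp add: distrib_right)
      then have "H * (r m + \<rho> ^ (k0 + m) * v m) \<le> H * ((1 + A + B2) * \<theta> ^ m * (r 0 + \<theta> ^ k0 * V))"
        using HB by (intro mult_left_mono)
      also have "\<dots> = (H * (1 + A + B2)) * \<theta> ^ m * (r 0 + \<theta> ^ k0 * V)" by (simp only: mult.assoc)
      finally show ?thesis using h[OF that, of m] G'[OF G(2), of m] by linarith
    qed
    moreover have "r m \<le> G * \<theta> ^ m * (r 0 + \<theta> ^ k0 * V)" for m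
      using rm'[of m] G'[OF G(1), of m] by linarith
    ultimately show ?thesis by blast
  qed
  from that[OF th(1,3) G(3) this] show ?thesis .
qed

section \<open>Asymptotics of trajectories of the perturbed matrices\<close>

primrec trajectory :: "nat \<Rightarrow> (nat \<Rightarrow> real Matrix.mat) \<Rightarrow> nat \<Rightarrow> (nat \<Rightarrow> real) \<Rightarrow> nat \<Rightarrow> (nat \<Rightarrow> real)" where
  "trajectory N T k0 v 0 = v"
| "trajectory N T k0 v (Suc m) = mat_app N (T (k0 + m)) (trajectory N T k0 v m)"

text \<open>Division by \<open>\<mu> ^ m\<close> makes the recursion telescope into a series that
  converges because \<open>\<theta> < \<mu>\<close>. It is applied with \<open>\<mu> = 1\<close> to
  the constant direction and with \<open>\<mu> = lam\<close> to the subdominant ones.\<close>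

lemma geometric_recursion_limit:
  fixes c h :: "nat \<Rightarrow> real"
  assumes c: "\<And>m. c (Suc m) = \<mu> * c m + h m" and h: "\<And>m. \<bar>h m\<bar> \<le> g * \<theta> ^ m"
    and th: "0 < \<theta>" "\<theta> < \<mu>"
  obtains a where "(\<lambda>m. c m / \<mu> ^ m) \<longlonglongrightarrow> a" "\<bar>a - c 0\<bar> \<le> g / (\<mu> - \<theta>)"
proof -
  define d where "d m = h m / \<mu> ^ Suc m" for m
  have d: "\<bar>d m\<bar> \<le> g / \<mu> * (\<theta> / \<mu>) ^ m" for m
    using h[of m] th by (simp add: d_def abs_mult power_divide field_simps)
  have gs: "(\<lambda>m. g / \<mu> * (\<theta> / \<mu>) ^ m) sums (g / \<mu> * (1 / (1 - \<theta> / \<mu>)))"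
    using th by (intro sums_mult geometric_sums) auto
  then have summ: "summable (\<lambda>m. g / \<mu> * (\<theta> / \<mu>) ^ m)" by (rule sums_summable)
  have dabs: "summable (\<lambda>m. \<bar>d m\<bar>)" by (rule summable_comparison_test'[OF summ, of 0]) (use d in auto)
  then have ds: "summable d" by (rule summable_rabs_cancel)
  have "c m / \<mu> ^ m = c 0 + (\<Sum>i<m. d i)" for m
  proof (induction m)
    case (Suc m)
    have "c (Suc m) / \<mu> ^ Suc m = c m / \<mu> ^ m + d m" using th by (simp add: c d_def add_divide_distrib)
    then show ?case using Suc by simp
  qed simp
  then have "(\<lambda>m. c m / \<mu> ^ m) \<longlonglongrightarrow> c 0 + suminf d"
    using tendsto_add[OF tendsto_const summable_LIMSEQ[OF ds], of "c 0"] by simp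
  moreover have "\<bar>suminf d\<bar> \<le> g / (\<mu> - \<theta>)"
  proof -
    have "\<bar>suminf d\<bar> \<le> suminf (\<lambda>m. \<bar>d m\<bar>)" by (rule summable_rabs[OF dabs])
    also have "\<dots> \<le> suminf (\<lambda>m. g / \<mu> * (\<theta> / \<mu>) ^ m)" by (rule suminf_le[OF d dabs summ])
    also have "\<dots> = g / \<mu> * (1 / (1 - \<theta> / \<mu>))" by (rule sums_unique[OF gs, symmetric])
    also have "\<dots> = g / (\<mu> - \<theta>)"
    proof -
      have "1 - \<theta> / \<mu> = (\<mu> - \<theta>) / \<mu>" using th by (simp add: diff_divide_distrib)
      then show ?thesis using th by simp
    qed
    finally show ?thesis .
  qed
  ultimately show ?thesis using that[of "c 0 + suminf d"] by simp
qed

lemma dual_coef_add: "dual_coef N w i (\<lambda>t. u t + v t) = dual_coef N w i u + dual_coef N w i v"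
  by (simp add: dual_coef_def distrib_left sum.distrib)

lemma dual_coef_sum:
  "dual_coef N w i (\<lambda>t. \<Sum>j\<in>J. b j * u j t) = (\<Sum>j\<in>J. b j * dual_coef N w i (u j))"
  unfolding dual_coef_def by (simp add: sum_distrib_left mult.left_commute) (rule sum.swap)

lemma mat_app_add: "mat_app N A (\<lambda>t. u t + v t) s = mat_app N A u s + mat_app N A v s"
  by (simp add: mat_app_def distrib_left sum.distrib)

lemma mat_app_sum:
  "mat_app N A (\<lambda>t. \<Sum>j\<in>J. b j * u j t) s = (\<Sum>j\<in>J. b j * mat_app N A (u j) s)"
  unfolding mat_app_def by (simp add: sum_distrib_left mult.left_commute) (rule sum.swap)

lemma dual_coef_cong: "(\<And>t. t < N \<Longrightarrow> u t = v t) \<Longrightarrow> dual_coef N w i u = dual_coef N w i v"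
  by (simp add: dual_coef_def)

lemma mat_app_cong: "(\<And>t. t < N \<Longrightarrow> u t = v t) \<Longrightarrow> mat_app N A u = mat_app N A v"
  by (auto simp: mat_app_def)

lemma l1_norm_nonneg: "0 \<le> l1_norm N v"
  by (simp add: l1_norm_def sum_nonneg)

lemma abs_le_l1_norm: "t < N \<Longrightarrow> \<bar>v t\<bar> \<le> l1_norm N v"
  unfolding l1_norm_def by (rule member_le_sum) auto

lemma l1_norm_add: "l1_norm N (\<lambda>t. u t + v t) \<le> l1_norm N u + l1_norm N v"
  unfolding l1_norm_def sum.distrib[symmetric] by (intro sum_mono abs_triangle_ineq)

lemma abs_dual_coef_le: "\<bar>dual_coef N w i v\<bar> \<le> l1_norm N (w i) * l1_norm N v"
proof -
  have "\<bar>dual_coef N w i v\<bar> \<le> (\<Sum>t<N. \<bar>w i t\<bar> * \<bar>v t\<bar>)"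
    unfolding dual_coef_def by (rule order_trans[OF sum_abs]) (simp add: abs_mult)
  also have "\<dots> \<le> (\<Sum>t<N. \<bar>w i t\<bar> * l1_norm N v)"
    by (intro sum_mono mult_left_mono abs_le_l1_norm) auto
  also have "\<dots> = l1_norm N (w i) * l1_norm N v" by (simp add: l1_norm_def sum_distrib_right)
  finally show ?thesis .
qed

lemma abs_dual_coef_le_mult:
  assumes "l1_norm N (w i) \<le> a" "l1_norm N v \<le> b"
  shows "\<bar>dual_coef N w i v\<bar> \<le> a * b"
proof -
  have "0 \<le> a" using assms(1) l1_norm_nonneg[of N "w i"] by linarith
  then have "l1_norm N (w i) * l1_norm N v \<le> a * b"
    by (intro mult_mono assms l1_norm_nonneg)
  then show ?thesis using abs_dual_coef_le[of N w i v] by linarith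
qed

lemma l1_norm_app_le:
  "l1_norm N (mat_app N A v) \<le> (\<Sum>t<N. \<Sum>l<N. \<bar>A $$ (t, l)\<bar>) * l1_norm N v"
proof -
  have "\<bar>mat_app N A v t\<bar> \<le> (\<Sum>l<N. \<bar>A $$ (t, l)\<bar>) * l1_norm N v" for t
  proof -
    have "\<bar>mat_app N A v t\<bar> \<le> (\<Sum>l<N. \<bar>A $$ (t, l)\<bar> * \<bar>v l\<bar>)"
      unfolding mat_app_def by (rule order_trans[OF sum_abs]) (simp add: abs_mult)
    also have "\<dots> \<le> (\<Sum>l<N. \<bar>A $$ (t, l)\<bar> * l1_norm N v)"
      by (intro sum_mono mult_left_mono abs_le_l1_norm) auto
    finally show ?thesis by (simp add: sum_distrib_right)
  qed
  then show ?thesis unfolding l1_norm_def[of N "mat_app N A v"] sum_distrib_right by (intro sum_mono)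
qed

context spectral_splitting
begin

text \<open>The norm \<open>nu\<close> is known only through the locale; entries beyond
  \<open>N\<close> do not affect it because the difference has l1 norm 0.\<close>

lemma nu_cong: "(\<And>t. t < N \<Longrightarrow> u t = v t) \<Longrightarrow> nu u = nu v"
proof -
  have *: "nu u \<le> nu v" if "\<And>t. t < N \<Longrightarrow> u t = v t" for u v
  proof -
    have "nu u = nu (\<lambda>t. v t + (u t - v t))" by simp
    also have "\<dots> \<le> nu v + nu (\<lambda>t. u t - v t)" by (rule nu_add)
    also have "nu (\<lambda>t. u t - v t) \<le> K * l1_norm N (\<lambda>t. u t - v t)" by (rule nu_le)
    also have "l1_norm N (\<lambda>t. u t - v t) = 0" using that by (simp add: l1_norm_def)
    finally show ?thesis by simp
  qed
  assume "\<And>t. t < N \<Longrightarrow> u t = v t"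
  then show ?thesis by (intro order_antisym[OF *[of u v] *[of v u]]) auto
qed

abbreviation "coef \<equiv> dual_coef N w"
abbreviation "rest \<equiv> residual N x w"

lemma rest_decomp: "v t = rest v t + (\<Sum>j<3. coef j v * x j t)"
  by (simp add: residual_def mult.commute)

text \<open>The last term is the feedback from the complement; it would be absent if the functionals
  \<open>w\<close> were left eigenvectors.\<close>

lemma coef_app:
  assumes "i < 3"
  shows "coef i (mat_app N S v) = (if i = 0 then 1 else lam) * coef i v + coef i (mat_app N S (rest v))"
proof -
  have "mat_app N S v t = mat_app N S (rest v) t + (\<Sum>j<3. coef j v * ((if j = 0 then 1 else lam) * x j t))"
    if "t < N" for t
  proof -
    have "mat_app N S v t = mat_app N S (\<lambda>t. rest v t + (\<Sum>j<3. coef j v * x j t)) t"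
      by (subst rest_decomp[symmetric]) (rule refl)
    also have "\<dots> = mat_app N S (rest v) t + (\<Sum>j<3. coef j v * mat_app N S (x j) t)"
      by (simp only: mat_app_add mat_app_sum)
    also have "(\<Sum>j<3. coef j v * mat_app N S (x j) t) = (\<Sum>j<3. coef j v * ((if j = 0 then 1 else lam) * x j t))"
      using eigen that by (intro sum.cong) auto
    finally show ?thesis .
  qed
  then have "coef i (mat_app N S v) =
     coef i (\<lambda>t. mat_app N S (rest v) t + (\<Sum>j<3. (coef j v * (if j = 0 then 1 else lam)) * x j t))"
    by (intro dual_coef_cong) (simp add: mult.assoc)
  also have "\<dots> = coef i (mat_app N S (rest v)) + (\<Sum>j<3. (coef j v * (if j = 0 then 1 else lam)) * coef i (x j))"
    by (simp only: dual_coef_add dual_coef_sum)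
  also have "(\<Sum>j<3. (coef j v * (if j = 0 then 1 else lam)) * coef i (x j)) =
     (\<Sum>j<3. if i = j then coef j v * (if j = 0 then 1 else lam) else 0)"
    using dual assms by (intro sum.cong) auto
  also have "\<dots> = coef i v * (if i = 0 then 1 else lam)" using assms by simp
  finally show ?thesis by simp
qed

lemma rest_add: "rest (\<lambda>t. u t + v t) s = rest u s + rest v s"
  by (simp add: residual_def dual_coef_add distrib_left sum.distrib)

text \<open>The span of the three \<open>x j\<close> is invariant under \<open>S\<close> and killed
  by \<open>rest\<close>, so the complementary part evolves without input from the dominant
  one.\<close>

lemma rest_app:
  assumes "s < N"
  shows "rest (mat_app N S v) s = rest (mat_app N S (rest v)) s"
proof -
  have "mat_app N S v = mat_app N S (\<lambda>t. rest v t + (\<Sum>j<3. coef j v * x j t))"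
    by (subst rest_decomp[symmetric]) (rule refl)
  also have "\<dots> = (\<lambda>t. mat_app N S (rest v) t + (\<Sum>j<3. coef j v * mat_app N S (x j) t))"
    by (simp add: mat_app_add mat_app_sum fun_eq_iff)
  finally have "rest (mat_app N S v) s = rest (\<lambda>t. mat_app N S (rest v) t + (\<Sum>j<3. coef j v * mat_app N S (x j) t)) s"
    by (rule arg_cong)
  then have "rest (mat_app N S v) s = rest (mat_app N S (rest v)) s + rest (\<lambda>t. \<Sum>j<3. coef j v * mat_app N S (x j) t) s"
    by (simp only: rest_add)
  moreover have "rest (\<lambda>t. \<Sum>j<3. coef j v * mat_app N S (x j) t) s = 0"
  proof -
    define b where "b j = coef j v * (if j = 0 then 1 else lam)" for j :: nat
    have eq: "(\<Sum>j<3. coef j v * mat_app N S (x j) t) = (\<Sum>j<3. b j * x j t)" if "t < N" for t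
      using eigen that by (intro sum.cong) (auto simp: b_def)
    have "coef i (\<lambda>t. \<Sum>j<3. coef j v * mat_app N S (x j) t) = b i" if "i < 3" for i
    proof -
      have "coef i (\<lambda>t. \<Sum>j<3. coef j v * mat_app N S (x j) t) = coef i (\<lambda>t. \<Sum>j<3. b j * x j t)"
        by (rule dual_coef_cong) (rule eq)
      also have "\<dots> = (\<Sum>j<3. if i = j then b j else 0)"
        unfolding dual_coef_sum using dual that by (intro sum.cong) auto
      finally show ?thesis using that by simp
    qed
    then have "(\<Sum>i<3. x i s * coef i (\<lambda>t. \<Sum>j<3. coef j v * mat_app N S (x j) t)) = (\<Sum>i<3. b i * x i s)"
      by (intro sum.cong) auto
    then show ?thesis using eq[OF assms] by (simp add: residual_def)
  qed
  ultimately show ?thesis by simp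
qed

lemma nu_rest_app: "nu (rest (mat_app N S v)) \<le> \<rho> * nu (rest v)"
  using nu_contract[of "rest v"] nu_cong[of "rest (mat_app N S v)" "rest (mat_app N S (rest v))", OF rest_app] by simp

lemma nu_nonneg: "0 \<le> nu v"
  using nu_ge[of v] l1_norm_nonneg[of N v] by linarith

definition rest_bound :: real where
  "rest_bound = 1 + (\<Sum>j<3. l1_norm N (x j) * l1_norm N (w j))"

lemma l1_norm_rest_le: "l1_norm N (rest v) \<le> rest_bound * l1_norm N v"
proof -
  have "l1_norm N (rest v) \<le> (\<Sum>t<N. \<bar>v t\<bar> + (\<Sum>j<3. \<bar>x j t\<bar> * \<bar>coef j v\<bar>))"
    unfolding l1_norm_def residual_def
    by (intro sum_mono order_trans[OF abs_triangle_ineq4] add_left_mono order_trans[OF sum_abs]) (simp add: abs_mult)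
  also have "\<dots> = l1_norm N v + (\<Sum>j<3. l1_norm N (x j) * \<bar>coef j v\<bar>)"
    unfolding sum.distrib l1_norm_def sum_distrib_right by (simp add: sum.swap[of _ "{..<3}"])
  also have "\<dots> \<le> l1_norm N v + (\<Sum>j<3. l1_norm N (x j) * (l1_norm N (w j) * l1_norm N v))"
    by (intro add_left_mono sum_mono mult_left_mono abs_dual_coef_le l1_norm_nonneg)
  also have "\<dots> = rest_bound * l1_norm N v"
    by (simp add: rest_bound_def distrib_right sum_distrib_right mult.assoc)
  finally show ?thesis .
qed

lemma rest_bound_ge: "1 \<le> rest_bound"
  by (simp add: rest_bound_def sum_nonneg l1_norm_nonneg)

lemma rest_x: "j < 3 \<Longrightarrow> rest (x j) t = 0"
proof -
  assume j: "j < 3"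
  have "(\<Sum>i<3. x i t * coef i (x j)) = (\<Sum>i<3. if i = j then x j t else 0)"
    using dual j by (intro sum.cong) auto
  then show ?thesis using j by (simp add: residual_def)
qed

end

text \<open>The same \<open>\<rho>\<close> bounds the contraction of the complement and the decay of
  the perturbation.\<close>

locale perturbed_splitting = spectral_splitting +
  fixes T :: "nat \<Rightarrow> real Matrix.mat" and C :: real
  assumes C: "0 \<le> C"
    and pert: "\<And>k. 1 \<le> k \<Longrightarrow> (\<Sum>t<N. \<Sum>l<N. \<bar>T k $$ (t, l) - S $$ (t, l)\<bar>) \<le> C * \<rho> ^ k"
begin

abbreviation "traj \<equiv> trajectory N T"

definition start_size :: "(nat \<Rightarrow> real) \<Rightarrow> real" where
  "start_size v = \<bar>coef 0 v\<bar> + \<bar>coef 1 v\<bar> + \<bar>coef 2 v\<bar> + nu (rest v)"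

text \<open>The estimate of \<open>a i - coef i v\<close> serves the independence proof: for a start
  inside the dominant span at a late level, the limit coordinates are close to the initial
  ones.\<close>

lemma trajectory_asymptotics:
  obtains \<theta> G where "0 < \<theta>" "\<theta> < lam" "0 \<le> G"
    "\<And>k0 v. 1 \<le> k0 \<Longrightarrow> \<exists>l a. (\<forall>t<N. (\<lambda>m. traj k0 v m t) \<longlonglongrightarrow> l) \<and>
       (\<forall>i\<in>{1, 2}. (\<lambda>m. coef i (traj k0 v m) / lam ^ m) \<longlonglongrightarrow> a i \<and>
          \<bar>a i - coef i v\<bar> \<le> G * (nu (rest v) + \<theta> ^ k0 * start_size v)) \<and>
       (\<forall>t<N. (\<lambda>m. (traj k0 v m t - coef 0 (traj k0 v m)) / lam ^ m) \<longlonglongrightarrow> a 1 * x 1 t + a 2 * x 2 t)"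
proof -
  define SS where "SS = (\<Sum>t<N. \<Sum>l<N. \<bar>S $$ (t, l)\<bar>)"
  define wb where "wb = (\<Sum>i<3. l1_norm N (w i))"
  define B where "B = 1 + (\<Sum>j<3. l1_norm N (x j))"
  define H where "H = wb * SS + wb * C + K * rest_bound * C"
  have nn: "0 \<le> SS" "0 \<le> wb" "0 \<le> B" "0 \<le> K * rest_bound * C"
    using rest_bound_ge C K by (auto simp: SS_def wb_def B_def sum_nonneg l1_norm_nonneg intro!: add_nonneg_nonneg)
  have wb: "l1_norm N (w i) \<le> wb" if "i < 3" for i
    unfolding wb_def using that by (intro member_le_sum) (auto simp: l1_norm_nonneg)
  have H: "0 \<le> H" "wb * SS \<le> H" "wb * C \<le> H" "K * rest_bound * C \<le> H"
    using nn C by (auto simp: H_def)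
  have norm_bound: "l1_norm N v \<le> B * (\<bar>coef 0 v\<bar> + \<bar>coef 1 v\<bar> + \<bar>coef 2 v\<bar> + nu (rest v))" for v
  proof -
    define q where "q = \<bar>coef 0 v\<bar> + \<bar>coef 1 v\<bar> + \<bar>coef 2 v\<bar> + nu (rest v)"
    have q: "nu (rest v) \<le> q" "0 \<le> q" "\<And>j. j < 3 \<Longrightarrow> \<bar>coef j v\<bar> \<le> q"
      using nu_nonneg[of "rest v"] by (auto simp: q_def numeral_3_eq_3 numeral_2_eq_2 less_Suc_eq)
    have "l1_norm N v = l1_norm N (\<lambda>t. rest v t + (\<Sum>j<3. coef j v * x j t))"
      by (subst rest_decomp[symmetric]) (rule refl)
    also have "\<dots> \<le> l1_norm N (rest v) + l1_norm N (\<lambda>t. \<Sum>j<3. coef j v * x j t)"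
      by (rule l1_norm_add)
    also have "l1_norm N (rest v) \<le> q" using nu_ge[of "rest v"] q by linarith
    also have "l1_norm N (\<lambda>t. \<Sum>j<3. coef j v * x j t) \<le> (\<Sum>t<N. \<Sum>j<3. \<bar>coef j v\<bar> * \<bar>x j t\<bar>)"
      unfolding l1_norm_def by (intro sum_mono order_trans[OF sum_abs]) (simp add: abs_mult)
    also have "\<dots> \<le> (\<Sum>t<N. \<Sum>j<3. q * \<bar>x j t\<bar>)"
      by (intro sum_mono mult_right_mono q) auto
    also have "\<dots> = (\<Sum>j<3. l1_norm N (x j)) * q"
      unfolding l1_norm_def by (subst sum.swap) (simp add: sum_distrib_left mult.commute)
    finally show ?thesis unfolding q_def[symmetric] by (simp add: B_def distrib_right)
  qed
  obtain \<theta> G where th: "0 < \<theta>" "\<theta> < lam" "0 \<le> G" and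
    bounds: "\<And>k0 (c :: nat \<Rightarrow> nat \<Rightarrow> real) (h :: nat \<Rightarrow> nat \<Rightarrow> real) r v V.
      (\<And>m. 0 \<le> r m) \<Longrightarrow> (\<And>m. 0 \<le> v m) \<Longrightarrow>
      (\<And>m. v m \<le> B * (\<bar>c 0 m\<bar> + \<bar>c 1 m\<bar> + \<bar>c 2 m\<bar> + r m)) \<Longrightarrow>
      (\<And>i m. i < 3 \<Longrightarrow> c i (Suc m) = (if i = 0 then 1 else lam) * c i m + h i m) \<Longrightarrow>
      (\<And>i m. i < 3 \<Longrightarrow> \<bar>h i m\<bar> \<le> H * (r m + \<rho> ^ (k0 + m) * v m)) \<Longrightarrow>
      (\<And>m. r (Suc m) \<le> \<rho> * r m + H * \<rho> ^ (k0 + m) * v m) \<Longrightarrow>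
      V = \<bar>c 0 0\<bar> + \<bar>c 1 0\<bar> + \<bar>c 2 0\<bar> + r 0 \<Longrightarrow>
      (\<forall>m. r m \<le> G * \<theta> ^ m * (r 0 + \<theta> ^ k0 * V)) \<and>
      (\<forall>i<3. \<forall>m. \<bar>h i m\<bar> \<le> G * \<theta> ^ m * (r 0 + \<theta> ^ k0 * V))"
    using perturbed_recursion_bounds[OF rho H(1) nn(3)] by blast
  show ?thesis
  \<comment> \<open>The denominator comes from summing the geometric bound on the forcing terms in
    \<open>geometric_recursion_limit\<close>.\<close>
  proof (rule that[of \<theta> "G / (lam - \<theta>)"])
    show "0 < \<theta>" "\<theta> < lam" "0 \<le> G / (lam - \<theta>)" using th by auto
    fix k0 :: nat and v0 assume k0: "1 \<le> k0"
    define v where "v = traj k0 v0"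
    define u where "u m t = mat_app N (T (k0 + m)) (v m) t - mat_app N S (v m) t" for m t
    \<comment> \<open>Everything that disturbs the diagonal recursion of the dominant coordinates:
      feedback from the complement and the perturbation \<open>u\<close>.\<close>
    define h where "h i m = coef i (mat_app N S (rest (v m))) + coef i (u m)" for i m
    have vSuc: "v (Suc m) = (\<lambda>t. mat_app N S (v m) t + u m t)" for m
      by (simp add: v_def u_def)
    have nu_u: "l1_norm N (u m) \<le> C * \<rho> ^ (k0 + m) * l1_norm N (v m)" for m
    proof -
      have "\<bar>u m t\<bar> \<le> (\<Sum>l<N. \<bar>T (k0 + m) $$ (t, l) - S $$ (t, l)\<bar>) * l1_norm N (v m)" for t
      proof -
        have "u m t = (\<Sum>l<N. (T (k0 + m) $$ (t, l) - S $$ (t, l)) * v m l)"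
          by (simp add: u_def mat_app_def left_diff_distrib sum_subtractf)
        also have "\<bar>\<dots>\<bar> \<le> (\<Sum>l<N. \<bar>T (k0 + m) $$ (t, l) - S $$ (t, l)\<bar> * \<bar>v m l\<bar>)"
          by (rule order_trans[OF sum_abs]) (simp add: abs_mult)
        also have "\<dots> \<le> (\<Sum>l<N. \<bar>T (k0 + m) $$ (t, l) - S $$ (t, l)\<bar> * l1_norm N (v m))"
          by (intro sum_mono mult_left_mono abs_le_l1_norm) auto
        finally show ?thesis by (simp add: sum_distrib_right)
      qed
      then have "l1_norm N (u m) \<le> (\<Sum>t<N. \<Sum>l<N. \<bar>T (k0 + m) $$ (t, l) - S $$ (t, l)\<bar>) * l1_norm N (v m)"
        unfolding l1_norm_def[of N "u m"] sum_distrib_right by (intro sum_mono)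
      also have "\<dots> \<le> C * \<rho> ^ (k0 + m) * l1_norm N (v m)"
        using pert[of "k0 + m"] k0 by (intro mult_right_mono l1_norm_nonneg) auto
      finally show ?thesis .
    qed
    have "(\<forall>m. nu (rest (v m)) \<le> G * \<theta> ^ m * (nu (rest (v 0)) + \<theta> ^ k0 * start_size (v 0))) \<and>
       (\<forall>i<3. \<forall>m. \<bar>h i m\<bar> \<le> G * \<theta> ^ m * (nu (rest (v 0)) + \<theta> ^ k0 * start_size (v 0)))"
    proof (rule bounds[of "\<lambda>m. nu (rest (v m))" "\<lambda>m. l1_norm N (v m)" "\<lambda>i m. coef i (v m)" h])
      show "coef i (v (Suc m)) = (if i = 0 then 1 else lam) * coef i (v m) + h i m" if "i < 3" for i m
        unfolding vSuc dual_coef_add coef_app[OF that, of "v m"] h_def by simp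
      show "\<bar>h i m\<bar> \<le> H * (nu (rest (v m)) + \<rho> ^ (k0 + m) * l1_norm N (v m))" if "i < 3" for i m
      proof -
        have "\<bar>coef i (mat_app N S (rest (v m)))\<bar> \<le> wb * (SS * nu (rest (v m)))"
        proof (rule abs_dual_coef_le_mult[of N w i, OF wb[OF that]])
          have "SS * l1_norm N (rest (v m)) \<le> SS * nu (rest (v m))"
            by (intro mult_left_mono nu_ge nn)
          then show "l1_norm N (mat_app N S (rest (v m))) \<le> SS * nu (rest (v m))"
            using l1_norm_app_le[of N S "rest (v m)"] by (simp add: SS_def)
        qed
        moreover have "\<bar>coef i (u m)\<bar> \<le> wb * (C * \<rho> ^ (k0 + m) * l1_norm N (v m))"
          by (rule abs_dual_coef_le_mult[of N w i, OF wb[OF that] nu_u])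
        moreover have "wb * (SS * nu (rest (v m))) \<le> H * nu (rest (v m))"
          using mult_right_mono[OF H(2) nu_nonneg[of "rest (v m)"]] by (simp add: mult.assoc)
        moreover have "wb * (C * \<rho> ^ (k0 + m) * l1_norm N (v m)) \<le> H * (\<rho> ^ (k0 + m) * l1_norm N (v m))"
          using mult_right_mono[OF H(3), of "\<rho> ^ (k0 + m) * l1_norm N (v m)"] rho l1_norm_nonneg
          by (simp add: mult.assoc)
        ultimately show ?thesis unfolding h_def by (simp add: distrib_left)
      qed
      show "nu (rest (v (Suc m))) \<le> \<rho> * nu (rest (v m)) + H * \<rho> ^ (k0 + m) * l1_norm N (v m)" for m
      proof -
        have "nu (rest (v (Suc m))) = nu (\<lambda>t. rest (mat_app N S (v m)) t + rest (u m) t)"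
          unfolding vSuc rest_add ..
        also have "\<dots> \<le> nu (rest (mat_app N S (v m))) + nu (rest (u m))" by (rule nu_add)
        also have "nu (rest (mat_app N S (v m))) \<le> \<rho> * nu (rest (v m))" by (rule nu_rest_app)
        also have "nu (rest (u m)) \<le> K * (rest_bound * (C * \<rho> ^ (k0 + m) * l1_norm N (v m)))"
          using rest_bound_ge
          by (intro order_trans[OF nu_le] mult_left_mono order_trans[OF l1_norm_rest_le] nu_u K) auto
        also have "\<dots> = (K * rest_bound * C) * (\<rho> ^ (k0 + m) * l1_norm N (v m))" by (simp only: mult_ac)
        also have "\<dots> \<le> H * (\<rho> ^ (k0 + m) * l1_norm N (v m))"
          using H rho l1_norm_nonneg by (intro mult_right_mono) auto
        finally show ?thesis by (simp add: mult.assoc)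
      qed
      show "l1_norm N (v m) \<le> B * (\<bar>coef 0 (v m)\<bar> + \<bar>coef 1 (v m)\<bar> + \<bar>coef 2 (v m)\<bar> + nu (rest (v m)))" for m
        by (rule norm_bound)
      show "start_size (v 0) = \<bar>coef 0 (v 0)\<bar> + \<bar>coef 1 (v 0)\<bar> + \<bar>coef 2 (v 0)\<bar> + nu (rest (v 0))"
        by (simp add: start_size_def)
    qed (auto simp: nu_nonneg l1_norm_nonneg)
    note main = this
    define g where "g = G * (nu (rest v0) + \<theta> ^ k0 * start_size v0)"
    have v_0: "v 0 = v0" by (simp add: v_def)
    have g: "G * \<theta> ^ m * (nu (rest (v 0)) + \<theta> ^ k0 * start_size (v 0)) = g * \<theta> ^ m" for m
      by (simp add: g_def v_0)
    have r: "nu (rest (v m)) \<le> g * \<theta> ^ m" for m using main unfolding g by blast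
    have h: "\<bar>h i m\<bar> \<le> g * \<theta> ^ m" if "i < 3" for i m using main that unfolding g by blast
    have cSuc: "coef i (v (Suc m)) = (if i = 0 then 1 else lam) * coef i (v m) + h i m" if "i < 3" for i m
      unfolding vSuc dual_coef_add coef_app[OF that, of "v m"] h_def by simp
    obtain l where l: "(\<lambda>m. coef 0 (v m) / 1 ^ m) \<longlonglongrightarrow> l"
    proof (rule geometric_recursion_limit[of "\<lambda>m. coef 0 (v m)" 1 "h 0" g \<theta>])
      show "coef 0 (v (Suc m)) = 1 * coef 0 (v m) + h 0 m" for m using cSuc[of 0 m] by simp
    qed (use h th rho in auto)
    have "\<exists>a. (\<lambda>m. coef i (v m) / lam ^ m) \<longlonglongrightarrow> a \<and> \<bar>a - coef i v0\<bar> \<le> g / (lam - \<theta>)" if "i \<in> {1, 2}" for i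
    proof -
      have "coef i (v (Suc m)) = lam * coef i (v m) + h i m" for m using cSuc[of i m] that by auto
      moreover have "\<bar>h i m\<bar> \<le> g * \<theta> ^ m" for m using h that by auto
      ultimately show ?thesis
        using geometric_recursion_limit[of "\<lambda>m. coef i (v m)" lam "h i" g \<theta>] th unfolding v_0 by metis
    qed
    then obtain a where a: "\<And>i. i \<in> {1, 2} \<Longrightarrow> (\<lambda>m. coef i (v m) / lam ^ m) \<longlonglongrightarrow> a i"
      "\<And>i. i \<in> {1, 2} \<Longrightarrow> \<bar>a i - coef i v0\<bar> \<le> g / (lam - \<theta>)"
      by metis
    have lim: "(\<lambda>m. (v m t - coef 0 (v m)) / lam ^ m) \<longlonglongrightarrow> a 1 * x 1 t + a 2 * x 2 t" if t: "t < N" for t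
    proof -
      have "(\<lambda>m. rest (v m) t / lam ^ m) \<longlonglongrightarrow> 0"
      proof (rule Lim_null_comparison)
        show "(\<lambda>m. g * (\<theta> / lam) ^ m) \<longlonglongrightarrow> 0"
          using th by (intro tendsto_mult_right_zero LIMSEQ_realpow_zero) auto
        have "\<bar>rest (v m) t\<bar> \<le> g * \<theta> ^ m" for m
          using abs_le_l1_norm[OF t, of "rest (v m)"] nu_ge[of "rest (v m)"] r[of m] by linarith
        then show "\<forall>\<^sub>F m in sequentially. norm (rest (v m) t / lam ^ m) \<le> g * (\<theta> / lam) ^ m"
          using th by (intro always_eventually) (auto simp: power_divide field_simps)
      qed
      then have "(\<lambda>m. rest (v m) t / lam ^ m + coef 1 (v m) / lam ^ m * x 1 t + coef 2 (v m) / lam ^ m * x 2 t)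
          \<longlonglongrightarrow> 0 + a 1 * x 1 t + a 2 * x 2 t"
        by (intro tendsto_intros a) auto
      moreover have "rest (v m) t / lam ^ m + coef 1 (v m) / lam ^ m * x 1 t + coef 2 (v m) / lam ^ m * x 2 t =
         (v m t - coef 0 (v m)) / lam ^ m" for m
        by (simp add: residual_def numeral_3_eq_3 numeral_2_eq_2 x0 diff_divide_distrib add_divide_distrib mult.commute)
      ultimately show ?thesis by simp
    qed
    have "(\<lambda>m. v m t) \<longlonglongrightarrow> l" if t: "t < N" for t
    proof -
      have "(\<lambda>m. (v m t - coef 0 (v m)) / lam ^ m * lam ^ m + coef 0 (v m)) \<longlonglongrightarrow> (a 1 * x 1 t + a 2 * x 2 t) * 0 + l"
        using l th rho by (intro tendsto_intros lim[OF t] LIMSEQ_realpow_zero) auto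
      moreover have "lam \<noteq> 0" using th by simp
      ultimately show ?thesis by simp
    qed
    then show "\<exists>l a. (\<forall>t<N. (\<lambda>m. traj k0 v0 m t) \<longlonglongrightarrow> l) \<and>
       (\<forall>i\<in>{1, 2}. (\<lambda>m. coef i (traj k0 v0 m) / lam ^ m) \<longlonglongrightarrow> a i \<and>
          \<bar>a i - coef i v0\<bar> \<le> G / (lam - \<theta>) * (nu (rest v0) + \<theta> ^ k0 * start_size v0)) \<and>
       (\<forall>t<N. (\<lambda>m. (traj k0 v0 m t - coef 0 (traj k0 v0 m)) / lam ^ m) \<longlonglongrightarrow> a 1 * x 1 t + a 2 * x 2 t)"
      using a lim unfolding v_def g_def by (intro exI[of _ l] exI[of _ a]) auto
  qed
qed

end

section \<open>Local subdivision matrices\<close>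

lemma sum_blocks: "(\<Sum>l<n * m. f l) = (\<Sum>s<n. \<Sum>j<m. f (s * m + j))" for f :: "nat \<Rightarrow> 'a::comm_monoid_add"
proof -
  have "(\<Sum>l<n * m. f l) = (\<Sum>s<n. sum f {s * m..<s * m + m})" by (rule sum.nat_group[symmetric])
  also have "\<dots> = (\<Sum>s<n. \<Sum>j<m. f (s * m + j))"
  proof (rule sum.cong)
    show "sum f {s * m..<s * m + m} = (\<Sum>j<m. f (s * m + j))" for s
      using sum.shift_bounds_nat_ivl[of f 0 "s * m" m] by (simp add: add.commute lessThan_atLeast0)
  qed simp
  finally show ?thesis .
qed

lemma block_index_less: "r < n \<Longrightarrow> i < m \<Longrightarrow> r * m + i < n * m" for r n i m :: nat
proof -
  assume "r < n" "i < m"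
  then have "r * m + i < Suc r * m" "Suc r * m \<le> n * m" by (simp, intro mult_right_mono) auto
  then show ?thesis by linarith
qed

lemma vertex_block_index:
  assumes "B \<in> carrier_mat p p"
  shows "vertex_block n p a b g B $$ (0, 0) = a / real n"
    "j < p \<Longrightarrow> vertex_block n p a b g B $$ (0, Suc j) = vec_index b j"
    "i < p \<Longrightarrow> vertex_block n p a b g B $$ (Suc i, 0) = vec_index g i / real n"
    "i < p \<Longrightarrow> j < p \<Longrightarrow> vertex_block n p a b g B $$ (Suc i, Suc j) = B $$ (i, j)"
  using assms by (auto simp: vertex_block_def)

lemma vertex_matrix_index:
  shows "vertex_matrix n p a b g B $$ (0, 0) = a"
    "j < n * p \<Longrightarrow> vertex_matrix n p a b g B $$ (0, Suc j) = vec_index b (j mod p)"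
    "i < n * p \<Longrightarrow> vertex_matrix n p a b g B $$ (Suc i, 0) = vec_index g (i mod p)"
    "i < n * p \<Longrightarrow> j < n * p \<Longrightarrow> vertex_matrix n p a b g B $$ (Suc i, Suc j) =
       B ((j div p + n - i div p) mod n) $$ (i mod p, j mod p)"
  by (auto simp: vertex_matrix_def circ_def)

text \<open>In the vertex case the block-circulant matrices are singular, but they act bijectively on the
  vectors in which the entry of the extraordinary vertex is the same in all sectors.\<close>

definition consistent :: "irregularity \<Rightarrow> nat \<Rightarrow> nat \<Rightarrow> (nat \<Rightarrow> real) \<Rightarrow> bool" where
  "consistent E n p v \<longleftrightarrow> E = Extraordinary_Vertex \<longrightarrow> (\<forall>r<n. v (r * (p + 1)) = v 0)"

lemma mat_app_solvable:
  assumes A: "A \<in> carrier_mat N N" "invertible_mat A"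
  shows "\<exists>v. \<forall>t<N. mat_app N A v t = z t"
proof -
  obtain B where B: "inverts_mat A B" "inverts_mat B A" using A(2) by (auto simp: invertible_mat_def)
  have AB: "A * B = 1\<^sub>m N" using B(1) A by (simp add: inverts_mat_def)
  have Bc: "B \<in> carrier_mat N N"
    using B A AB by (metis carrier_matD carrier_matI index_mult_mat(2,3) index_one_mat(2,3) inverts_mat_def)
  define v where "v l = (\<Sum>s<N. B $$ (l, s) * z s)" for l
  have "mat_app N A v t = z t" if t: "t < N" for t
  proof -
    have "mat_app N A v t = (\<Sum>l<N. \<Sum>s<N. A $$ (t, l) * B $$ (l, s) * z s)"
      by (simp add: mat_app_def v_def sum_distrib_left mult.assoc)
    also have "\<dots> = (\<Sum>s<N. (\<Sum>l<N. A $$ (t, l) * B $$ (l, s)) * z s)"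
      by (subst sum.swap) (simp add: sum_distrib_right)
    also have "\<dots> = (\<Sum>s<N. (A * B) $$ (t, s) * z s)"
      using A Bc t by (intro sum.cong) (auto simp: scalar_prod_def lessThan_atLeast0)
    also have "\<dots> = (\<Sum>s<N. if t = s then z s else 0)"
      unfolding AB using t by (intro sum.cong) auto
    finally show ?thesis using t by simp
  qed
  then show ?thesis by blast
qed

text \<open>The formula for the first row of a block does not depend on the sector \<open>r\<close>,
  which makes every image consistent. On consistent data the \<open>n\<close> copies of the vertex
  with weights divided by \<open>n\<close> act like the single vertex of
  \<open>vertex_matrix\<close>.\<close>

lemma circ_vertex_app:
  assumes b: "b \<in> carrier_vec p" and g: "g \<in> carrier_vec p" and B: "\<forall>j<n. B j \<in> carrier_mat p p"
    and S: "S = circ n (p + 1) (\<lambda>j. vertex_block n p a b g (B j))" and r: "r < n"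
  shows "mat_app (n * (p + 1)) S v (r * (p + 1)) =
      (\<Sum>s<n. a / real n * v (s * (p + 1)) + (\<Sum>j<p. vec_index b j * v (s * (p + 1) + Suc j)))"
    and "i < p \<Longrightarrow> mat_app (n * (p + 1)) S v (r * (p + 1) + Suc i) =
      (\<Sum>s<n. vec_index g i / real n * v (s * (p + 1)) +
         (\<Sum>j<p. B ((s + n - r) mod n) $$ (i, j) * v (s * (p + 1) + Suc j)))"
proof -
  have divmod: "(q * (p + 1) + i) div (p + 1) = q" "(q * (p + 1) + i) mod (p + 1) = i" if "i < p + 1" for q i
    using that by (simp_all only: div_mult_self3 mod_mult_self3 div_less mod_less)
  have ent: "S $$ (r * (p + 1) + i, s * (p + 1) + j) = vertex_block n p a b g (B ((s + n - r) mod n)) $$ (i, j)"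
    if "i < p + 1" "s < n" "j < p + 1" for i s j
  proof -
    have lt: "r * (p + 1) + i < n * (p + 1)" "s * (p + 1) + j < n * (p + 1)"
      using that r by (auto intro!: block_index_less simp del: mult_Suc_right add_Suc_right Suc_eq_plus1)
    show ?thesis unfolding S circ_def index_mat(1)[OF lt] prod.case divmod[OF that(1)] divmod[OF that(3)] ..
  qed
  have app: "mat_app (n * (p + 1)) S v (r * (p + 1) + i) =
    (\<Sum>s<n. \<Sum>j<p + 1. vertex_block n p a b g (B ((s + n - r) mod n)) $$ (i, j) * v (s * (p + 1) + j))" if "i < p + 1" for i
    unfolding mat_app_def sum_blocks using ent that by (intro sum.cong) auto
  have Bc: "B ((s + n - r) mod n) \<in> carrier_mat p p" for s
    using r by (intro B[rule_format]) auto
  show "mat_app (n * (p + 1)) S v (r * (p + 1)) =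
      (\<Sum>s<n. a / real n * v (s * (p + 1)) + (\<Sum>j<p. vec_index b j * v (s * (p + 1) + Suc j)))"
    using app[of 0] unfolding Suc_eq_plus1[symmetric] sum.lessThan_Suc_shift
    by (simp add: vertex_block_index[OF Bc])
  show "i < p \<Longrightarrow> mat_app (n * (p + 1)) S v (r * (p + 1) + Suc i) =
      (\<Sum>s<n. vec_index g i / real n * v (s * (p + 1)) +
         (\<Sum>j<p. B ((s + n - r) mod n) $$ (i, j) * v (s * (p + 1) + Suc j)))"
    using app[of "Suc i"] unfolding Suc_eq_plus1[symmetric] sum.lessThan_Suc_shift
    by (simp add: vertex_block_index[OF Bc])
qed

lemma consistent_app:
  assumes "local_matrices E n p T S"
  shows "consistent E n p (mat_app (local_dim E n p) S v)"
proof (cases E)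
  case Extraordinary_Vertex
  then obtain a b g B where "b \<in> carrier_vec p" "g \<in> carrier_vec p" "\<forall>j<n. B j \<in> carrier_mat p p"
    "S = circ n (p + 1) (\<lambda>j. vertex_block n p a b g (B j))" using assms by auto
  note app = circ_vertex_app(1)[OF this]
  show ?thesis
  proof (cases "n = 0")
    case False
    then show ?thesis using app[of 0] app unfolding consistent_def Extraordinary_Vertex by simp
  qed (simp add: consistent_def)
qed (simp add: consistent_def)

text \<open>A consistent vector is the same as a vector of size \<open>n * p + 1\<close>, and under
  this identification \<open>S\<close> acts as the invertible \<open>T\<close>.\<close>

lemma consistent_solvable:
  assumes n: "n \<ge> 1" and loc: "local_matrices E n p T S" and inv: "invertible_mat T"
    and z: "consistent E n p z"
  shows "\<exists>v. consistent E n p v \<and> (\<forall>t<local_dim E n p. mat_app (local_dim E n p) S v t = z t)"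
proof (cases E)
  case Extraordinary_Face
  then have "S \<in> carrier_mat (n * p) (n * p)" "T = S" using loc by (auto simp: circ_def)
  then show ?thesis using mat_app_solvable[of S "n * p" z] inv Extraordinary_Face by (simp add: consistent_def)
next
  case Extraordinary_Vertex
  then obtain a b g B where bgB: "b \<in> carrier_vec p" "g \<in> carrier_vec p" "\<forall>j<n. B j \<in> carrier_mat p p"
    and T: "T = vertex_matrix n p a b g B" and S: "S = circ n (p + 1) (\<lambda>j. vertex_block n p a b g (B j))"
    using loc by auto
  have Tc: "T \<in> carrier_mat (Suc (n * p)) (Suc (n * p))" by (auto simp: T vertex_matrix_def circ_def)
  \<comment> \<open>The right-hand side with the vertex copies merged into entry 0; below,
    \<open>v\<close> undoes the merging for the solution \<open>u\<close>.\<close>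
  define z' where "z' l = (case l of 0 \<Rightarrow> z 0 | Suc q \<Rightarrow> z ((q div p) * (p + 1) + Suc (q mod p)))" for l
  obtain u where u: "\<And>t. t < Suc (n * p) \<Longrightarrow> mat_app (Suc (n * p)) T u t = z' t"
    using mat_app_solvable[OF Tc inv] by blast
  define v where "v l = (if l mod (p + 1) = 0 then u 0 else u (Suc ((l div (p + 1)) * p + (l mod (p + 1) - 1))))" for l
  have divmod: "(q * (p + 1) + i) div (p + 1) = q" "(q * (p + 1) + i) mod (p + 1) = i" if "i < p + 1" for q i
    using that by (simp_all only: div_mult_self3 mod_mult_self3 div_less mod_less)
  have divmod': "(q * p + i) div p = q" "(q * p + i) mod p = i" if "i < p" for q i
    using that by auto
  have v0: "v (s * (p + 1)) = u 0" for s using divmod[of 0 s] by (simp add: v_def)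
  have v1: "v (s * (p + 1) + Suc j) = u (Suc (s * p + j))" if "j < p" for s j
    using divmod[of "Suc j" s] that unfolding v_def by simp
  have T0: "mat_app (Suc (n * p)) T u 0 = a * u 0 + (\<Sum>s<n. \<Sum>j<p. vec_index b j * u (Suc (s * p + j)))"
  proof -
    have "mat_app (Suc (n * p)) T u 0 = a * u 0 + (\<Sum>l<n * p. vec_index b (l mod p) * u (Suc l))"
      unfolding mat_app_def sum.lessThan_Suc_shift by (simp add: T vertex_matrix_index)
    also have "(\<Sum>l<n * p. vec_index b (l mod p) * u (Suc l)) = (\<Sum>s<n. \<Sum>j<p. vec_index b j * u (Suc (s * p + j)))"
      unfolding sum_blocks using divmod' by (intro sum.cong) auto
    finally show ?thesis .
  qed
  have T1: "mat_app (Suc (n * p)) T u (Suc (r * p + i)) =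
      vec_index g i * u 0 + (\<Sum>s<n. \<Sum>j<p. B ((s + n - r) mod n) $$ (i, j) * u (Suc (s * p + j)))"
    if "r < n" "i < p" for r i
  proof -
    have lt: "r * p + i < n * p" using that by (rule block_index_less)
    have "mat_app (Suc (n * p)) T u (Suc (r * p + i)) = vec_index g i * u 0 +
        (\<Sum>l<n * p. B ((l div p + n - r) mod n) $$ (i, l mod p) * u (Suc l))"
      unfolding mat_app_def sum.lessThan_Suc_shift using lt divmod'[OF that(2), of r]
      by (simp add: T vertex_matrix_index)
    also have "(\<Sum>l<n * p. B ((l div p + n - r) mod n) $$ (i, l mod p) * u (Suc l)) =
       (\<Sum>s<n. \<Sum>j<p. B ((s + n - r) mod n) $$ (i, j) * u (Suc (s * p + j)))"
      unfolding sum_blocks using divmod' by (intro sum.cong) auto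
    finally show ?thesis .
  qed
  have "mat_app (n * (p + 1)) S v t = z t" if t: "t < n * (p + 1)" for t
  proof -
    define r i where "r = t div (p + 1)" and "i = t mod (p + 1)"
    have ri: "t = r * (p + 1) + i" "i < p + 1" by (simp_all only: r_def i_def div_mult_mod_eq mod_less_divisor zero_less_Suc Suc_eq_plus1[symmetric])
    have r: "r < n" unfolding r_def using t by (rule less_mult_imp_div_less)
    show ?thesis
    proof (cases i)
      case 0
      have "mat_app (n * (p + 1)) S v t = a * u 0 + (\<Sum>s<n. \<Sum>j<p. vec_index b j * u (Suc (s * p + j)))"
      proof -
        have "mat_app (n * (p + 1)) S v t = mat_app (n * (p + 1)) S v (r * (p + 1))" using ri(1) 0 by simp
        also have "\<dots> = (\<Sum>s<n. a / real n * u 0 + (\<Sum>j<p. vec_index b j * u (Suc (s * p + j))))"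
          unfolding circ_vertex_app(1)[OF bgB S r] v0 by (intro sum.cong arg_cong2[of _ _ _ _ "(+)"]) (use v1 in simp_all)
        also have "\<dots> = a * u 0 + (\<Sum>s<n. \<Sum>j<p. vec_index b j * u (Suc (s * p + j)))"
          using n by (simp add: sum.distrib)
        finally show ?thesis .
      qed
      also have "\<dots> = z' 0" using u[of 0] T0 by simp
      also have "\<dots> = z t" using z r unfolding ri(1) 0 by (simp add: z'_def consistent_def Extraordinary_Vertex)
      finally show ?thesis .
    next
      case (Suc i')
      then have i': "i' < p" using ri(2) by simp
      have "mat_app (n * (p + 1)) S v t =
          vec_index g i' * u 0 + (\<Sum>s<n. \<Sum>j<p. B ((s + n - r) mod n) $$ (i', j) * u (Suc (s * p + j)))"
      proof -
        have "mat_app (n * (p + 1)) S v t = mat_app (n * (p + 1)) S v (r * (p + 1) + Suc i')" using ri(1) Suc by simp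
        also have "\<dots> = (\<Sum>s<n. vec_index g i' / real n * u 0 + (\<Sum>j<p. B ((s + n - r) mod n) $$ (i', j) * u (Suc (s * p + j))))"
          unfolding circ_vertex_app(2)[OF bgB S r i'] v0 by (intro sum.cong arg_cong2[of _ _ _ _ "(+)"]) (use v1 in simp_all)
        also have "\<dots> = vec_index g i' * u 0 + (\<Sum>s<n. \<Sum>j<p. B ((s + n - r) mod n) $$ (i', j) * u (Suc (s * p + j)))"
          using n by (simp add: sum.distrib)
        finally show ?thesis .
      qed
      also have "\<dots> = z' (Suc (r * p + i'))"
        using u[of "Suc (r * p + i')"] T1[OF r i'] block_index_less[OF r i'] by simp
      also have "\<dots> = z t" using divmod'[OF i', of r] unfolding ri(1) Suc by (simp add: z'_def)
      finally show ?thesis .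
    qed
  qed
  moreover have "consistent E n p v" using v0 v0[of 0] by (simp add: consistent_def)
  ultimately show ?thesis using Extraordinary_Vertex by auto
qed

text \<open>As \<open>lam\<close> is non-zero, \<open>y\<close> is an image under
  \<open>Sbar\<close> and therefore consistent. Consistent vectors can then be traced back level by
  level, staying consistent.\<close>

lemma eigenvector_reachable:
  assumes n: "n \<ge> 1" and N: "N = local_dim E n p"
    and loc: "\<And>k. k \<ge> 1 \<Longrightarrow> local_matrices E n p (T k) (S k)" "\<And>k. k \<ge> 1 \<Longrightarrow> invertible_mat (T k)"
    and loc': "local_matrices E n p Tbar Sbar" and lam: "lam \<noteq> 0"
    and y: "\<And>t. t < N \<Longrightarrow> mat_app N Sbar y t = lam * y t"
  shows "\<exists>v. \<forall>t<N. trajectory N S 1 v m t = y t"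
proof -
  have reach: "\<exists>v. \<forall>t<N. trajectory N S 1 v m t = z t" if "consistent E n p z" for m z
    using that
  proof (induction m arbitrary: z)
    case (Suc m)
    obtain u where u: "consistent E n p u" "\<And>t. t < N \<Longrightarrow> mat_app N (S (1 + m)) u t = z t"
      using consistent_solvable[OF n loc(1)[of "1 + m"] loc(2)[of "1 + m"] Suc.prems] unfolding N by auto
    obtain v where v: "\<And>t. t < N \<Longrightarrow> trajectory N S 1 v m t = u t" using Suc.IH[OF u(1)] by blast
    have "mat_app N (S (1 + m)) (trajectory N S 1 v m) = mat_app N (S (1 + m)) u"
      by (rule mat_app_cong) (rule v)
    then show ?case using u(2) by (intro exI[of _ v]) simp
  qed auto
  have c: "consistent E n p (mat_app N Sbar (\<lambda>t. y t / lam))" unfolding N by (rule consistent_app[OF loc'])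
  have "mat_app N Sbar (\<lambda>t. y t / lam) t = y t" if "t < N" for t
  proof -
    have "mat_app N Sbar (\<lambda>t. y t / lam) t = mat_app N Sbar y t / lam"
      by (simp add: mat_app_def sum_divide_distrib)
    then show ?thesis using y[OF that] lam by simp
  qed
  then show ?thesis using reach[OF c, of m] by auto
qed

lemma local_matrices_carrier:
  "local_matrices E n p T S \<Longrightarrow> S \<in> carrier_mat (local_dim E n p) (local_dim E n p)"
  by (cases E) (auto simp: circ_def)

lemma entry_sum_le_matrix_norm_inf:
  assumes "A \<in> carrier_mat N N"
  shows "(\<Sum>t<N. \<Sum>l<N. \<bar>A $$ (t, l)\<bar>) \<le> real N * matrix_norm_inf A"
proof -
  have "(\<Sum>l<N. \<bar>A $$ (t, l)\<bar>) \<le> matrix_norm_inf A" if "t < N" for t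
    unfolding matrix_norm_inf_def using assms that by (intro Max_ge) auto
  then have "(\<Sum>t<N. \<Sum>l<N. \<bar>A $$ (t, l)\<bar>) \<le> (\<Sum>t<N. matrix_norm_inf A)" by (intro sum_mono) auto
  then show ?thesis by simp
qed

section \<open>From scalar trajectories to control points\<close>

lemma trajectory_add:
  "trajectory N S k v (j + m) = trajectory N S (k + j) (trajectory N S k v j) m"
  by (induction m) (simp_all add: add.assoc)

lemma trajectory_cong:
  assumes "\<And>t. t < N \<Longrightarrow> u t = v t" "t < N"
  shows "trajectory N S k u m t = trajectory N S k v m t"
  using assms(2)
proof (induction m arbitrary: t)
  case (Suc m)
  have "mat_app N (S (k + m)) (trajectory N S k u m) = mat_app N (S (k + m)) (trajectory N S k v m)"
    by (rule mat_app_cong) (rule Suc.IH)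
  then show ?case by simp
qed (use assms in auto)

definition unit_seq :: "nat \<Rightarrow> nat \<Rightarrow> real" where
  "unit_seq t s = (if s = t then 1 else 0)"

text \<open>Level 1 carries the initial points, so level \<open>Suc k\<close> is reached after the
  \<open>k\<close> matrices \<open>S 1\<close> to \<open>S k\<close>. The coefficients are scalar,
  which reduces points of space to scalar trajectories.\<close>

lemma control_points_eq_trajectory:
  assumes "i < N"
  shows "control_points N S d (Suc k) i = (\<Sum>t<N. trajectory N S 1 (unit_seq t) k i *\<^sub>R d t)"
  using assms
proof (induction k arbitrary: i)
  case 0
  have "(\<Sum>t<N. trajectory N S 1 (unit_seq t) 0 i *\<^sub>R d t) = (\<Sum>t<N. if i = t then d t else 0)"
    by (intro sum.cong) (auto simp: unit_seq_def)
  then show ?case using 0 by simp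
next
  case (Suc k)
  have "control_points N S d (Suc (Suc k)) i = (\<Sum>l<N. (S (Suc k) $$ (i, l)) *\<^sub>R control_points N S d (Suc k) l)"
    by simp
  also have "\<dots> = (\<Sum>l<N. \<Sum>t<N. (S (Suc k) $$ (i, l) * trajectory N S 1 (unit_seq t) k l) *\<^sub>R d t)"
    using Suc.IH by (intro sum.cong) (auto simp: scaleR_right.sum)
  also have "\<dots> = (\<Sum>t<N. (\<Sum>l<N. S (Suc k) $$ (i, l) * trajectory N S 1 (unit_seq t) k l) *\<^sub>R d t)"
    by (subst sum.swap) (simp add: scaleR_left.sum)
  finally show ?case by (simp add: mat_app_def)
qed

lemma trajectory_linear:
  assumes "s < N"
  shows "trajectory N S k v m s = (\<Sum>t<N. v t * trajectory N S k (unit_seq t) m s)"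
  using assms
proof (induction m arbitrary: s)
  case 0
  have "(\<Sum>t<N. v t * trajectory N S k (unit_seq t) 0 s) = (\<Sum>t<N. if s = t then v t else 0)"
    by (intro sum.cong) (auto simp: unit_seq_def)
  then show ?case using 0 by simp
next
  case (Suc m)
  have "mat_app N (S (k + m)) (trajectory N S k v m) =
      mat_app N (S (k + m)) (\<lambda>s. \<Sum>t<N. v t * trajectory N S k (unit_seq t) m s)"
    by (rule mat_app_cong) (rule Suc.IH)
  then show ?case by (simp add: mat_app_sum)
qed

text \<open>If all two-by-two minors of the pair \<open>A\<close>, \<open>B\<close> vanished, so
  would the determinant of the two functionals on any pair of vectors, being a bilinear combination
  of those minors.\<close>

lemma nonparallel_entries:
  fixes A B u v :: "nat \<Rightarrow> real"
  assumes "(\<Sum>t<N. u t * A t) * (\<Sum>t<N. v t * B t) \<noteq> (\<Sum>t<N. u t * B t) * (\<Sum>t<N. v t * A t)"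
  shows "\<exists>i<N. \<exists>j<N. A i * B j - A j * B i \<noteq> 0"
proof (rule ccontr)
  assume "\<not> ?thesis"
  then have eq: "A i * B j = A j * B i" if "i < N" "j < N" for i j using that by force
  have "(\<Sum>t<N. u t * A t) * (\<Sum>t<N. v t * B t) = (\<Sum>i<N. \<Sum>j<N. u i * v j * (A i * B j))"
    unfolding sum_product by (simp add: mult_ac)
  also have "\<dots> = (\<Sum>i<N. \<Sum>j<N. u i * v j * (A j * B i))"
    using eq by (intro sum.cong) auto
  also have "\<dots> = (\<Sum>t<N. u t * B t) * (\<Sum>t<N. v t * A t)"
    unfolding sum_product by (simp add: mult_ac)
  finally show False using assms by contradiction
qed

text \<open>\<open>A t\<close> and \<open>B t\<close> are the limit coordinates along
  \<open>y0\<close> and \<open>y1\<close> of the trajectory started at the unit vector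
  \<open>t\<close>.\<close>

lemma control_points_asymptotics:
  fixes S T :: "nat \<Rightarrow> real Matrix.mat"
  assumes n: "n \<ge> 1" and N: "N = local_dim E n p"
    and loc: "\<And>k. k \<ge> 1 \<Longrightarrow> local_matrices E n p (T k) (S k)" "\<And>k. k \<ge> 1 \<Longrightarrow> invertible_mat (T k)"
    and loc': "local_matrices E n p Tbar Sbar"
    and std: "standard_matrix Sbar lam"
    and y: "eigenvector Sbar y0 lam" "eigenvector Sbar y1 lam"
    and indep: "\<And>a b :: real. a \<cdot>\<^sub>v y0 + b \<cdot>\<^sub>v y1 = 0\<^sub>v N \<Longrightarrow> a = 0 \<and> b = 0"
    and C: "C > 0" and sigma: "\<sigma> > 1 / lam"
    and conv: "\<And>k. k \<ge> 1 \<Longrightarrow> matrix_norm_inf (S k - Sbar) \<le> C / \<sigma> ^ k"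
  obtains A B :: "nat \<Rightarrow> real" where
    "\<exists>i<N. \<exists>j<N. A i * B j - A j * B i \<noteq> 0"
    "\<And>d. \<exists>l. \<forall>i<N. (\<lambda>k. control_points N S d k i) \<longlonglongrightarrow> l"
    "\<And>d. \<exists>q. \<forall>i<N. (\<lambda>k. (control_points N S d (Suc k) i - q k) /\<^sub>R lam ^ k) \<longlonglongrightarrow>
        vec_index y0 i *\<^sub>R (\<Sum>t<N. A t *\<^sub>R d t) + vec_index y1 i *\<^sub>R (\<Sum>t<N. B t *\<^sub>R d t)"
proof -
  have lam: "0 < lam" "lam < 1" using std by (auto simp: standard_matrix_def)
  have sig: "0 < \<sigma>" "1 / \<sigma> < lam"
  proof -
    show *: "0 < \<sigma>" using sigma lam by (meson divide_pos_pos less_trans zero_less_one)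
    show "1 / \<sigma> < lam" using sigma lam * by (simp add: field_simps)
  qed
  have Sc: "Sbar \<in> carrier_mat N N" "\<And>k. k \<ge> 1 \<Longrightarrow> S k \<in> carrier_mat N N"
    using local_matrices_carrier loc(1) loc' unfolding N by blast+
  obtain \<rho> x w nu K where rho_sig: "1 / \<sigma> < \<rho>" and x: "x 1 = vec_index y0" "x 2 = vec_index y1"
    and split: "spectral_splitting N Sbar lam \<rho> x w nu K"
    using spectral_splitting_exists[OF Sc(1) std sig(2) y indep] by blast
  interpret spectral_splitting N Sbar lam \<rho> x w nu K by (rule split)
  interpret perturbed_splitting N Sbar lam \<rho> x w nu K S "real N * C"
  proof
    show "0 \<le> real N * C" using C by simp
    fix k :: nat assume k: "1 \<le> k"
    have "(\<Sum>t<N. \<Sum>l<N. \<bar>S k $$ (t, l) - Sbar $$ (t, l)\<bar>) = (\<Sum>t<N. \<Sum>l<N. \<bar>(S k - Sbar) $$ (t, l)\<bar>)"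
      using Sc k by (intro sum.cong) auto
    also have "\<dots> \<le> real N * matrix_norm_inf (S k - Sbar)"
      by (rule entry_sum_le_matrix_norm_inf) (use Sc k in auto)
    also have "\<dots> \<le> real N * (C / \<sigma> ^ k)" using conv[OF k] by (intro mult_left_mono) auto
    also have "\<dots> = real N * C * (1 / \<sigma>) ^ k" by (simp add: power_divide)
    also have "\<dots> \<le> real N * C * \<rho> ^ k" using rho_sig sig C by (intro mult_left_mono power_mono) auto
    finally show "(\<Sum>t<N. \<Sum>l<N. \<bar>S k $$ (t, l) - Sbar $$ (t, l)\<bar>) \<le> real N * C * \<rho> ^ k" .
  qed
  obtain \<theta> G where th: "0 < \<theta>" "\<theta> < lam" "0 \<le> G" and asym:
    "\<And>k0 v. 1 \<le> k0 \<Longrightarrow> \<exists>l a. (\<forall>t<N. (\<lambda>m. traj k0 v m t) \<longlonglongrightarrow> l) \<and>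
       (\<forall>i\<in>{1, 2}. (\<lambda>m. coef i (traj k0 v m) / lam ^ m) \<longlonglongrightarrow> a i \<and>
          \<bar>a i - coef i v\<bar> \<le> G * (nu (rest v) + \<theta> ^ k0 * start_size v)) \<and>
       (\<forall>t<N. (\<lambda>m. (traj k0 v m t - coef 0 (traj k0 v m)) / lam ^ m) \<longlonglongrightarrow> a 1 * x 1 t + a 2 * x 2 t)"
    using trajectory_asymptotics by blast
  have "\<forall>v. \<exists>l a. (\<forall>t<N. (\<lambda>m. traj 1 v m t) \<longlonglongrightarrow> l) \<and>
       (\<forall>i\<in>{1, 2}. (\<lambda>m. coef i (traj 1 v m) / lam ^ m) \<longlonglongrightarrow> a i) \<and>
       (\<forall>t<N. (\<lambda>m. (traj 1 v m t - coef 0 (traj 1 v m)) / lam ^ m) \<longlonglongrightarrow> a 1 * x 1 t + a 2 * x 2 t)"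
    using asym[of 1] by fast
  then obtain l a where
    l: "\<And>v t. t < N \<Longrightarrow> (\<lambda>m. traj 1 v m t) \<longlonglongrightarrow> l v" and
    a: "\<And>v i. i \<in> {1, 2} \<Longrightarrow> (\<lambda>m. coef i (traj 1 v m) / lam ^ m) \<longlonglongrightarrow> a v i" and
    d: "\<And>v t. t < N \<Longrightarrow> (\<lambda>m. (traj 1 v m t - coef 0 (traj 1 v m)) / lam ^ m) \<longlonglongrightarrow> a v 1 * x 1 t + a v 2 * x 2 t"
    unfolding choice_iff by blast
  define A where "A t = a (unit_seq t) 1" for t
  define B where "B t = a (unit_seq t) 2" for t
  have lin: "a v i = (\<Sum>t<N. v t * a (unit_seq t) i)" if "i \<in> {1, 2}" for v i
  proof (rule LIMSEQ_unique[OF a[OF that]])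
    have "(\<lambda>m. \<Sum>t<N. v t * (coef i (traj 1 (unit_seq t) m) / lam ^ m)) \<longlonglongrightarrow> (\<Sum>t<N. v t * a (unit_seq t) i)"
      by (intro tendsto_intros a that)
    moreover have "(\<Sum>t<N. v t * (coef i (traj 1 (unit_seq t) m) / lam ^ m)) = coef i (traj 1 v m) / lam ^ m" for m
    proof -
      have "coef i (traj 1 v m) = coef i (\<lambda>s. \<Sum>t<N. v t * traj 1 (unit_seq t) m s)"
        by (rule dual_coef_cong) (rule trajectory_linear)
      then show ?thesis by (simp add: dual_coef_sum sum_divide_distrib)
    qed
    ultimately show "(\<lambda>m. coef i (traj 1 v m) / lam ^ m) \<longlonglongrightarrow> (\<Sum>t<N. v t * a (unit_seq t) i)" by simp
  qed
  have "\<exists>i<N. \<exists>j<N. A i * B j - A j * B i \<noteq> 0"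
  proof -
    have "(\<lambda>k. G * \<theta> ^ k) \<longlonglongrightarrow> G * 0"
      using th lam by (intro tendsto_intros LIMSEQ_realpow_zero) auto
    then have "\<forall>\<^sub>F k in sequentially. G * \<theta> ^ k < 1 / 4" by (rule order_tendstoD) simp
    \<comment> \<open>\<open>k1\<close> steps from level 1 lead to level \<open>Suc k1\<close>, late
      enough for the perturbation error to stay below 1/4.\<close>
    then obtain k1 where k1: "G * \<theta> ^ Suc k1 < 1 / 4"
      unfolding eventually_sequentially by (meson le_SucI order_refl)
    \<comment> \<open>Initial data that arrive exactly at the eigenvector \<open>x j\<close> after
      \<open>k1\<close> steps: there the complementary part is zero and \<open>start_size\<close> is
      1, so the scaled limit coordinates are close to those of \<open>x j\<close>.\<close>
    have "\<exists>v. \<forall>i\<in>{1, 2}. \<bar>a v i * lam ^ k1 - (if i = j then 1 else 0)\<bar> < 1 / 4" if j: "j \<in> {1, 2}" for j :: nat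
    proof -
      have j3: "j < 3" using j by auto
      have "\<exists>v. \<forall>t<N. traj 1 v k1 t = x j t"
        using eigenvector_reachable[where S = S and T = T and y = "x j" and m = k1 and lam = lam, OF n N loc loc'] eigen[of j] j lam by auto
      then obtain v where v: "\<And>t. t < N \<Longrightarrow> traj 1 v k1 t = x j t" by blast
      obtain a' where a': "\<And>i. i \<in> {1, 2} \<Longrightarrow> (\<lambda>m. coef i (traj (Suc k1) (x j) m) / lam ^ m) \<longlonglongrightarrow> a' i"
        "\<And>i. i \<in> {1, 2} \<Longrightarrow> \<bar>a' i - coef i (x j)\<bar> \<le> G * (nu (rest (x j)) + \<theta> ^ Suc k1 * start_size (x j))"
        using asym[of "Suc k1" "x j"] by auto
      have "rest (x j) = (\<lambda>_. 0)" using rest_x[OF j3] by auto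
      moreover have "nu (\<lambda>_. 0) = 0" using nu_le[of "\<lambda>_. 0"] nu_nonneg[of "\<lambda>_. 0"] by (simp add: l1_norm_def)
      ultimately have nr: "nu (rest (x j)) = 0" by simp
      have "start_size (x j) = 1" using j dual j3 nr by (auto simp: start_size_def)
      then have close: "\<bar>a' i - (if i = j then 1 else 0)\<bar> < 1 / 4" if "i \<in> {1, 2}" for i
        using a'(2)[OF that] k1 nr dual[of i j] that j3 by auto
      \<comment> \<open>The two limits differ only in normalisation: the restarted trajectory is
        divided by \<open>lam ^ m\<close> instead of \<open>lam ^ (k1 + m)\<close>.\<close>
      have "a v i * lam ^ k1 = a' i" if i: "i \<in> {1, 2}" for i
      proof (rule LIMSEQ_unique[OF _ a'(1)[OF i]])
        have "(\<lambda>m. coef i (traj 1 v (k1 + m)) / lam ^ (k1 + m)) \<longlonglongrightarrow> a v i"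
          using LIMSEQ_ignore_initial_segment[OF a[OF i, of v], of k1] by (simp add: add.commute)
        then have "(\<lambda>m. coef i (traj 1 v (k1 + m)) / lam ^ (k1 + m) * lam ^ k1) \<longlonglongrightarrow> a v i * lam ^ k1"
          by (rule tendsto_mult_right)
        moreover have "coef i (traj 1 v (k1 + m)) = coef i (traj (Suc k1) (x j) m)" for m
          unfolding trajectory_add by (rule dual_coef_cong) (auto intro!: trajectory_cong v[unfolded One_nat_def])
        ultimately show "(\<lambda>m. coef i (traj (Suc k1) (x j) m) / lam ^ m) \<longlonglongrightarrow> a v i * lam ^ k1"
          using lam by (simp add: power_add)
      qed
      then show ?thesis using close by (intro exI[of _ v]) auto
    qed
    note ex = this
    obtain u where u: "\<bar>a u 1 * lam ^ k1 - 1\<bar> < 1 / 4" "\<bar>a u 2 * lam ^ k1\<bar> < 1 / 4"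
      using ex[of 1] by auto
    obtain v where v: "\<bar>a v 1 * lam ^ k1\<bar> < 1 / 4" "\<bar>a v 2 * lam ^ k1 - 1\<bar> < 1 / 4"
      using ex[of 2] by auto
    \<comment> \<open>The two-by-two matrix is entrywise within 1/4 of the identity: the diagonal
      product is at least 9/16, the other at most 1/16.\<close>
    have "(a u 2 * lam ^ k1) * (a v 1 * lam ^ k1) < (a u 1 * lam ^ k1) * (a v 2 * lam ^ k1)"
    proof -
      have "\<bar>(a u 2 * lam ^ k1) * (a v 1 * lam ^ k1)\<bar> \<le> 1 / 4 * (1 / 4)"
        unfolding abs_mult[of "a u 2 * lam ^ k1"] using u v by (intro mult_mono) auto
      moreover have "(3 / 4) * (3 / 4) \<le> (a u 1 * lam ^ k1) * (a v 2 * lam ^ k1)"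
      proof -
        have "3 / 4 \<le> a u 1 * lam ^ k1" "3 / 4 \<le> a v 2 * lam ^ k1" using u v by linarith+
        then show ?thesis by (intro mult_mono) auto
      qed
      ultimately show ?thesis by auto
    qed
    then have "a u 1 * a v 2 \<noteq> a u 2 * a v 1" by (auto simp: mult_ac)
    then show ?thesis using lin[of 1 u] lin[of 2 u] lin[of 1 v] lin[of 2 v] unfolding A_def B_def
      by (intro nonparallel_entries[where u = u and v = v]) simp
  qed
  moreover have "\<exists>L. \<forall>i<N. (\<lambda>k. control_points N S d k i) \<longlonglongrightarrow> L" for d
  proof (intro exI allI impI)
    fix i assume "i < N"
    then have "(\<lambda>k. \<Sum>t<N. traj 1 (unit_seq t) k i *\<^sub>R d t) \<longlonglongrightarrow> (\<Sum>t<N. l (unit_seq t) *\<^sub>R d t)"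
      by (intro tendsto_intros l)
    then have "(\<lambda>k. control_points N S d (Suc k) i) \<longlonglongrightarrow> (\<Sum>t<N. l (unit_seq t) *\<^sub>R d t)"
      using \<open>i < N\<close> by (simp only: control_points_eq_trajectory)
    then show "(\<lambda>k. control_points N S d k i) \<longlonglongrightarrow> (\<Sum>t<N. l (unit_seq t) *\<^sub>R d t)"
      by (rule LIMSEQ_imp_Suc)
  qed
  moreover have "\<exists>q. \<forall>i<N. (\<lambda>k. (control_points N S dd (Suc k) i - q k) /\<^sub>R lam ^ k) \<longlonglongrightarrow>
        vec_index y0 i *\<^sub>R (\<Sum>t<N. A t *\<^sub>R dd t) + vec_index y1 i *\<^sub>R (\<Sum>t<N. B t *\<^sub>R dd t)" for dd
  proof (intro exI allI impI)
    fix i assume i: "i < N"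
    have "(\<lambda>k. \<Sum>t<N. ((traj 1 (unit_seq t) k i - coef 0 (traj 1 (unit_seq t) k)) / lam ^ k) *\<^sub>R dd t) \<longlonglongrightarrow>
       (\<Sum>t<N. (A t * x 1 i + B t * x 2 i) *\<^sub>R dd t)"
      unfolding A_def B_def by (intro tendsto_intros d i)
    also have "(\<Sum>t<N. (A t * x 1 i + B t * x 2 i) *\<^sub>R dd t) =
        vec_index y0 i *\<^sub>R (\<Sum>t<N. A t *\<^sub>R dd t) + vec_index y1 i *\<^sub>R (\<Sum>t<N. B t *\<^sub>R dd t)"
      unfolding x by (simp add: scaleR_add_left sum.distrib scaleR_right.sum mult.commute)
    also have "(\<lambda>k. \<Sum>t<N. ((traj 1 (unit_seq t) k i - coef 0 (traj 1 (unit_seq t) k)) / lam ^ k) *\<^sub>R dd t) =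
       (\<lambda>k. (control_points N S dd (Suc k) i - (\<Sum>t<N. coef 0 (traj 1 (unit_seq t) k) *\<^sub>R dd t)) /\<^sub>R lam ^ k)"
      unfolding control_points_eq_trajectory[OF i] sum_subtractf[symmetric] scaleR_right.sum
      by (simp add: scaleR_diff_left[symmetric] divide_inverse mult.commute)
    finally show "(\<lambda>k. (control_points N S dd (Suc k) i - (\<Sum>t<N. coef 0 (traj 1 (unit_seq t) k) *\<^sub>R dd t)) /\<^sub>R lam ^ k)
      \<longlonglongrightarrow> vec_index y0 i *\<^sub>R (\<Sum>t<N. A t *\<^sub>R dd t) + vec_index y1 i *\<^sub>R (\<Sum>t<N. B t *\<^sub>R dd t)" .
  qed
  ultimately show ?thesis by (rule that)
qed

section \<open>Rings and normals\<close>

text \<open>Fubini: the exceptional set is null as soon as its sections in one coordinate are null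
  for every choice of the others.\<close>

lemma AE_PiM_coordinate:
  fixes P :: "('i \<Rightarrow> 'a::euclidean_space) \<Rightarrow> bool"
  assumes I: "finite I" "i \<in> I"
    and meas: "{d \<in> space (PiM I (\<lambda>_. lborel)). P d} \<in> sets (PiM I (\<lambda>_. lborel))"
    and AE: "\<And>d. AE z in lborel. P (d(i := z))"
  shows "AE d in PiM I (\<lambda>_. lborel). P d"
proof -
  interpret product_sigma_finite "\<lambda>_ :: 'i. lborel :: 'a measure" ..
  let ?M = "PiM I (\<lambda>_. lborel :: 'a measure)"
  let ?N = "{d \<in> space ?M. \<not> P d}"
  have "?N = space ?M - {d \<in> space ?M. P d}" by auto
  then have N: "?N \<in> sets ?M" using meas by simp
  define J where "J = I - {i}"
  have J: "finite J" "i \<notin> J" "I = insert i J" using I by (auto simp: J_def)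
  have "emeasure ?M ?N = (\<integral>\<^sup>+ d. indicator ?N d \<partial>?M)" using N by simp
  also have "\<dots> = (\<integral>\<^sup>+ d. \<integral>\<^sup>+ z. indicator ?N (d(i := z)) \<partial>lborel \<partial>PiM J (\<lambda>_. lborel))"
    using N unfolding J(3) by (intro product_nn_integral_insert[OF J(1,2)]) simp
  also have "\<dots> = (\<integral>\<^sup>+ d. 0 \<partial>PiM J (\<lambda>_. lborel :: 'a measure))"
  proof (rule nn_integral_cong)
    fix d
    have "(\<integral>\<^sup>+ z. indicator ?N (d(i := z)) \<partial>lborel) = (\<integral>\<^sup>+ z. 0 \<partial>(lborel :: 'a measure))"
      by (rule nn_integral_cong_AE, rule AE_mp[OF AE[of d]]) (auto simp: indicator_def)
    then show "(\<integral>\<^sup>+ z. indicator ?N (d(i := z)) \<partial>lborel) = 0" by simp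
  qed
  finally have "?N \<in> null_sets ?M" using N by auto
  then show ?thesis by (rule AE_I') auto
qed

lemma AE_lborel_hyperplane:
  fixes a :: "'a::euclidean_space"
  assumes "a \<noteq> 0"
  shows "AE z in lborel. a \<bullet> z \<noteq> b"
proof -
  have "{z. a \<bullet> z = b} \<in> null_sets lebesgue"
    using negligible_hyperplane[of a b] assms by (simp add: negligible_iff_null_sets)
  then have "{z. a \<bullet> z = b} \<in> null_sets lborel"
    by (subst (asm) null_sets_completion_iff) (auto intro!: borel_closed closed_hyperplane)
  then show ?thesis by (rule AE_I') auto
qed

text \<open>Pairing the cross product with a fixed \<open>w\<close> not parallel to \<open>u\<close>
  turns its zeros into a subset of a hyperplane, by the triple product identity.\<close>

lemma AE_lborel_cross_nonzero:
  fixes u v :: "real^3"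
  assumes u: "u \<noteq> 0" and c: "c \<noteq> 0"
  shows "AE z in lborel. cross3 u (c *\<^sub>R z + v) \<noteq> 0"
proof -
  obtain w :: "real^3" where w: "cross3 w u \<noteq> 0"
  proof -
    have "\<exists>w. cross3 w u \<noteq> 0"
    proof (rule ccontr)
      assume "\<nexists>w. cross3 w u \<noteq> 0"
      then have 0: "cross3 w u = 0" for w by blast
      have "u $ 1 = 0 \<and> u $ 2 = 0 \<and> u $ 3 = 0"
        using 0[of "axis 1 1"] 0[of "axis 2 1"] by (simp add: Finite_Cartesian_Product.vec_eq_iff[of "cross3 _ _"] forall_3 cross_components axis_def)
      then show False using u by (simp add: Finite_Cartesian_Product.vec_eq_iff forall_3)
    qed
    then show ?thesis using that by blast
  qed
  have eq: "w \<bullet> cross3 u z = cross3 w u \<bullet> z" for z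
    by (simp add: cross3_def inner_vec_def sum_3 algebra_simps)
  have "AE z in lborel. (c *\<^sub>R cross3 w u) \<bullet> z \<noteq> - (cross3 w u \<bullet> v)"
    using w c by (intro AE_lborel_hyperplane) simp
  then show ?thesis
  proof eventually_elim
    case (elim z)
    have "w \<bullet> cross3 u (c *\<^sub>R z + v) = c * (cross3 w u \<bullet> z) + cross3 w u \<bullet> v"
      by (simp add: eq inner_add_right)
    then show ?case using elim by auto
  qed
qed

text \<open>Cramer-type elimination decouples the points \<open>d i\<close> and \<open>d j\<close>:
  first \<open>d i\<close> makes one combination non-zero, then \<open>d j\<close> moves the other
  one off its line.\<close>

lemma AE_combinations_cross_nonzero:
  fixes A B :: "nat \<Rightarrow> real"
  assumes ij: "i < N" "j < N" and det: "A i * B j - A j * B i \<noteq> 0"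
  shows "AE d in PiM {..<N} (\<lambda>_. lborel). cross3 (\<Sum>t<N. A t *\<^sub>R d t) (\<Sum>t<N. B t *\<^sub>R d t :: real^3) \<noteq> 0"
proof -
  let ?M = "PiM {..<N} (\<lambda>_. lborel :: (real^3) measure)"
  define D where "D = A i * B j - A j * B i"
  \<comment> \<open>\<open>p\<close> has no entry at \<open>j\<close> and \<open>q\<close> none at
    \<open>i\<close>, and passing from \<open>A\<close>, \<open>B\<close> to \<open>p\<close>,
    \<open>q\<close> multiplies the cross product by the minor \<open>D\<close>.\<close>
  define p where "p t = B j * A t - A j * B t" for t
  define q where "q t = A i * B t - B i * A t" for t
  define F where "F c d = (\<Sum>t<N. c t *\<^sub>R d t :: real^3)" for c :: "nat \<Rightarrow> real" and d
  have upd: "F c (d(k := z)) = c k *\<^sub>R z + (\<Sum>t\<in>{..<N} - {k}. c t *\<^sub>R d t)" if "k < N" for c d k z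
    unfolding F_def using that by (subst sum.remove[of _ k]) auto
  have meas: "(\<lambda>d. F c d) \<in> borel_measurable ?M" for c
    unfolding F_def by measurable
  have p: "p i = D" "p j = 0" and q: "q i = 0" "q j = D"
    by (simp_all add: p_def q_def D_def mult.commute)
  have crossM: "(\<lambda>d. cross3 (F p d) (F q d)) \<in> borel_measurable ?M"
    by (intro borel_measurable_continuous_Pair[OF meas meas] continuous_on_cross continuous_intros)
  have 1: "AE d in ?M. F p d \<noteq> 0"
  proof (rule AE_PiM_coordinate[of _ i])
    show "{d \<in> space ?M. F p d \<noteq> 0} \<in> sets ?M" using meas by measurable
    fix d :: "nat \<Rightarrow> real^3"
    obtain e :: "real^3" where "e \<noteq> 0" by (metis zero_neq_one)
    then have "AE z in lborel. (D *\<^sub>R e) \<bullet> z \<noteq> - (e \<bullet> (\<Sum>t\<in>{..<N} - {i}. p t *\<^sub>R d t))"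
      using det by (intro AE_lborel_hyperplane) (simp add: D_def)
    then show "AE z in lborel. F p (d(i := z)) \<noteq> 0"
    proof eventually_elim
      case (elim z)
      then have "e \<bullet> F p (d(i := z)) \<noteq> 0"
        unfolding upd[OF ij(1)] p by (simp add: inner_add_right)
      then show ?case by auto
    qed
  qed (use ij in auto)
  \<comment> \<open>The alternative \<open>F p d = 0\<close> is added so that the statement holds
    for every choice of the other coordinates, as the sectionwise criterion demands; the previous
    fact removes it almost everywhere.\<close>
  have 2: "AE d in ?M. cross3 (F p d) (F q d) \<noteq> 0 \<or> F p d = 0"
  proof (rule AE_PiM_coordinate[of _ j])
    show "{d \<in> space ?M. cross3 (F p d) (F q d) \<noteq> 0 \<or> F p d = 0} \<in> sets ?M"
      using meas crossM by measurable
    fix d :: "nat \<Rightarrow> real^3"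
    define r where "r = (\<Sum>t\<in>{..<N} - {j}. p t *\<^sub>R d t)"
    have r: "F p (d(j := z)) = r" for z unfolding upd[OF ij(2)] p r_def by simp
    show "AE z in lborel. cross3 (F p (d(j := z))) (F q (d(j := z))) \<noteq> 0 \<or> F p (d(j := z)) = 0"
    proof (cases "r = 0")
      case False
      from AE_lborel_cross_nonzero[OF this, of D "\<Sum>t\<in>{..<N} - {j}. q t *\<^sub>R d t"] det
      show ?thesis unfolding r upd[OF ij(2), of q] q by (simp add: D_def False)
    qed (simp add: r)
  qed (use ij in auto)
  from 1 2 show ?thesis
  proof eventually_elim
    case (elim d)
    have Fpq: "F p d = B j *\<^sub>R F A d - A j *\<^sub>R F B d" "F q d = A i *\<^sub>R F B d - B i *\<^sub>R F A d"
      by (simp_all add: F_def p_def q_def scaleR_diff_left sum_subtractf scaleR_right.sum)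
    have "cross3 (F p d) (F q d) = D *\<^sub>R cross3 (F A d) (F B d)"
      unfolding Fpq Finite_Cartesian_Product.vec_eq_iff forall_3
      by (simp add: cross_components D_def) (simp add: algebra_simps)
    then show ?case using elim by (auto simp: F_def)
  qed
qed

section \<open>Partial derivatives and the geometry of the cells\<close>

lemma bounded_bilinear_cross3: "bounded_bilinear cross3"
  using bilinear_cross bilinear_conv_bounded_bilinear by blast

lemma partial_eq:
  assumes "(f has_derivative f') (at x)"
  shows "partial_u f x = f' (1, 0)" "partial_v f x = f' (0, 1)"
proof -
  interpret bounded_linear f' using assms by (rule has_derivative_bounded_linear)
  have "((\<lambda>t. (t, snd x)) has_derivative (\<lambda>t. (t, 0))) (at (fst x))"
    by (auto intro!: derivative_eq_intros)
  moreover have "(f has_derivative f') (at (fst x, snd x))" using assms by simp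
  ultimately have "((\<lambda>t. f (t, snd x)) has_derivative (\<lambda>t. f' (t, 0))) (at (fst x))"
    by (rule has_derivative_compose)
  moreover have "(\<lambda>t. f' (t, 0)) = (\<lambda>t. t *\<^sub>R f' (1, 0))" by (simp flip: scaleR add: fun_eq_iff)
  ultimately have "((\<lambda>t. f (t, snd x)) has_vector_derivative f' (1, 0)) (at (fst x))"
    by (simp add: has_vector_derivative_def)
  then show "partial_u f x = f' (1, 0)" unfolding partial_u_def by (rule vector_derivative_at)
  have "((\<lambda>t. (fst x, t)) has_derivative (\<lambda>t. (0, t))) (at (snd x))"
    by (auto intro!: derivative_eq_intros)
  moreover have "(f has_derivative f') (at (fst x, snd x))" using assms by simp
  ultimately have "((\<lambda>t. f (fst x, t)) has_derivative (\<lambda>t. f' (0, t))) (at (snd x))"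
    by (rule has_derivative_compose)
  moreover have "(\<lambda>t. f' (0, t)) = (\<lambda>t. t *\<^sub>R f' (0, 1))" by (simp flip: scaleR add: fun_eq_iff)
  ultimately have "((\<lambda>t. f (fst x, t)) has_vector_derivative f' (0, 1)) (at (snd x))"
    by (simp add: has_vector_derivative_def)
  then show "partial_v f x = f' (0, 1)" unfolding partial_v_def by (rule vector_derivative_at)
qed

text \<open>Outside \<open>C\<close> nothing is known about \<open>f\<close>, and \<open>y\<close>
  may lie on the boundary; a one-sided derivative along the segment towards \<open>p\<close> is
  still available.\<close>

lemma derivative_zero_on_constant_segment:
  fixes f :: "'a::real_normed_vector \<Rightarrow> 'b::real_normed_vector"
  assumes f: "(f has_derivative f') (at y)" and C: "convex C" "y \<in> C" "p \<in> C"
    and const: "\<And>x. x \<in> C \<Longrightarrow> f x = b"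
  shows "f' (p - y) = 0"
proof -
  interpret bounded_linear f' using f by (rule has_derivative_bounded_linear)
  have seg: "y + t *\<^sub>R (p - y) \<in> C" if "t \<in> {0..1}" for t
  proof -
    have "(1 - t) *\<^sub>R y + t *\<^sub>R p \<in> C" using C that by (intro convexD) auto
    then show ?thesis by (simp add: algebra_simps)
  qed
  have "((\<lambda>t. y + t *\<^sub>R (p - y)) has_derivative (\<lambda>t. t *\<^sub>R (p - y))) (at 0 within {0..1})"
    by (auto intro!: derivative_eq_intros)
  moreover have "(f has_derivative f') (at (y + 0 *\<^sub>R (p - y)))" using f by simp
  ultimately have "((\<lambda>t. f (y + t *\<^sub>R (p - y))) has_derivative (\<lambda>t. f' (t *\<^sub>R (p - y)))) (at 0 within {0..1})"
    by (rule has_derivative_compose)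
  then have "((\<lambda>t. f (y + t *\<^sub>R (p - y))) has_vector_derivative f' (p - y)) (at 0 within {0..1})"
    by (simp add: has_vector_derivative_def scaleR)
  moreover have "((\<lambda>t. f (y + t *\<^sub>R (p - y))) has_vector_derivative 0) (at 0 within {0..1})"
  proof (rule has_vector_derivative_transform[where f = "\<lambda>_. b"])
    show "((\<lambda>_. b) has_vector_derivative 0) (at 0 within {0..1::real})" by simp
  qed (use const seg in auto)
  moreover have "at (0::real) within {0..1} \<noteq> bot" by (simp add: at_within_Icc_at_right)
  ultimately show ?thesis by (rule vector_derivative_unique_within[rotated])
qed

lemma cell_triangular_halfspaces:
  "cell Triangular k j = (let h = 2 / 2 ^ k in
     if j = 0 then {x. (-1, 0) \<bullet> x \<le> - h} \<inter> {x. (0, -1) \<bullet> x \<le> 0} \<inter> {x. (1, 1) \<bullet> x \<le> 2 * h}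
     else if j = 1 then {x. (1, 0) \<bullet> x \<le> h} \<inter> {x. (0, 1) \<bullet> x \<le> h} \<inter> {x. (-1, -1) \<bullet> x \<le> - h}
     else {x. (-1, 0) \<bullet> x \<le> 0} \<inter> {x. (0, -1) \<bullet> x \<le> - h} \<inter> {x. (1, 1) \<bullet> x \<le> 2 * h})"
  by (auto simp: Let_def inner_prod_def)

lemma convex_cell: "convex (cell M k j)"
proof (cases M)
  case Quadrilateral
  then show ?thesis by (auto simp: Let_def intro!: convex_Times)
next
  case Triangular
  then show ?thesis unfolding Triangular cell_triangular_halfspaces Let_def
    by (auto intro!: convex_Int convex_halfspace_le)
qed

lemma compact_cell: "compact (cell M k j)"
proof (cases M)
  case Quadrilateral
  then show ?thesis by (auto simp: Let_def intro!: compact_Times)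
next
  case Triangular
  define h :: real where "h = 2 / 2 ^ k"
  have "closed (cell M k j)" unfolding Triangular cell_triangular_halfspaces Let_def
    by (auto intro!: closed_Int closed_halfspace_le)
  moreover have "cell M k j \<subseteq> {0..2 * h} \<times> {0..2 * h}"
    unfolding Triangular cell.simps Let_def h_def[symmetric] by (auto simp: h_def split: if_splits)
  moreover have "compact ({0..2 * h} \<times> {0..2 * h})" by (intro compact_Times) auto
  ultimately show ?thesis using compact_Int_closed by (metis Int_absorb1)
qed

text \<open>Every cell has a corner with edges parallel to both axes. The middle triangular cell is
  turned around, with this corner at \<open>(1, 1)\<close> and edges in the negative
  directions.\<close>

lemma cell_corners:
  assumes "j < 3"
  obtains q r where "q \<in> cell M 1 j" "q + (r, 0) \<in> cell M 1 j" "q + (0, r) \<in> cell M 1 j" "r \<noteq> 0"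
proof (cases M)
  case Quadrilateral
  have "(if j = 0 then (1, 0) else if j = 1 then (1, 1) else (0, 1)) \<in> cell M 1 j"
    "(if j = 0 then (1, 0) else if j = 1 then (1, 1) else (0, 1)) + (1, 0) \<in> cell M 1 j"
    "(if j = 0 then (1, 0) else if j = 1 then (1, 1) else (0, 1)) + (0, 1) \<in> cell M 1 j"
    by (auto simp: Quadrilateral Let_def)
  then show ?thesis by (rule that) simp
next
  case Triangular
  show ?thesis
  proof (cases "j = 1")
    case True
    show ?thesis by (rule that[of "(1, 1)" "-1"]) (auto simp: Triangular True)
  next
    case False
    show ?thesis by (rule that[of "if j = 0 then (1, 0) else (0, 1)" 1]) (use False in \<open>auto simp: Triangular\<close>)
  qed
qed

text \<open>The derivative vanishes in the directions from \<open>y\<close> to the three corners,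
  hence on their differences, which are multiples of the axis directions.\<close>

lemma derivative_zero_on_constant_cell:
  fixes f :: "real \<times> real \<Rightarrow> 'b::real_normed_vector"
  assumes f: "(f has_derivative f') (at y)" and j: "j < 3" and y: "y \<in> cell M 1 j"
    and const: "\<And>x. x \<in> cell M 1 j \<Longrightarrow> f x = b"
  shows "f' (1, 0) = 0" "f' (0, 1) = 0"
proof -
  interpret bounded_linear f' using f by (rule has_derivative_bounded_linear)
  obtain q r where q: "q \<in> cell M 1 j" "q + (r, 0) \<in> cell M 1 j" "q + (0, r) \<in> cell M 1 j" "r \<noteq> 0"
    using cell_corners[OF j] by blast
  have z: "f' (p - y) = 0" if "p \<in> cell M 1 j" for p
    by (rule derivative_zero_on_constant_segment[OF f convex_cell y that const])
  have "f' (r, 0) = 0" "f' (0, r) = 0"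
    using z[OF q(2)] z[OF q(3)] z[OF q(1)] diff[of "q + (r, 0) - y" "q - y"] diff[of "q + (0, r) - y" "q - y"] by simp_all
  moreover have "f' (r, 0) = r *\<^sub>R f' (1, 0)" "f' (0, r) = r *\<^sub>R f' (0, 1)" by (simp_all flip: scaleR)
  ultimately show "f' (1, 0) = 0" "f' (0, 1) = 0" using q(4) by simp_all
qed

lemma cell_scale_iff: "(2 / 2 ^ k) *\<^sub>R y \<in> cell M k j \<longleftrightarrow> y \<in> cell M 1 j"
proof -
  define h :: real where "h = 2 / 2 ^ k"
  have h: "0 < h" by (simp add: h_def)
  have c: "h \<le> h * a \<longleftrightarrow> 1 \<le> a" "h * a \<le> 2 * h \<longleftrightarrow> a \<le> 2" "0 \<le> h * a \<longleftrightarrow> 0 \<le> a" "h * a \<le> h \<longleftrightarrow> a \<le> 1"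
    "h * a + h * b \<le> 2 * h \<longleftrightarrow> a + b \<le> 2" "h \<le> h * a + h * b \<longleftrightarrow> 1 \<le> a + b" for a b
    using mult_le_cancel_left_pos[OF h, of 1 a] mult_le_cancel_left_pos[OF h, of a 2] mult_le_cancel_left_pos[OF h, of 0 a]
      mult_le_cancel_left_pos[OF h, of a 1] mult_le_cancel_left_pos[OF h, of "a + b" 2] mult_le_cancel_left_pos[OF h, of 1 "a + b"]
    by (simp_all add: distrib_left mult.commute)
  show ?thesis
    by (cases M; cases y) (simp_all only: cell.simps Let_def h_def[symmetric] scaleR_Pair real_scaleR_def, simp_all add: c)
qed

lemma cell_rescale:
  assumes "x \<in> cell M k j"
  shows "(2 ^ k / 2) *\<^sub>R x \<in> cell M 1 j"
  using assms cell_scale_iff[of k "(2 ^ k / 2) *\<^sub>R x"] by simp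

lemma ring_domain_nonempty:
  assumes "n \<ge> 1"
  shows "(0, 0, (2 / 2 ^ k, 0)) \<in> ring_domain M n k"
  using assms by (cases M) (auto simp: ring_domain_def Let_def divide_le_cancel)

text \<open>Normalisation is Lipschitz away from 0. With \<open>sgn 0 = 0\<close> the bound holds
  for \<open>p = 0\<close> too.\<close>

lemma norm_sgn_diff_le:
  fixes p q :: "'a::real_normed_vector"
  assumes "q \<noteq> 0"
  shows "norm (sgn p - sgn q) \<le> 2 * norm (p - q) / norm q"
proof (cases "p = 0")
  case True
  then show ?thesis using assms by (simp add: norm_sgn)
next
  case False
  have "sgn p - sgn q = (1 / norm q) *\<^sub>R (p - q) + (1 / norm p - 1 / norm q) *\<^sub>R p"
    using assms False by (simp add: sgn_div_norm algebra_simps divide_inverse)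
  then have "norm (sgn p - sgn q) \<le> norm (p - q) / norm q + \<bar>1 / norm p - 1 / norm q\<bar> * norm p"
    using norm_triangle_ineq[of "(1 / norm q) *\<^sub>R (p - q)" "(1 / norm p - 1 / norm q) *\<^sub>R p"] by simp
  also have "\<bar>1 / norm p - 1 / norm q\<bar> * norm p = \<bar>norm q - norm p\<bar> / norm q"
  proof -
    have "1 / norm p - 1 / norm q = (norm q - norm p) / (norm p * norm q)" using assms False by (simp add: field_simps)
    then show ?thesis using False by (simp add: abs_mult)
  qed
  also have "\<dots> \<le> norm (p - q) / norm q"
    using norm_triangle_ineq3[of q p] by (intro divide_right_mono) (auto simp: norm_minus_commute)
  finally show ?thesis by simp
qed

text \<open>The vectors \<open>v k i\<close> do not depend on the point \<open>p\<close> and there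
  are finitely many of them, so their plain convergence already gives a uniform limit.\<close>

lemma uniform_limit_combination:
  fixes v :: "nat \<Rightarrow> nat \<Rightarrow> 'b::real_normed_vector"
  assumes u: "\<And>k i p. i < N \<Longrightarrow> p \<in> X \<Longrightarrow> \<bar>u k i p - ubar i p\<bar> \<le> \<epsilon> k"
    and K: "\<And>i p. i < N \<Longrightarrow> p \<in> X \<Longrightarrow> \<bar>ubar i p\<bar> \<le> K"
    and eps: "\<epsilon> \<longlonglongrightarrow> 0" and v: "\<And>i. i < N \<Longrightarrow> (\<lambda>k. v k i) \<longlonglongrightarrow> vbar i"
  shows "uniform_limit X (\<lambda>k p. \<Sum>i<N. u k i p *\<^sub>R v k i) (\<lambda>p. \<Sum>i<N. ubar i p *\<^sub>R vbar i) sequentially"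
proof (rule uniform_limitI)
  fix e :: real assume "0 < e"
  define \<eta> where "\<eta> k = (\<Sum>i<N. \<epsilon> k * norm (v k i) + K * norm (v k i - vbar i))" for k
  have "(\<lambda>k. \<epsilon> k * norm (v k i) + K * norm (v k i - vbar i)) \<longlonglongrightarrow> 0 * norm (vbar i) + K * norm (vbar i - vbar i)" if "i < N" for i
    using v[OF that] eps by (intro tendsto_intros)
  then have "\<eta> \<longlonglongrightarrow> (\<Sum>i<N. 0)" unfolding \<eta>_def by (intro tendsto_sum) simp
  then have "\<forall>\<^sub>F k in sequentially. \<eta> k < e" using \<open>0 < e\<close> by (intro order_tendstoD(2)) auto
  then show "\<forall>\<^sub>F k in sequentially. \<forall>p\<in>X. dist (\<Sum>i<N. u k i p *\<^sub>R v k i) (\<Sum>i<N. ubar i p *\<^sub>R vbar i) < e"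
  proof (rule eventually_mono, intro ballI)
    fix k p assume k: "\<eta> k < e" and p: "p \<in> X"
    have "norm (u k i p *\<^sub>R v k i - ubar i p *\<^sub>R vbar i) \<le> \<epsilon> k * norm (v k i) + K * norm (v k i - vbar i)" if "i < N" for i
    proof -
      have "u k i p *\<^sub>R v k i - ubar i p *\<^sub>R vbar i = (u k i p - ubar i p) *\<^sub>R v k i + ubar i p *\<^sub>R (v k i - vbar i)"
        by (simp add: algebra_simps)
      also have "norm \<dots> \<le> \<bar>u k i p - ubar i p\<bar> * norm (v k i) + \<bar>ubar i p\<bar> * norm (v k i - vbar i)"
        using norm_triangle_ineq[of "(u k i p - ubar i p) *\<^sub>R v k i" "ubar i p *\<^sub>R (v k i - vbar i)"] by simp
      also have "\<dots> \<le> \<epsilon> k * norm (v k i) + K * norm (v k i - vbar i)"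
        using u[OF that p] K[OF that p] by (intro add_mono mult_right_mono) auto
      finally show ?thesis .
    qed
    then have "norm (\<Sum>i<N. u k i p *\<^sub>R v k i - ubar i p *\<^sub>R vbar i) \<le> \<eta> k"
      unfolding \<eta>_def by (intro order_trans[OF norm_sum] sum_mono) auto
    then show "dist (\<Sum>i<N. u k i p *\<^sub>R v k i) (\<Sum>i<N. ubar i p *\<^sub>R vbar i) < e"
      using k by (simp add: dist_norm sum_subtractf)
  qed
qed

text \<open>The triple \<open>(s, j, y)\<close> stands for a point of the ring of level \<open>k\<close> rescaled to level \<open>1\<close>:
  \<open>y = 2\<^bsup>k-1\<^esup> x\<close>.\<close>

definition placed :: "layout \<Rightarrow> (real \<times> real \<Rightarrow> 'a::zero) \<Rightarrow> nat \<Rightarrow> nat \<times> nat \<times> real \<times> real \<Rightarrow> 'a" where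
  "placed L \<psi> i = (\<lambda>(s, j, y). case L s j i of None \<Rightarrow> 0 | Some \<alpha> \<Rightarrow> \<psi> (y - grid_point 0 \<alpha>))"

section \<open>Rings in rescaled coordinates and limits of their normals\<close>

lemma Phi_eq_placed: "Phi L c k s j i x = placed L (basic_limit_function c k) i (s, j, (2 ^ k / 2) *\<^sub>R x)"
  by (simp add: Phi_def placed_def lattice_copy_def split: option.split)

lemma Phi_has_derivative:
  assumes "\<And>x. (basic_limit_function c k has_derivative blinfun_apply (\<phi>' x)) (at x)"
  shows "(Phi L c k s j i has_derivative
    (\<lambda>v. (2 ^ k / 2) * blinfun_apply (placed L \<phi>' i (s, j, (2 ^ k / 2) *\<^sub>R x)) v)) (at x)"
proof (cases "L s j i")
  case None
  then have "Phi L c k s j i = (\<lambda>_. 0)" by (simp add: Phi_def fun_eq_iff)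
  then show ?thesis using None by (simp add: placed_def)
next
  case (Some \<alpha>)
  have "((\<lambda>x. (2 ^ k / 2) *\<^sub>R x - grid_point 0 \<alpha>) has_derivative (\<lambda>v. (2 ^ k / 2) *\<^sub>R v)) (at x)"
    by (auto intro!: derivative_eq_intros)
  from has_derivative_compose[OF this assms]
  have "((\<lambda>x. basic_limit_function c k ((2 ^ k / 2) *\<^sub>R x - grid_point 0 \<alpha>)) has_derivative
      (\<lambda>v. blinfun_apply (\<phi>' ((2 ^ k / 2) *\<^sub>R x - grid_point 0 \<alpha>)) ((2 ^ k / 2) *\<^sub>R v))) (at x)" .
  moreover have "Phi L c k s j i = (\<lambda>x. basic_limit_function c k ((2 ^ k / 2) *\<^sub>R x - grid_point 0 \<alpha>))"
    using Some by (simp add: Phi_def lattice_copy_def fun_eq_iff)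
  ultimately show ?thesis using Some by (simp add: placed_def blinfun.scaleR_right)
qed

lemma ring_patch_partials:
  assumes "\<And>x. (basic_limit_function c k has_derivative blinfun_apply (\<phi>' x)) (at x)"
  shows "partial_u (ring_patch N L c S d k s j) x =
      (2 ^ k / 2) *\<^sub>R (\<Sum>i<N. blinfun_apply (placed L \<phi>' i (s, j, (2 ^ k / 2) *\<^sub>R x)) (1, 0) *\<^sub>R control_points N S d k i)"
    and "partial_v (ring_patch N L c S d k s j) x =
      (2 ^ k / 2) *\<^sub>R (\<Sum>i<N. blinfun_apply (placed L \<phi>' i (s, j, (2 ^ k / 2) *\<^sub>R x)) (0, 1) *\<^sub>R control_points N S d k i)"
proof -
  have "(ring_patch N L c S d k s j has_derivative
     (\<lambda>v. \<Sum>i<N. ((2 ^ k / 2) * blinfun_apply (placed L \<phi>' i (s, j, (2 ^ k / 2) *\<^sub>R x)) v) *\<^sub>R control_points N S d k i)) (at x)"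
    unfolding ring_patch_def[abs_def]
    by (intro has_derivative_sum has_derivative_scaleR_left Phi_has_derivative assms(1))
  from partial_eq[OF this] show
    "partial_u (ring_patch N L c S d k s j) x =
      (2 ^ k / 2) *\<^sub>R (\<Sum>i<N. blinfun_apply (placed L \<phi>' i (s, j, (2 ^ k / 2) *\<^sub>R x)) (1, 0) *\<^sub>R control_points N S d k i)"
    "partial_v (ring_patch N L c S d k s j) x =
      (2 ^ k / 2) *\<^sub>R (\<Sum>i<N. blinfun_apply (placed L \<phi>' i (s, j, (2 ^ k / 2) *\<^sub>R x)) (0, 1) *\<^sub>R control_points N S d k i)"
    by (simp_all add: scaleR_right.sum)
qed

lemma planar_component_partials:
  assumes "\<And>x. (basic_limit_function c 1 has_derivative blinfun_apply (\<phi>' x)) (at x)"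
  shows "partial_u (planar_component N L c y s j) x =
      (\<Sum>i<N. blinfun_apply (placed L \<phi>' i (s, j, x)) (1, 0) * vec_index y i)"
    and "partial_v (planar_component N L c y s j) x =
      (\<Sum>i<N. blinfun_apply (placed L \<phi>' i (s, j, x)) (0, 1) * vec_index y i)"
proof -
  have "(planar_component N L c y s j has_derivative
     (\<lambda>v. \<Sum>i<N. ((2 ^ 1 / 2) * blinfun_apply (placed L \<phi>' i (s, j, (2 ^ 1 / 2) *\<^sub>R x)) v) * vec_index y i)) (at x)"
    unfolding planar_component_def[abs_def]
    by (intro has_derivative_sum has_derivative_mult_left Phi_has_derivative assms(1))
  from partial_eq[OF this] show
    "partial_u (planar_component N L c y s j) x =
      (\<Sum>i<N. blinfun_apply (placed L \<phi>' i (s, j, x)) (1, 0) * vec_index y i)"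
    "partial_v (planar_component N L c y s j) x =
      (\<Sum>i<N. blinfun_apply (placed L \<phi>' i (s, j, x)) (0, 1) * vec_index y i)"
    by simp_all
qed

lemma sum_placed_derivative_zero:
  assumes deriv: "\<And>x. (basic_limit_function c k has_derivative blinfun_apply (\<phi>' x)) (at x)"
    and const: "\<And>x. x \<in> cell M k j \<Longrightarrow> (\<Sum>i<N. Phi L c k s j i x) = b"
    and j: "j < 3" and y: "y \<in> cell M 1 j"
  shows "(\<Sum>i<N. blinfun_apply (placed L \<phi>' i (s, j, y)) (1, 0)) = 0"
    "(\<Sum>i<N. blinfun_apply (placed L \<phi>' i (s, j, y)) (0, 1)) = 0"
proof -
  define x where "x = (2 / 2 ^ k :: real) *\<^sub>R y"
  have "((\<lambda>y. \<Sum>i<N. Phi L c k s j i ((2 / 2 ^ k) *\<^sub>R y)) has_derivative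
     (\<lambda>v. \<Sum>i<N. (2 ^ k / 2) * blinfun_apply (placed L \<phi>' i (s, j, (2 ^ k / 2) *\<^sub>R x)) ((2 / 2 ^ k) *\<^sub>R v))) (at y)"
  proof (intro has_derivative_sum)
    fix i
    have "((\<lambda>y :: real \<times> real. (2 / 2 ^ k :: real) *\<^sub>R y) has_derivative (\<lambda>v. (2 / 2 ^ k) *\<^sub>R v)) (at y)"
      by (auto intro!: derivative_eq_intros)
    from has_derivative_compose[OF this Phi_has_derivative[OF deriv]]
    show "((\<lambda>y. Phi L c k s j i ((2 / 2 ^ k) *\<^sub>R y)) has_derivative
       (\<lambda>v. (2 ^ k / 2) * blinfun_apply (placed L \<phi>' i (s, j, (2 ^ k / 2) *\<^sub>R x)) ((2 / 2 ^ k) *\<^sub>R v))) (at y)"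
      unfolding x_def .
  qed
  from derivative_zero_on_constant_cell[OF this j y, of b] const
  show "(\<Sum>i<N. blinfun_apply (placed L \<phi>' i (s, j, y)) (1, 0)) = 0"
    "(\<Sum>i<N. blinfun_apply (placed L \<phi>' i (s, j, y)) (0, 1)) = 0"
    by (simp_all add: cell_scale_iff x_def blinfun.scaleR_right del: scaleR_Pair)
qed

lemma placed_close:
  assumes "\<And>x. norm (\<psi> x - \<psi>' x) \<le> \<epsilon>"
  shows "norm (placed L \<psi> i p - placed L \<psi>' i p) \<le> (\<epsilon> :: real)"
proof -
  have "0 \<le> \<epsilon>" using assms norm_ge_zero order_trans by blast
  then show ?thesis using assms by (auto simp: placed_def split: prod.split option.split)
qed

lemma placed_bound:
  assumes "\<And>x. norm (\<psi> x) \<le> K"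
  shows "norm (placed L \<psi> i p) \<le> (K :: real)"
proof -
  have "0 \<le> K" using assms norm_ge_zero order_trans by blast
  then show ?thesis using assms by (auto simp: placed_def split: prod.split option.split)
qed

lemma continuous_on_placed:
  assumes "continuous_on UNIV \<psi>"
  shows "continuous_on A (\<lambda>y. placed L \<psi> i (s, j, y))"
proof (cases "L s j i")
  case (Some \<alpha>)
  have "continuous_on A (\<lambda>y. \<psi> (y - grid_point 0 \<alpha>))"
    by (rule continuous_on_compose2[OF assms]) (auto intro!: continuous_intros)
  then show ?thesis using Some by (simp add: placed_def)
qed (simp add: placed_def)

text \<open>The limiting cross products all lie on the line of \<open>w\<close>, on one side of 0
  and bounded away from it, so they have one common direction and normalisation preserves uniform
  convergence.\<close>

lemma uniform_unit_normals:
  fixes U V :: "nat \<Rightarrow> 'p \<Rightarrow> real^3"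
  assumes UV: "uniform_limit X U U' sequentially" "uniform_limit X V V' sequentially"
    and bdd: "bounded (U' ` X)" "bounded (V' ` X)"
    and cross: "\<And>p. p \<in> X \<Longrightarrow> cross3 (U' p) (V' p) = D p *\<^sub>R w"
    and w: "w \<noteq> 0" and \<delta>: "0 < \<delta>" "\<And>p. p \<in> X \<Longrightarrow> \<delta> \<le> \<bar>D p\<bar>" and e: "\<And>p. p \<in> X \<Longrightarrow> sgn (D p) = e"
    and \<epsilon>: "0 < \<epsilon>"
  shows "\<forall>\<^sub>F m in sequentially. \<forall>p\<in>X. cross3 (U m p) (V m p) \<noteq> 0 \<and> norm (sgn (cross3 (U m p) (V m p)) - e *\<^sub>R sgn w) < \<epsilon>"
proof -
  define b where "b = \<delta> * norm w"
  have b: "0 < b" using w \<delta> by (simp add: b_def)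
  have "uniform_limit X (\<lambda>m p. cross3 (U m p) (V m p)) (\<lambda>p. cross3 (U' p) (V' p)) sequentially"
    by (rule bounded_bilinear.bounded_uniform_limit[OF bounded_bilinear_cross3 UV bdd(2,1)])
  \<comment> \<open>\<open>b\<close> bounds the limiting cross products from below: staying within
    \<open>b\<close> keeps the approximations non-zero, and \<open>\<epsilon> * b / 2\<close> is the
    tolerance that \<open>norm_sgn_diff_le\<close> turns into \<open>\<epsilon>\<close>.\<close>
  from uniform_limitD[OF this, of "min b (\<epsilon> * b / 2)"]
  have "\<forall>\<^sub>F m in sequentially. \<forall>p\<in>X. dist (cross3 (U m p) (V m p)) (cross3 (U' p) (V' p)) < min b (\<epsilon> * b / 2)"
    using b \<epsilon> by simp
  then show ?thesis
  proof (rule eventually_mono, intro ballI)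
    fix m p assume *: "\<forall>p\<in>X. dist (cross3 (U m p) (V m p)) (cross3 (U' p) (V' p)) < min b (\<epsilon> * b / 2)" and p: "p \<in> X"
    define q where "q = D p *\<^sub>R w"
    define r where "r = cross3 (U m p) (V m p)"
    have d: "norm (r - q) < b" "norm (r - q) < \<epsilon> * b / 2"
      using * p cross[OF p] by (auto simp: q_def r_def dist_norm)
    have bq: "b \<le> norm q" using \<delta>(2)[OF p] by (simp add: b_def q_def mult_right_mono)
    then have q0: "q \<noteq> 0" using b by auto
    have "r \<noteq> 0" using d(1) bq by auto
    moreover have "norm (sgn r - sgn q) < \<epsilon>"
    proof -
      have "norm (sgn r - sgn q) \<le> 2 * norm (r - q) / norm q" by (rule norm_sgn_diff_le[OF q0])
      also have "\<dots> \<le> 2 * norm (r - q) / b" using bq b q0 by (intro divide_left_mono mult_pos_pos) auto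
      also have "\<dots> < \<epsilon>" using d(2) b by (simp add: field_simps)
      finally show ?thesis .
    qed
    moreover have "sgn q = e *\<^sub>R sgn w" using e[OF p] by (simp add: q_def sgn_scaleR)
    ultimately show "cross3 (U m p) (V m p) \<noteq> 0 \<and> norm (sgn (cross3 (U m p) (V m p)) - e *\<^sub>R sgn w) < \<epsilon>"
      by (simp add: r_def)
  qed
qed

text \<open>Compactness of each of the finitely many closed cells.\<close>

lemma ring_domain_lower_bound:
  fixes D :: "nat \<Rightarrow> nat \<Rightarrow> real \<times> real \<Rightarrow> real"
  assumes cont: "\<And>s j. continuous_on UNIV (D s j)"
    and nz: "\<And>s j x. (s, j, x) \<in> ring_domain M n 1 \<Longrightarrow> D s j x \<noteq> 0"
  obtains \<delta> where "0 < \<delta>" "\<And>s j x. (s, j, x) \<in> ring_domain M n 1 \<Longrightarrow> \<delta> \<le> \<bar>D s j x\<bar>"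
proof -
  have "\<exists>\<delta>>0. \<forall>x\<in>cell M 1 j. \<delta> \<le> \<bar>D s j x\<bar>" if "s < n" "j < 3" for s j
  proof -
    have "cell M 1 j \<noteq> {}" using cell_corners[OF that(2), of M] by blast
    moreover have "continuous_on (cell M 1 j) (\<lambda>x. \<bar>D s j x\<bar>)"
      using continuous_on_subset[OF cont] by (intro continuous_intros) auto
    ultimately obtain x where x: "x \<in> cell M 1 j" "\<And>y. y \<in> cell M 1 j \<Longrightarrow> \<bar>D s j x\<bar> \<le> \<bar>D s j y\<bar>"
      using continuous_attains_inf[OF compact_cell] by blast
    have "D s j x \<noteq> 0" using nz[of s j x] x(1) that by (simp add: ring_domain_def)
    then show ?thesis using x(2) by (intro exI[of _ "\<bar>D s j x\<bar>"]) auto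
  qed
  then obtain \<delta> where \<delta>: "\<And>s j. s < n \<Longrightarrow> j < 3 \<Longrightarrow> 0 < \<delta> s j \<and> (\<forall>x\<in>cell M 1 j. \<delta> s j \<le> \<bar>D s j x\<bar>)"
    by metis
  \<comment> \<open>The inserted 1 keeps the minimum meaningful when there are no sectors.\<close>
  define \<delta>0 where "\<delta>0 = Min (insert 1 ((\<lambda>(s, j). \<delta> s j) ` ({..<n} \<times> {..<3})))"
  have "0 < \<delta>0" unfolding \<delta>0_def using \<delta> by (subst Min_gr_iff) auto
  moreover have "\<delta>0 \<le> \<bar>D s j x\<bar>" if "(s, j, x) \<in> ring_domain M n 1" for s j x
  proof -
    have sj: "s < n" "j < 3" "x \<in> cell M 1 j" using that by (auto simp: ring_domain_def)
    then have "\<delta>0 \<le> \<delta> s j" unfolding \<delta>0_def by (intro Min_le) (auto intro!: rev_image_eqI[of "(s, j)"])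
    then show ?thesis using \<delta>[OF sj(1,2)] sj(3) by force
  qed
  ultimately show ?thesis by (rule that)
qed

theorem theorem4p2:
  fixes M :: mesh and E :: irregularity and n p N P :: nat and L :: layout
    and c :: "nat \<Rightarrow> laurent2" and cbar :: laurent2
    and S T :: "nat \<Rightarrow> real Matrix.mat" and Sbar Tbar :: "real Matrix.mat"
    and lam1 C \<sigma> :: real and \<alpha> :: "nat \<Rightarrow> real" and y0 y1 :: "real Matrix.vec"
  assumes n: "n \<ge> 1"
    and N: "N = local_dim E n p"
    and layout: "valid_layout n N P L"
      "\<And>k. k \<ge> 1 \<Longrightarrow> covers_supports M n L k (basic_limit_function c k)"
      "covers_supports M n L 1 (basic_limit_function (\<lambda>_. cbar) 1)"
    and support: "same_bounded_support c"
    and rot_sym: "\<And>k. k \<ge> 1 \<Longrightarrow> local_matrices E n p (T k) (S k)"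
      "local_matrices E n p Tbar Sbar"
    and nonsingular: "nonsingular_scheme c T"
    and sum_Phi: "\<And>k s j x. k \<ge> 1 \<Longrightarrow> (s, j, x) \<in> ring_domain M n (k + 1) \<Longrightarrow>
      (\<Sum>i<N. Phi L c (k + 1) s j i x) = \<alpha> (k + 1)"
    and standard: "standard_matrix Sbar lam1"
    and effective: "no_ineffective_eigenvectors M n N L (\<lambda>_. cbar) Sbar"
    and i: "C1_convergent_regular (\<lambda>_. cbar)"
      "(1 + z1) * (1 + z2) dvd cbar"
      "eigenvector Sbar y0 lam1" "eigenvector Sbar y1 lam1"
      "\<And>a b :: real. a \<cdot>\<^sub>v y0 + b \<cdot>\<^sub>v y1 = 0\<^sub>v N \<Longrightarrow> a = 0 \<and> b = 0"
      "regular_characteristic_map M n N L (\<lambda>_. cbar) y0 y1"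
    and ii: "\<And>k. k \<ge> 1 \<Longrightarrow> (1 + z1) * (1 + z2) dvd c k"
    and iii: "summable (\<lambda>k. 2 ^ Suc k * subdivision_norm (c (Suc k) - cbar))"
    and iv: "C > 0" "\<sigma> > 1 / lam1"
      "\<And>k. k \<ge> 1 \<Longrightarrow> matrix_norm_inf (S k - Sbar) \<le> C / \<sigma> ^ k"
  shows "C1_convergent_regular c \<and> convergent_irregular M n N L c S \<and>
         normal_continuous M n N L c S"
proof -
  define X where "X = ring_domain M n 1"
  define \<phi> where "\<phi> = basic_limit_function (\<lambda>_. cbar) 1"
  have nonsing: "\<And>f. bounded (range f) \<Longrightarrow> has_limit_function c 1 f (\<lambda>x. 0) \<longleftrightarrow> f = (\<lambda>\<alpha>. 0)"
    and inv: "\<And>k. k \<ge> 1 \<Longrightarrow> invertible_mat (T k)"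
    using nonsingular by (auto simp: nonsingular_scheme_def)
  note regular = regular_convergence[OF i(1) iii nonsing]
  obtain \<phi>' \<phi>k' \<epsilon> K where "continuous_on UNIV \<phi>'"
    "\<forall>x. (\<phi> has_derivative blinfun_apply (\<phi>' x)) (at x)"
    "\<forall>x. \<bar>\<phi> x\<bar> \<le> K \<and> norm (\<phi>' x) \<le> K"
    "\<forall>k\<ge>1. \<forall>x. (basic_limit_function c k has_derivative blinfun_apply (\<phi>k' k x)) (at x) \<and>
         \<bar>basic_limit_function c k x - \<phi> x\<bar> \<le> \<epsilon> k \<and> norm (\<phi>k' k x - \<phi>' x) \<le> \<epsilon> k"
    and \<epsilon>: "\<epsilon> \<longlonglongrightarrow> 0"
    using regular(2)[folded \<phi>_def] by blast
  then have \<phi>': "continuous_on UNIV \<phi>'" "\<And>x. (\<phi> has_derivative blinfun_apply (\<phi>' x)) (at x)"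
    and K: "\<And>x. norm (\<phi> x) \<le> K" "\<And>x. norm (\<phi>' x) \<le> K"
    and \<phi>k': "\<And>k x. k \<ge> 1 \<Longrightarrow> (basic_limit_function c k has_derivative blinfun_apply (\<phi>k' k x)) (at x)"
    and close: "\<And>k x. k \<ge> 1 \<Longrightarrow> norm (basic_limit_function c k x - \<phi> x) \<le> \<epsilon> k"
      "\<And>k x. k \<ge> 1 \<Longrightarrow> norm (\<phi>k' k x - \<phi>' x) \<le> \<epsilon> k"
    unfolding real_norm_def by blast+
  have placed_phi: "norm (placed L (basic_limit_function c k) i p - placed L \<phi> i p) \<le> \<epsilon> k"
    and placed_phi': "norm (placed L (\<phi>k' k) i p - placed L \<phi>' i p) \<le> \<epsilon> k" if "k \<ge> 1" for k i p
    by (rule placed_close, rule close[OF that])+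
  have placed_K: "norm (placed L \<phi> i p) \<le> K" and placed_K': "norm (placed L \<phi>' i p) \<le> K" for i p
    by (rule placed_bound, rule K)+
  \<comment> \<open>The constant sum of \<open>\<Phi>\<close> is assumed for levels
    \<open>k + 1\<close> with \<open>k\<close> at least 1, so the levels are parametrised as
    \<open>Suc (Suc m)\<close> from here on.\<close>
  have shift: "eventually P sequentially" if "\<forall>\<^sub>F m in sequentially. P (Suc (Suc m))" for P
    using that eventually_sequentially_seg[of P 2] by simp
  have \<epsilon>2: "(\<lambda>m. \<epsilon> (Suc (Suc m))) \<longlonglongrightarrow> 0"
    using LIMSEQ_ignore_initial_segment[OF \<epsilon>, of 2] by simp
  obtain A B where AB: "\<exists>i<N. \<exists>j<N. A i * B j - A j * B i \<noteq> 0"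
    and pts: "\<And>d. \<exists>l. \<forall>i<N. (\<lambda>k. control_points N S d k i) \<longlonglongrightarrow> l"
    and asym: "\<And>d. \<exists>q. \<forall>i<N. (\<lambda>k. (control_points N S d (Suc k) i - q k) /\<^sub>R lam1 ^ k) \<longlonglongrightarrow>
        vec_index y0 i *\<^sub>R (\<Sum>t<N. A t *\<^sub>R d t) + vec_index y1 i *\<^sub>R (\<Sum>t<N. B t *\<^sub>R d t)"
    using control_points_asymptotics[where S = S and T = T, OF n N rot_sym(1) inv rot_sym(2) standard i(3,4,5) iv] by blast
  have lam: "0 < lam1" using standard by (simp add: standard_matrix_def)
  have in_X: "(s, j, (2 ^ k / 2) *\<^sub>R x) \<in> X" if "(s, j, x) \<in> ring_domain M n k" for s j k x
    using that cell_rescale[of x M k j] by (auto simp: X_def ring_domain_def simp del: scaleR_Pair)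
  have p0: "(0, 0, (1, 0)) \<in> X" using ring_domain_nonempty[OF n, of 1 M] by (simp add: X_def)
  have const: "(\<Sum>i<N. Phi L c (Suc (Suc m)) s j i x) = \<alpha> (Suc (Suc m))"
    if "s < n" "j < 3" "x \<in> cell M (Suc (Suc m)) j" for m s j x
    using sum_Phi[of "Suc m" s j x] that by (simp add: ring_domain_def)

  \<comment> \<open>Convergence in the irregular region\<close>
  have irregular: "convergent_irregular M n N L c S"
    unfolding convergent_irregular_def
  proof
    fix d
    obtain l where l: "\<And>i. i < N \<Longrightarrow> (\<lambda>k. control_points N S d k i) \<longlonglongrightarrow> l" using pts by blast
    have unif: "uniform_limit X (\<lambda>m p. \<Sum>i<N. placed L (basic_limit_function c (Suc (Suc m))) i p *\<^sub>R v m i)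
        (\<lambda>p. \<Sum>i<N. placed L \<phi> i p *\<^sub>R v' i) sequentially"
      if v: "\<And>i. i < N \<Longrightarrow> (\<lambda>m. v m i) \<longlonglongrightarrow> v' i" for v and v' :: "nat \<Rightarrow> real^3"
    proof (rule uniform_limit_combination[OF _ _ \<epsilon>2 v])
      show "\<bar>placed L (basic_limit_function c (Suc (Suc m))) i p - placed L \<phi> i p\<bar> \<le> \<epsilon> (Suc (Suc m))" for m i p
        using placed_phi[of "Suc (Suc m)" i p] by simp
      show "\<bar>placed L \<phi> i p\<bar> \<le> K" for i p
        using placed_K[of i p] by simp
    qed
    have sum1: "(\<Sum>i<N. placed L (basic_limit_function c (Suc (Suc m))) i p) = \<alpha> (Suc (Suc m))" if "p \<in> X" for m p
    proof -
      obtain s j y where p: "p = (s, j, y)" by (cases p)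
      then have sj: "s < n" "j < 3" "y \<in> cell M 1 j" using that by (auto simp: X_def ring_domain_def)
      have "(\<Sum>i<N. Phi L c (Suc (Suc m)) s j i ((2 / 2 ^ Suc (Suc m)) *\<^sub>R y)) = \<alpha> (Suc (Suc m))"
        by (rule const[OF sj(1,2)]) (simp only: cell_scale_iff sj(3))
      then show ?thesis by (simp add: Phi_eq_placed p)
    qed
    have sum_lim: "(\<lambda>m. \<alpha> (Suc (Suc m))) \<longlonglongrightarrow> (\<Sum>i<N. placed L \<phi> i p)" if p: "p \<in> X" for p
    proof -
      have "(\<lambda>m. placed L (basic_limit_function c (Suc (Suc m))) i p) \<longlonglongrightarrow> placed L \<phi> i p" for i
        by (rule LIM_zero_cancel, rule Lim_null_comparison[OF _ \<epsilon>2], rule always_eventually, rule allI, rule placed_phi) simp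
      then have "(\<lambda>m. \<Sum>i<N. placed L (basic_limit_function c (Suc (Suc m))) i p) \<longlonglongrightarrow> (\<Sum>i<N. placed L \<phi> i p)"
        by (intro tendsto_sum)
      then show ?thesis by (simp only: sum1[OF p])
    qed
    \<comment> \<open>The sums at level \<open>Suc (Suc m)\<close> are one number for the whole
      ring, so their limit is one number \<open>a\<close> too. It need not be 1, and the limit point
      is \<open>a *\<^sub>R l\<close>.\<close>
    define a where "a = (\<Sum>i<N. placed L \<phi> i (0, 0, (1, 0)))"
    have a: "(\<Sum>i<N. placed L \<phi> i p) = a" if "p \<in> X" for p
      unfolding a_def using LIMSEQ_unique[OF sum_lim[OF that] sum_lim[OF p0]] .
    have "(\<lambda>m. control_points N S d (Suc (Suc m)) i) \<longlonglongrightarrow> l" if "i < N" for i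
      using LIMSEQ_ignore_initial_segment[OF l[OF that], of 2] by simp
    from unif[OF this] have lim: "uniform_limit X
        (\<lambda>m p. \<Sum>i<N. placed L (basic_limit_function c (Suc (Suc m))) i p *\<^sub>R control_points N S d (Suc (Suc m)) i)
        (\<lambda>p. \<Sum>i<N. placed L \<phi> i p *\<^sub>R l) sequentially" .
    show "\<exists>rc. \<forall>\<epsilon>>0. \<forall>\<^sub>F k in sequentially. \<forall>(s, j, x)\<in>ring_domain M n k.
        infnorm (ring_patch N L c S d k s j x - rc) < \<epsilon>"
    proof (intro exI[of _ "a *\<^sub>R l"] allI impI)
      fix e :: real assume "0 < e"
      show "\<forall>\<^sub>F k in sequentially. \<forall>(s, j, x)\<in>ring_domain M n k. infnorm (ring_patch N L c S d k s j x - a *\<^sub>R l) < e"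
      proof (rule shift, rule eventually_mono[OF uniform_limitD[OF lim \<open>0 < e\<close>]])
        fix m assume *: "\<forall>p\<in>X. dist (\<Sum>i<N. placed L (basic_limit_function c (Suc (Suc m))) i p *\<^sub>R control_points N S d (Suc (Suc m)) i)
            (\<Sum>i<N. placed L \<phi> i p *\<^sub>R l) < e"
        have "infnorm (ring_patch N L c S d (Suc (Suc m)) s j x - a *\<^sub>R l) < e"
          if "(s, j, x) \<in> ring_domain M n (Suc (Suc m))" for s j x
        proof (rule le_less_trans[OF infnorm_le_norm])
          have p: "(s, j, (2 ^ Suc (Suc m) / 2) *\<^sub>R x) \<in> X" by (rule in_X[OF that])
          have "(\<Sum>i<N. placed L \<phi> i (s, j, (2 ^ Suc (Suc m) / 2) *\<^sub>R x) *\<^sub>R l) = a *\<^sub>R l"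
            unfolding a[OF p, symmetric] by (rule scaleR_left.sum[symmetric])
          then show "norm (ring_patch N L c S d (Suc (Suc m)) s j x - a *\<^sub>R l) < e"
            using bspec[OF * p] unfolding ring_patch_def Phi_eq_placed dist_norm by (simp only:)
        qed
        then show "\<forall>(s, j, x)\<in>ring_domain M n (Suc (Suc m)). infnorm (ring_patch N L c S d (Suc (Suc m)) s j x - a *\<^sub>R l) < e"
          by blast
      qed
    qed
  qed

  \<comment> \<open>The Jacobian of the characteristic map\<close>
  define g where "g v i p = blinfun_apply (placed L \<phi>' i p) v" for v i p
  define J where "J s j x = (\<Sum>i<N. g (1, 0) i (s, j, x) * vec_index y0 i) * (\<Sum>i<N. g (0, 1) i (s, j, x) * vec_index y1 i)
      - (\<Sum>i<N. g (1, 0) i (s, j, x) * vec_index y1 i) * (\<Sum>i<N. g (0, 1) i (s, j, x) * vec_index y0 i)" for s j x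
  have J: "characteristic_det N L (\<lambda>_. cbar) y0 y1 s j x = J s j x" for s j x
    unfolding characteristic_det_def J_def g_def
    using planar_component_partials[where c = "\<lambda>_. cbar", OF \<phi>'(2)[unfolded \<phi>_def]] by simp
  obtain e where e: "e \<noteq> 0" "\<And>s j x. (s, j, x) \<in> X \<Longrightarrow> sgn (J s j x) = e"
    using i(6) unfolding regular_characteristic_map_def J X_def by blast
  have J_cont: "continuous_on UNIV (J s j)" for s j
    unfolding J_def g_def by (intro continuous_intros continuous_on_placed \<phi>')
  have J_nz: "J s j x \<noteq> 0" if "(s, j, x) \<in> ring_domain M n 1" for s j x
    using e that unfolding X_def by fastforce
  obtain \<delta> where \<delta>: "0 < \<delta>" "\<And>s j x. (s, j, x) \<in> X \<Longrightarrow> \<delta> \<le> \<bar>J s j x\<bar>"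
    using ring_domain_lower_bound[of J M n, OF J_cont J_nz] unfolding X_def by blast

  \<comment> \<open>Limits of the normals for given initial points\<close>
  have normals: "(\<forall>\<^sub>F k in sequentially. \<forall>(s, j, x)\<in>ring_domain M n k.
            normal_direction (ring_patch N L c S d k s j) x \<noteq> 0) \<and>
        (\<exists>!n_inf. \<forall>\<epsilon>>0. \<forall>\<^sub>F k in sequentially. \<forall>(s, j, x)\<in>ring_domain M n k.
            infnorm (unit_normal (ring_patch N L c S d k s j) x - n_inf) < \<epsilon>)"
    if w0: "cross3 (\<Sum>t<N. A t *\<^sub>R d t) (\<Sum>t<N. B t *\<^sub>R d t) \<noteq> 0" for d :: "nat \<Rightarrow> real^3"
  proof -
    define a b where "a = (\<Sum>t<N. A t *\<^sub>R d t)" and "b = (\<Sum>t<N. B t *\<^sub>R d t)"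
    define w where "w = cross3 a b"
    define z' where "z' i = vec_index y0 i *\<^sub>R a + vec_index y1 i *\<^sub>R b" for i
    obtain q where q: "\<And>i. i < N \<Longrightarrow> (\<lambda>k. (control_points N S d (Suc k) i - q k) /\<^sub>R lam1 ^ k) \<longlonglongrightarrow> z' i"
      using asym[of d] unfolding z'_def a_def b_def by blast
    \<comment> \<open>Rescaled control points. Subtracting the common vector \<open>q\<close> leaves
      the derivatives of the ring unchanged, and dividing by the power of \<open>lam1\<close> yields
      a convergent sequence.\<close>
    define z where "z m i = (control_points N S d (Suc (Suc m)) i - q (Suc m)) /\<^sub>R lam1 ^ Suc m" for m i
    have z: "(\<lambda>m. z m i) \<longlonglongrightarrow> z' i" if "i < N" for i
      unfolding z_def using LIMSEQ_ignore_initial_segment[OF q[OF that], of 1] by simp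
    have cancel: "lam1 ^ Suc m *\<^sub>R (r *\<^sub>R (u /\<^sub>R lam1 ^ Suc m)) = r *\<^sub>R u" for m r and u :: "real^3"
      using lam by (simp add: field_simps)
    define U where "U v m p = (\<Sum>i<N. blinfun_apply (placed L (\<phi>k' (Suc (Suc m))) i p) v *\<^sub>R z m i)" for v m p
    define U' where "U' v p = (\<Sum>i<N. g v i p *\<^sub>R z' i)" for v p
    have g_bound: "\<bar>g v i p\<bar> \<le> K" if "norm v = 1" for v i p
      using norm_blinfun[of "placed L \<phi>' i p" v] placed_K'[of i p] that by (simp add: g_def)
    have U_lim: "uniform_limit X (U v) (U' v) sequentially" if v: "norm v = 1" for v
      unfolding U_def U'_def
    proof (rule uniform_limit_combination[OF _ g_bound[OF v] \<epsilon>2 z])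
      fix m i p
      have "\<bar>blinfun_apply (placed L (\<phi>k' (Suc (Suc m))) i p - placed L \<phi>' i p) v\<bar> \<le> \<epsilon> (Suc (Suc m))"
        using norm_blinfun[of "placed L (\<phi>k' (Suc (Suc m))) i p - placed L \<phi>' i p" v]
          placed_phi'[of "Suc (Suc m)" i p] v by simp
      then show "\<bar>blinfun_apply (placed L (\<phi>k' (Suc (Suc m))) i p) v - g v i p\<bar> \<le> \<epsilon> (Suc (Suc m))"
        by (simp add: g_def blinfun.diff_left)
    qed
    have U_bdd: "bounded (U' v ` X)" if v: "norm v = 1" for v
    proof (rule boundedI)
      fix u assume "u \<in> U' v ` X"
      then obtain p where u: "u = U' v p" by blast
      have "norm (g v i p *\<^sub>R z' i) \<le> K * norm (z' i)" for i
        using mult_right_mono[OF g_bound[OF v, of i p] norm_ge_zero[of "z' i"]] by simp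
      then have "norm (U' v p) \<le> (\<Sum>i<N. K * norm (z' i))"
        unfolding U'_def by (intro order_trans[OF norm_sum] sum_mono)
      then show "norm u \<le> (\<Sum>i<N. K * norm (z' i))" by (simp add: u)
    qed
    have U'_eq: "U' v p = (\<Sum>i<N. g v i p * vec_index y0 i) *\<^sub>R a + (\<Sum>i<N. g v i p * vec_index y1 i) *\<^sub>R b" for v p
      by (simp add: U'_def z'_def scaleR_add_right sum.distrib scaleR_left.sum)
    have v1: "norm (1 :: real, 0 :: real) = 1" "norm (0 :: real, 1 :: real) = 1" by (simp_all add: norm_Pair)
    \<comment> \<open>Both limits lie in the span of \<open>a\<close> and \<open>b\<close>; the
      squares \<open>a \<times> a\<close> and \<open>b \<times> b\<close> vanish and the mixed terms
      combine to the Jacobian.\<close>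
    have cross: "cross3 (U' (1, 0) p) (U' (0, 1) p) = (\<lambda>(s, j, x). J s j x) p *\<^sub>R w" for p
      unfolding U'_eq w_def J_def
      by (cases p) (simp add: cross_add_left cross_add_right cross_mult_left cross_mult_right cross_refl
        cross_skew[of b a] algebra_simps)
    have key: "\<forall>\<^sub>F m in sequentially. \<forall>p\<in>X. cross3 (U (1, 0) m p) (U (0, 1) m p) \<noteq> 0 \<and>
        norm (sgn (cross3 (U (1, 0) m p) (U (0, 1) m p)) - e *\<^sub>R sgn w) < r" if "0 < r" for r
      by (rule uniform_unit_normals[OF U_lim U_lim U_bdd U_bdd cross _ \<delta>(1) _ _ that])
        (use v1 w0 \<delta>(2) e(2) in \<open>auto simp: w_def a_def b_def\<close>)
    \<comment> \<open>Each partial derivative contributes one factor from the dilation and one from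
      \<open>lam1\<close>. Their squared product is positive and disappears in the unit
      normal.\<close>
    have normal: "normal_direction (ring_patch N L c S d (Suc (Suc m)) s j) x =
        (2 ^ Suc (Suc m) / 2 * lam1 ^ Suc m)\<^sup>2 *\<^sub>R cross3 (U (1, 0) m (s, j, (2 ^ Suc (Suc m) / 2) *\<^sub>R x)) (U (0, 1) m (s, j, (2 ^ Suc (Suc m) / 2) *\<^sub>R x))"
      if x: "(s, j, x) \<in> ring_domain M n (Suc (Suc m))" for m s j x
    proof -
      define p where "p = (s, j, (2 ^ Suc (Suc m) / 2) *\<^sub>R x)"
      have sj: "s < n" "j < 3" "(2 ^ Suc (Suc m) / 2) *\<^sub>R x \<in> cell M 1 j"
        using in_X[OF x] by (auto simp: X_def ring_domain_def simp del: scaleR_Pair)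
      have d: "(basic_limit_function c (Suc (Suc m)) has_derivative blinfun_apply (\<phi>k' (Suc (Suc m)) x)) (at x)" for x
        by (rule \<phi>k') simp
      have zero: "(\<Sum>i<N. blinfun_apply (placed L (\<phi>k' (Suc (Suc m))) i p) (1, 0)) = 0"
        "(\<Sum>i<N. blinfun_apply (placed L (\<phi>k' (Suc (Suc m))) i p) (0, 1)) = 0"
        unfolding p_def by (rule sum_placed_derivative_zero[OF d _ sj(2,3)], rule const[OF sj(1,2)], assumption)+
      have U_eq: "(\<Sum>i<N. blinfun_apply (placed L (\<phi>k' (Suc (Suc m))) i p) v *\<^sub>R control_points N S d (Suc (Suc m)) i) =
          lam1 ^ Suc m *\<^sub>R U v m p" if "(\<Sum>i<N. blinfun_apply (placed L (\<phi>k' (Suc (Suc m))) i p) v) = 0" for v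
      proof -
        have "lam1 ^ Suc m *\<^sub>R U v m p = (\<Sum>i<N. blinfun_apply (placed L (\<phi>k' (Suc (Suc m))) i p) v *\<^sub>R
            (control_points N S d (Suc (Suc m)) i - q (Suc m)))"
          unfolding U_def z_def scaleR_right.sum by (intro sum.cong refl cancel)
        also have "\<dots> = (\<Sum>i<N. blinfun_apply (placed L (\<phi>k' (Suc (Suc m))) i p) v *\<^sub>R control_points N S d (Suc (Suc m)) i)
            - (\<Sum>i<N. blinfun_apply (placed L (\<phi>k' (Suc (Suc m))) i p) v) *\<^sub>R q (Suc m)"
          by (simp add: scaleR_diff_right sum_subtractf scaleR_left.sum del: control_points.simps)
        finally show ?thesis using that by simp
      qed
      have "partial_u (ring_patch N L c S d (Suc (Suc m)) s j) x =
          (2 ^ Suc (Suc m) / 2) *\<^sub>R (lam1 ^ Suc m *\<^sub>R U (1, 0) m p)"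
        unfolding U_eq[OF zero(1), symmetric] unfolding p_def by (rule ring_patch_partials(1)[OF d])
      moreover have "partial_v (ring_patch N L c S d (Suc (Suc m)) s j) x =
          (2 ^ Suc (Suc m) / 2) *\<^sub>R (lam1 ^ Suc m *\<^sub>R U (0, 1) m p)"
        unfolding U_eq[OF zero(2), symmetric] unfolding p_def by (rule ring_patch_partials(2)[OF d])
      ultimately show ?thesis
        unfolding normal_direction_def p_def[symmetric]
        by (simp only: cross_mult_left cross_mult_right power2_eq_square scaleR_scaleR)
    qed
    have key1: "\<forall>\<^sub>F m in sequentially. \<forall>p\<in>X. cross3 (U (1, 0) m p) (U (0, 1) m p) \<noteq> 0"
      by (rule eventually_mono[OF key[of 1]]) auto
    have pos: "0 < (2 ^ Suc (Suc m) / 2 * lam1 ^ Suc m)\<^sup>2" for m using lam by simp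
    have "\<forall>\<^sub>F k in sequentially. \<forall>(s, j, x)\<in>ring_domain M n k. normal_direction (ring_patch N L c S d k s j) x \<noteq> 0"
    proof (rule shift, rule eventually_mono[OF key1])
      fix m assume *: "\<forall>p\<in>X. cross3 (U (1, 0) m p) (U (0, 1) m p) \<noteq> 0"
      have "normal_direction (ring_patch N L c S d (Suc (Suc m)) s j) x \<noteq> 0"
        if "(s, j, x) \<in> ring_domain M n (Suc (Suc m))" for s j x
        unfolding normal[OF that] using bspec[OF * in_X[OF that]] pos[of m] by (simp only: scaleR_eq_0_iff) simp
      then show "\<forall>(s, j, x)\<in>ring_domain M n (Suc (Suc m)). normal_direction (ring_patch N L c S d (Suc (Suc m)) s j) x \<noteq> 0"
        by blast
    qed
    moreover have lim: "\<forall>\<^sub>F k in sequentially. \<forall>(s, j, x)\<in>ring_domain M n k.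
            infnorm (unit_normal (ring_patch N L c S d k s j) x - e *\<^sub>R sgn w) < r" if "0 < r" for r
    proof (rule shift, rule eventually_mono[OF key[OF that]])
      fix m assume *: "\<forall>p\<in>X. cross3 (U (1, 0) m p) (U (0, 1) m p) \<noteq> 0 \<and>
        norm (sgn (cross3 (U (1, 0) m p) (U (0, 1) m p)) - e *\<^sub>R sgn w) < r"
      have "infnorm (unit_normal (ring_patch N L c S d (Suc (Suc m)) s j) x - e *\<^sub>R sgn w) < r"
        if x: "(s, j, x) \<in> ring_domain M n (Suc (Suc m))" for s j x
      proof (rule le_less_trans[OF infnorm_le_norm])
        have "unit_normal (ring_patch N L c S d (Suc (Suc m)) s j) x =
            sgn (cross3 (U (1, 0) m (s, j, (2 ^ Suc (Suc m) / 2) *\<^sub>R x)) (U (0, 1) m (s, j, (2 ^ Suc (Suc m) / 2) *\<^sub>R x)))"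
          unfolding unit_normal_def sgn_div_norm[symmetric] normal[OF x] sgn_scaleR sgn_pos[OF pos] by simp
        then show "norm (unit_normal (ring_patch N L c S d (Suc (Suc m)) s j) x - e *\<^sub>R sgn w) < r"
          using bspec[OF * in_X[OF x]] by (simp only:)
      qed
      then show "\<forall>(s, j, x)\<in>ring_domain M n (Suc (Suc m)).
          infnorm (unit_normal (ring_patch N L c S d (Suc (Suc m)) s j) x - e *\<^sub>R sgn w) < r"
        by blast
    qed
    \<comment> \<open>Uniqueness rests on the rings being non-empty: one point of a late ring has a
      normal close to both candidates.\<close>
    moreover have "n_inf = e *\<^sub>R sgn w"
      if n_inf: "\<forall>\<epsilon>>0. \<forall>\<^sub>F k in sequentially. \<forall>(s, j, x)\<in>ring_domain M n k.
            infnorm (unit_normal (ring_patch N L c S d k s j) x - n_inf) < \<epsilon>" for n_inf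
    proof (rule ccontr)
      assume "n_inf \<noteq> e *\<^sub>R sgn w"
      define r where "r = infnorm (n_inf - e *\<^sub>R sgn w) / 2"
      have "0 < r" using \<open>n_inf \<noteq> e *\<^sub>R sgn w\<close> by (simp add: r_def infnorm_pos_lt)
      have "\<forall>\<^sub>F k in sequentially. (\<forall>(s, j, x)\<in>ring_domain M n k. infnorm (unit_normal (ring_patch N L c S d k s j) x - n_inf) < r) \<and>
          (\<forall>(s, j, x)\<in>ring_domain M n k. infnorm (unit_normal (ring_patch N L c S d k s j) x - e *\<^sub>R sgn w) < r)"
        using n_inf lim \<open>0 < r\<close> by (intro eventually_conj) auto
      then obtain k where k: "\<forall>(s, j, x)\<in>ring_domain M n k. infnorm (unit_normal (ring_patch N L c S d k s j) x - n_inf) < r"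
          "\<forall>(s, j, x)\<in>ring_domain M n k. infnorm (unit_normal (ring_patch N L c S d k s j) x - e *\<^sub>R sgn w) < r"
        using eventually_happens'[OF sequentially_bot] by blast
      define u where "u = unit_normal (ring_patch N L c S d k 0 0) (2 / 2 ^ k, 0)"
      have "infnorm (u - n_inf) < r" "infnorm (u - e *\<^sub>R sgn w) < r"
        using bspec[OF k(1) ring_domain_nonempty[OF n]] bspec[OF k(2) ring_domain_nonempty[OF n]] by (simp_all add: u_def)
      moreover have "infnorm (n_inf - e *\<^sub>R sgn w) \<le> infnorm (n_inf - u) + infnorm (u - e *\<^sub>R sgn w)"
        using infnorm_triangle[of "n_inf - u" "u - e *\<^sub>R sgn w"] by simp
      ultimately show False by (simp add: r_def infnorm_sub[of n_inf u])
    qed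
    ultimately show ?thesis by blast
  qed

  \<comment> \<open>Almost all initial points\<close>
  have "normal_continuous M n N L c S"
    unfolding normal_continuous_def
  proof -
    obtain i j where "i < N" "j < N" "A i * B j - A j * B i \<noteq> 0" using AB by blast
    from AE_combinations_cross_nonzero[OF this]
    show "AE d in PiM {..<N} (\<lambda>_. lborel).
        (\<forall>\<^sub>F k in sequentially. \<forall>(s, j, x)\<in>ring_domain M n k.
            normal_direction (ring_patch N L c S d k s j) x \<noteq> 0) \<and>
        (\<exists>!n_inf. \<forall>\<epsilon>>0. \<forall>\<^sub>F k in sequentially. \<forall>(s, j, x)\<in>ring_domain M n k.
            infnorm (unit_normal (ring_patch N L c S d k s j) x - n_inf) < \<epsilon>)"
      by (rule AE_mp) (rule AE_I2, rule impI, rule normals)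
  qed
  then show ?thesis using regular(1) irregular by blast
qed

end
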